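(* Let $Z:\Gamma\to\mathbb{C}$ be a rational central charge of rank $2$, i.e. $Z(\Gamma)\subset\mathbb{Z}^2\subset\mathbb{R}^2=\mathbb{C}$ and $Z_{\mathbb{R}}(\Gamma_{\mathbb{R}})=\mathbb{C}$. Let $V\subset\mathbb{R}^2$ be a closed rational admissible sector, and let $V=V_1\cup V_2$ be a decomposition of $V$ into the union of two closed rational admissible sectors with a common boundary ray $l_{12}$. Then $$G_V^{an}=G_{V_1}^{an}\,G_{V_2}^{an}$$ (product of subsets in the group $G_V$).
   Context: Let $\Gamma$ be a free abelian group of finite rank $n$, $\Gamma_{\mathbb{R}}=\Gamma\otimes\mathbb{R}$. Let $\mathbf{T}_\Gamma=\mathrm{Hom}(\Gamma,\mathbb{C}^* )$ with monomial functions $x^\gamma$, $\gamma\in\Gamma$, and let $\mathfrak{g}=\mathrm{Vect}_\Gamma=\bigoplus_{\gamma\in\Gamma}\mathfrak{g}_\gamma$ be the $\Gamma$-graded complex Lie algebra of algebraic vector fields on $\mathbf{T}_\Gamma$ (derivations of $\mathbb{C}[\Gamma]$); $\mathfrak{g}_\gamma$ is spanned by $x^\gamma x_i\partial_{x_i}$, $1\le i\le n$, for coordinates $x_i$ given by a basis of $\Gamma$. A cone is strict if it contains no straight line. For a closed strict convex cone $C\subset\Gamma_{\mathbb{R}}$ put $\mathfrak{g}_C=\prod_{\gamma\in C\cap\Gamma-\{0\}}\mathfrak{g}_\gamma$ (a pronilpotent Lie algebra) and $G_C=\exp(\mathfrak{g}_C)$. An element $g\in G_C$ acts as an automorphism with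 $g(x^\gamma)=x^\gamma\bigl(1+\sum_{\mu\in C\cap\Gamma-\{0\}}c_{\gamma\mu}x^\mu\bigr)$ for $\gamma\in\Gamma$. A series $\sum_{\mu\in C\cap \Gamma}c_\mu x^\mu$ is called analytic if it converges absolutely at some point of $\mathbf{T}_\Gamma$ (equivalently, its coefficients satisfy an exponential bound $|c_\mu|\le R^{\|\mu\|}$, $\mu\neq 0$, for some $R>0$). An element $g\in G_C$ is analytic if $g(x^\gamma)/x^\gamma$ is analytic for all $\gamma\in\Gamma$. An admissible sector is a set $V=\{re^{i\theta}: r>0,\theta\in S\}\subset\mathbb{R}^2-\{0\}$ with $S\subset\mathbb{R}$ a non-empty connected set of length $<\pi$, or an open interval of length $\pi$; $V$ is closed if $S$ is closed; $V$ is rational if its boundary rays are rational, i.e. spanned by vectors of $\mathbb{Z}^2$. $Z_{\mathbb{R}}:\Gamma_{\mathbb{R}}\to\mathbb{C}$ is the $\mathbb{R}$-linear extension of $Z$. For a closed admissible sector $V$, $G_V=G_{V,Z}=\varinjlim_C G_C$, the inductive limit (by inclusions of cones) over closed strict convex cones $C\subset\Gamma_{\mathbb{R}}$ with $Z_{\mathbb{R}}(C-\{0\})\subset V$ and $C\cap\mathrm{Ker}\,Z_{\mathbb{R}}=\{0\}$. $G_V^{an}\subset G_V$ is the subgroup of elements that are images of analytic elements of some such $G_C$. *)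

theory Defs
  imports "HOL-Analysis.Analysis" "HOL-Algebra.Coset"
begin

text \<open>
  A basis of the free abelian group \<open>\<Gamma>\<close> of rank \<open>n\<close> is fixed: \<open>\<Gamma> = int ^ 'n\<close>,
  \<open>\<Gamma>\<^sub>\<real> = real ^ 'n\<close>, with \<open>n = CARD('n)\<close>.
\<close>

type_synonym 'n lattice = "int ^ 'n"

definition lattice_emb :: "'n::finite lattice \<Rightarrow> real ^ 'n" where
  "lattice_emb \<gamma> = (\<chi> i. real_of_int (\<gamma> $ i))"

definition torus :: "('n::finite lattice \<Rightarrow> complex) set" where
  "torus = {t. (\<forall>\<gamma>. t \<gamma> \<noteq> 0) \<and> (\<forall>\<gamma> \<delta>. t (\<gamma> + \<delta>) = t \<gamma> * t \<delta>)}"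

text \<open>
  A formal vector field \<open>v\<close> is given by its homogeneous components:
  \<open>v \<delta> $ i\<close> is the coefficient of \<open>x\<^sup>\<delta> x\<^sub>i \<partial>/\<partial>x\<^sub>i\<close>, so that
  \<open>v \<delta>\<close> represents an element of \<open>\<gg>\<^sub>\<delta>\<close>.

  An operator \<open>A\<close> on formal series is given by its matrix: \<open>A \<gamma> \<nu>\<close> is the coefficient of
  \<open>x\<^sup>\<nu>\<close> in \<open>A(x\<^sup>\<gamma>)\<close>.
\<close>

type_synonym 'n vfield = "'n lattice \<Rightarrow> complex ^ 'n"

type_synonym 'n operator = "'n lattice \<Rightarrow> 'n lattice \<Rightarrow> complex"

text \<open>The derivation sends \<open>x\<^sup>\<gamma>\<close> to \<open>\<Sum>\<delta>. (\<Sum>i. v \<delta> $ i * \<gamma> $ i) x\<^bsup>\<gamma> + \<delta>\<^esup>\<close>.\<close>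

definition derivation :: "'n::finite vfield \<Rightarrow> 'n operator" where
  "derivation v \<gamma> \<nu> = (\<Sum>i\<in>UNIV. v (\<nu> - \<gamma>) $ i * of_int (\<gamma> $ i))"

definition op_one :: "'n::finite operator" where
  "op_one \<gamma> \<nu> = (if \<gamma> = \<nu> then 1 else 0)"

text \<open>
  Composition \<open>A \<circ> B\<close>, i.e. \<open>(A \<circ> B)(x\<^sup>\<gamma>) = A(B(x\<^sup>\<gamma>))\<close>. For operators graded by a common
  strict closed convex cone only finitely many terms are nonzero.
\<close>

definition op_comp :: "'n::finite operator \<Rightarrow> 'n operator \<Rightarrow> 'n operator" where
  "op_comp A B \<gamma> \<nu> =
     (\<Sum>\<mu> | B \<gamma> \<mu> * A \<mu> \<nu> \<noteq> 0. B \<gamma> \<mu> * A \<mu> \<nu>)"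

text \<open>
  For \<open>v\<close> supported in a strict closed convex cone minus the origin, the derivation is pronilpotent,
  hence each entry of the following series has only finitely many nonzero terms.
\<close>

definition op_exp :: "'n::finite operator \<Rightarrow> 'n operator" where
  "op_exp A \<gamma> \<nu> = (\<Sum>k. ((op_comp A ^^ k) op_one) \<gamma> \<nu> / fact k)"

definition strict :: "(real ^ 'n::finite) set \<Rightarrow> bool" where
  "strict C \<longleftrightarrow> \<not> (\<exists>p d. d \<noteq> 0 \<and> (\<forall>t::real. p + t *\<^sub>R d \<in> C))"

definition g_cone :: "(real ^ 'n::finite) set \<Rightarrow> 'n vfield set" where
  "g_cone C = {v. \<forall>\<delta>. v \<delta> \<noteq> 0 \<longrightarrow> \<delta> \<noteq> 0 \<and> lattice_emb \<delta> \<in> C}"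

text \<open>
  The action of the Lie algebra \<open>\<gg>\<^sub>C\<close> by derivations is faithful, and so is that of the
  pronilpotent group \<open>exp(\<gg>\<^sub>C)\<close>; group elements are identified with the automorphisms they induce.
  The matrix of such an automorphism does not depend on the cone, so that for \<open>C \<subseteq> C'\<close> the
  inclusion of \<open>exp(\<gg>\<^sub>C)\<close> into \<open>exp(\<gg>\<^bsub>C'\<^esub>)\<close> becomes an inclusion of sets.
\<close>

definition G_cone :: "(real ^ 'n::finite) set \<Rightarrow> 'n operator set" where
  "G_cone C = (\<lambda>v. op_exp (derivation v)) ` g_cone C"

definition analytic_series :: "('n::finite lattice \<Rightarrow> complex) \<Rightarrow> bool" where
  "analytic_series c \<longleftrightarrow> (\<exists>t\<in>torus. (\<lambda>\<mu>. norm (c \<mu> * t \<mu>)) summable_on UNIV)"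

text \<open>The coefficient of \<open>x\<^sup>\<mu>\<close> in \<open>g(x\<^sup>\<gamma>)/x\<^sup>\<gamma>\<close> is \<open>g \<gamma> (\<gamma> + \<mu>)\<close>.\<close>

definition analytic_op :: "'n::finite operator \<Rightarrow> bool" where
  "analytic_op g \<longleftrightarrow> (\<forall>\<gamma>. analytic_series (\<lambda>\<mu>. g \<gamma> (\<gamma> + \<mu>)))"

definition sector :: "real set \<Rightarrow> complex set" where
  "sector S = {of_real r * cis \<theta> | r \<theta>. r > 0 \<and> \<theta> \<in> S}"

definition admissible_angles :: "real set \<Rightarrow> bool" where
  "admissible_angles S \<longleftrightarrow> S \<noteq> {} \<and> connected S \<and>
     (bounded S \<and> diameter S < pi \<or> (\<exists>a. S = {a<..<a + pi}))"

definition closed_admissible_sector :: "complex set \<Rightarrow> bool" where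
  "closed_admissible_sector V \<longleftrightarrow> (\<exists>S. admissible_angles S \<and> closed S \<and> V = sector S)"

definition ray :: "complex \<Rightarrow> complex set" where
  "ray u = {of_real r * u | r. r > 0}"

definition boundary_ray :: "complex set \<Rightarrow> complex set \<Rightarrow> bool" where
  "boundary_ray l V \<longleftrightarrow> (\<exists>u. u \<noteq> 0 \<and> l = ray u) \<and> l \<subseteq> frontier V"

definition rational_ray :: "complex set \<Rightarrow> bool" where
  "rational_ray l \<longleftrightarrow> (\<exists>u. u \<noteq> 0 \<and> Re u \<in> \<int> \<and> Im u \<in> \<int> \<and> l = ray u)"

definition rational_sector :: "complex set \<Rightarrow> bool" where
  "rational_sector V \<longleftrightarrow> (\<forall>l. boundary_ray l V \<longrightarrow> rational_ray l)"

definition central_charge :: "('n::finite lattice \<Rightarrow> complex) \<Rightarrow> bool" where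
  "central_charge Z \<longleftrightarrow> (\<forall>\<gamma> \<delta>. Z (\<gamma> + \<delta>) = Z \<gamma> + Z \<delta>)"

definition Z_real :: "('n::finite lattice \<Rightarrow> complex) \<Rightarrow> real ^ 'n \<Rightarrow> complex" where
  "Z_real Z x = (\<Sum>i\<in>UNIV. (x $ i) *\<^sub>R Z (axis i 1))"

definition rational_rank2 :: "('n::finite lattice \<Rightarrow> complex) \<Rightarrow> bool" where
  "rational_rank2 Z \<longleftrightarrow>
     central_charge Z \<and> (\<forall>\<gamma>. Re (Z \<gamma>) \<in> \<int> \<and> Im (Z \<gamma>) \<in> \<int>) \<and> range (Z_real Z) = UNIV"

definition sector_cones ::
    "('n::finite lattice \<Rightarrow> complex) \<Rightarrow> complex set \<Rightarrow> (real ^ 'n) set set" where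
  "sector_cones Z V = {C. closed C \<and> convex C \<and> cone C \<and> strict C \<and>
     Z_real Z ` (C - {0}) \<subseteq> V \<and> C \<inter> {x. Z_real Z x = 0} = {0}}"

text \<open>
  The cones attached to a closed admissible sector are directed by inclusion (\<open>C + C'\<close> is an
  upper bound), and the transition maps are inclusions, so the inductive limit is the union.
\<close>

definition G_sector ::
    "('n::finite lattice \<Rightarrow> complex) \<Rightarrow> complex set \<Rightarrow> 'n operator monoid" where
  "G_sector Z V =
     \<lparr>carrier = (\<Union>C\<in>sector_cones Z V. G_cone C), mult = op_comp, one = op_one\<rparr>"

definition G_an :: "('n::finite lattice \<Rightarrow> complex) \<Rightarrow> complex set \<Rightarrow> 'n operator set" where
  "G_an Z V = (\<Union>C\<in>sector_cones Z V. {g \<in> G_cone C. analytic_op g})"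

end

theory Submission
  imports Defs
begin

text \<open>
  An analytic automorphism \<open>g\<close> is factored by a Newton iteration. Split the linear part of \<open>g - 1\<close>,
  read off from the images of the coordinates, into its components over the two subcones, and let
  \<open>a\<close>, \<open>b\<close> be the exponentials of their negatives. Then \<open>a g b - 1\<close> is quadratic in \<open>g - 1\<close> up to a
  loss of radius of convergence. As there are no small divisors, the quadratic gain beats the loss,
  the products of the left and of the right corrections converge on a fixed polyradius to \<open>A\<close>, \<open>B\<close>
  with \<open>A g B = 1\<close>, and \<open>g = A\<^sup>-\<^sup>1 B\<^sup>-\<^sup>1\<close>. The inverses are analytic by the same
  argument with one of the cones trivial. Smallness of \<open>g - 1\<close> is obtained by shrinking the radius,
  because all its terms have positive degree.

  Elements of \<open>exp(\<gg>\<^sub>C)\<close> are recognised as the unipotent multiplicative operators graded by \<open>C\<close>;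
  this makes closure under products evident without the Campbell-Hausdorff formula.
\<close>

section \<open>Integer lattices\<close>

text \<open>Two difficulties shape the proof. The subcones overlap above the common ray, so the
  splitting is not canonical there; the convention is to give the overlap to the left factor, whence
  the pair \<open>S1\<close> and \<open>S2 - S1\<close>. And solving for the factors degree by
  degree gives no control of convergence. That control comes from a single linear degree, a multiple
  of \<open>Re (Z \<mu> * u)\<close> with \<open>u\<close> rotating the bisector of the sector onto
  the positive reals; scaled suitably it dominates the l1-norm on the lattice points of the cone. An
  operator is measured by how fast the norm of g(x^\<gamma>)/x^\<gamma> grows with \<gamma>, at most
  like \<open>exp (\<eta> * ell \<gamma>)\<close>. Moving from \<gamma> to \<gamma> + \<alpha>
  raises \<open>ell\<close> by at most \<open>deg \<alpha>\<close>, so a growth rate \<eta> is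
  interchangeable with a loss \<eta> of logarithmic radius. Hence rates simply add under
  composition, and infinitely many factors can be multiplied as long as their rates are summable.
  Splitting the linear part only discards coefficients, so it never enlarges a norm.\<close>

definition ell :: "'n::finite lattice \<Rightarrow> real" where
  "ell \<gamma> = (\<Sum>i\<in>UNIV. \<bar>real_of_int (\<gamma> $ i)\<bar>)"

lemma ell_nonneg: "0 \<le> ell \<gamma>"
  by (simp add: ell_def sum_nonneg)

lemma ell_0 [simp]: "ell 0 = 0"
  by (simp add: ell_def)

lemma ell_minus [simp]: "ell (- \<gamma>) = ell \<gamma>"
  by (simp add: ell_def)

lemma ell_add: "ell (\<gamma> + \<delta>) \<le> ell \<gamma> + ell \<delta>"
  unfolding ell_def sum.distrib[symmetric] by (intro sum_mono) auto

lemma ell_axis: "ell (axis i k) = \<bar>real_of_int k\<bar>"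
proof -
  have "ell (axis i k) = (\<Sum>j\<in>UNIV. if j = i then \<bar>real_of_int k\<bar> else 0)"
    unfolding ell_def by (intro sum.cong) (auto simp: axis_def)
  then show ?thesis by simp
qed

lemma ell_ge_comp: "\<bar>real_of_int (\<gamma> $ i)\<bar> \<le> ell \<gamma>"
  unfolding ell_def by (rule member_le_sum) auto

lemma ell_ge_1:
  assumes "\<gamma> \<noteq> 0"
  shows "1 \<le> ell \<gamma>"
proof -
  obtain i where "\<gamma> $ i \<noteq> 0"
    using assms by (auto simp: vec_eq_iff)
  then have "1 \<le> \<bar>real_of_int (\<gamma> $ i)\<bar>"
    by linarith
  then show ?thesis using ell_ge_comp[of \<gamma> i] by linarith
qed

lemma finite_ell_le: "finite {\<gamma> :: 'n::finite lattice. ell \<gamma> \<le> N}"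
proof -
  let ?B = "PiE (UNIV :: 'n set) (\<lambda>_. {-\<lceil>N\<rceil>..\<lceil>N\<rceil>})"
  have "{\<gamma> :: 'n lattice. ell \<gamma> \<le> N} \<subseteq> vec_lambda ` ?B"
  proof
    fix \<gamma> :: "'n lattice" assume "\<gamma> \<in> {\<gamma>. ell \<gamma> \<le> N}"
    then have "\<bar>real_of_int (\<gamma> $ i)\<bar> \<le> N" for i
      using ell_ge_comp[of \<gamma> i] by simp
    then have "\<gamma> $ i \<le> \<lceil>N\<rceil> \<and> - (\<gamma> $ i) \<le> \<lceil>N\<rceil>" for i
      by (simp add: abs_le_iff) (smt (verit) ceiling_mono ceiling_of_int of_int_minus)
    then have "vec_nth \<gamma> \<in> ?B" by force
    then show "\<gamma> \<in> vec_lambda ` ?B" by (metis image_eqI vec_nth_inverse)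
  qed
  moreover have "finite ?B" by (intro finite_PiE) auto
  ultimately show ?thesis by (meson finite_imageI finite_subset)
qed

text \<open>Stated for real vector spaces because it serves three additive maps: the first-order
  discrepancy of two automorphisms, the logarithm of the modulus of a torus point, and the central
  charge.\<close>

lemma additive_lattice_expand:
  fixes f :: "'n::finite lattice \<Rightarrow> 'a::real_vector"
  assumes add: "\<And>\<gamma> \<delta>. f (\<gamma> + \<delta>) = f \<gamma> + f \<delta>"
  shows "f \<gamma> = (\<Sum>i\<in>UNIV. real_of_int (\<gamma> $ i) *\<^sub>R f (axis i 1))"
proof -
  interpret additive f by unfold_locales (rule add)
  have nat: "f (axis i (int k)) = real k *\<^sub>R f (axis i 1)" for i k
  proof (induction k)
    case 0
    have "axis i (0::int) = 0" by (simp add: vec_eq_iff axis_def)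
    then show ?case by (simp only: of_nat_0 zero scaleR_zero_left)
  next
    case (Suc k)
    have "axis i (int (Suc k)) = axis i (int k) + axis i 1"
      by (simp add: vec_eq_iff axis_def)
    then show ?case using Suc by (simp add: add scaleR_left_distrib)
  qed
  have int: "f (axis i k) = real_of_int k *\<^sub>R f (axis i 1)" for i k
  proof (cases "k \<ge> 0")
    case True
    then show ?thesis using nat[of i "nat k"] by simp
  next
    case False
    have "axis i k = - axis i (int (nat (- k)))"
      using False by (simp add: vec_eq_iff axis_def)
    then show ?thesis using False nat[of i "nat (- k)"] by (simp add: minus)
  qed
  have "\<gamma> = (\<Sum>i\<in>UNIV. axis i (\<gamma> $ i))"
    by (simp add: vec_eq_iff axis_def)
  from arg_cong[OF this, of f] have "f \<gamma> = (\<Sum>i\<in>UNIV. f (axis i (\<gamma> $ i)))"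
    unfolding sum .
  also have "\<dots> = (\<Sum>i\<in>UNIV. real_of_int (\<gamma> $ i) *\<^sub>R f (axis i 1))"
    by (intro sum.cong refl int)
  finally show ?thesis .
qed

section \<open>Graded operators\<close>

definition graded :: "'n::finite lattice set \<Rightarrow> 'n operator \<Rightarrow> bool" where
  "graded S A \<longleftrightarrow> (\<forall>\<gamma> \<nu>. A \<gamma> \<nu> \<noteq> 0 \<longrightarrow> \<nu> - \<gamma> \<in> S)"

lemma graded_mono: "graded S A \<Longrightarrow> S \<subseteq> T \<Longrightarrow> graded T A"
  unfolding graded_def by blast

lemma graded_zero: "graded S A \<Longrightarrow> \<nu> - \<gamma> \<notin> S \<Longrightarrow> A \<gamma> \<nu> = 0"
  unfolding graded_def by blast

lemma graded_zero': "graded S A \<Longrightarrow> \<mu> \<notin> S \<Longrightarrow> A \<gamma> (\<gamma> + \<mu>) = 0"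
  unfolding graded_def by (metis add_diff_cancel_left')

lemma graded_diff: "graded S A \<Longrightarrow> graded S B \<Longrightarrow> graded S (A - B)"
  unfolding graded_def by (metis eq_iff_diff_eq_0 minus_apply)

lemma graded_one: "0 \<in> S \<Longrightarrow> graded S op_one"
  unfolding graded_def op_one_def by auto

locale grading =
  fixes deg :: "'n::finite lattice \<Rightarrow> real"
  assumes deg_add: "deg (\<alpha> + \<beta>) = deg \<alpha> + deg \<beta>"
begin

text \<open>
  A common home for all strict cones considered: since \<open>deg\<close> dominates the \<open>\<ell>\<^sup>1\<close>-norm on \<open>pos\<close>,
  the sets \<open>trunc N\<close> and \<open>splits \<mu>\<close> below are finite.
\<close>

definition pos :: "'n lattice set" where
  "pos = {\<mu>. ell \<mu> \<le> deg \<mu>}"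

definition trunc :: "real \<Rightarrow> 'n lattice set" where
  "trunc N = {\<mu> \<in> pos. deg \<mu> \<le> N}"

definition splits :: "'n lattice \<Rightarrow> 'n lattice set" where
  "splits \<mu> = {\<alpha> \<in> pos. \<mu> - \<alpha> \<in> pos}"

definition submonoid :: "'n lattice set \<Rightarrow> bool" where
  "submonoid S \<longleftrightarrow> 0 \<in> S \<and> S \<subseteq> pos \<and> (\<forall>\<alpha>\<in>S. \<forall>\<beta>\<in>S. \<alpha> + \<beta> \<in> S)"

text \<open>The last clause is g(x^\<gamma> x^\<gamma>') = g(x^\<gamma>) g(x^\<gamma>'), read off at
  one coefficient. The sum runs over \<open>splits \<mu>\<close> rather than over splittings inside
  \<open>S\<close>, so that only the grading clause mentions \<open>S\<close> and enlarging
  \<open>S\<close> is immediate.\<close>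

definition is_aut :: "'n lattice set \<Rightarrow> 'n operator \<Rightarrow> bool" where
  "is_aut S g \<longleftrightarrow> graded S g \<and> (\<forall>\<gamma>. g \<gamma> \<gamma> = 1) \<and> (\<forall>\<nu>. g 0 \<nu> = op_one 0 \<nu>) \<and>
     (\<forall>\<gamma> \<gamma>' \<mu>. g (\<gamma> + \<gamma>') (\<gamma> + \<gamma>' + \<mu>) =
        (\<Sum>\<alpha>\<in>splits \<mu>. g \<gamma> (\<gamma> + \<alpha>) * g \<gamma>' (\<gamma>' + (\<mu> - \<alpha>))))"

lemma deg_0 [simp]: "deg 0 = 0"
  using deg_add[of 0 0] by simp

lemma deg_diff: "deg (\<alpha> - \<beta>) = deg \<alpha> - deg \<beta>"
  using deg_add[of "\<alpha> - \<beta>" \<beta>] by simp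

lemma ell_le_deg: "\<mu> \<in> pos \<Longrightarrow> ell \<mu> \<le> deg \<mu>"
  by (simp add: pos_def)

lemma zero_pos [simp]: "0 \<in> pos"
  by (simp add: pos_def)

lemma pos_add: "\<alpha> \<in> pos \<Longrightarrow> \<beta> \<in> pos \<Longrightarrow> \<alpha> + \<beta> \<in> pos"
  using ell_add[of \<alpha> \<beta>] by (simp add: pos_def deg_add)

lemma deg_nonneg: "\<mu> \<in> pos \<Longrightarrow> 0 \<le> deg \<mu>"
  using ell_le_deg ell_nonneg by (metis order_trans)

lemma deg_ge_1: "\<mu> \<in> pos \<Longrightarrow> \<mu> \<noteq> 0 \<Longrightarrow> 1 \<le> deg \<mu>"
  using ell_le_deg ell_ge_1 by (metis order_trans)

lemma submonoid_pos: "submonoid pos"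
  by (simp add: submonoid_def pos_add)

lemma submonoid_0: "submonoid {0}"
  by (simp add: submonoid_def)

lemma submonoidD:
  assumes "submonoid S"
  shows "0 \<in> S" "S \<subseteq> pos" "\<alpha> \<in> S \<Longrightarrow> \<beta> \<in> S \<Longrightarrow> \<alpha> + \<beta> \<in> S"
  using assms by (auto simp: submonoid_def)

lemma finite_trunc [simp]: "finite (trunc N)"
proof (rule finite_subset)
  show "trunc N \<subseteq> {\<gamma>. ell \<gamma> \<le> N}"
    unfolding trunc_def using ell_le_deg by fastforce
qed (rule finite_ell_le)

lemma splitsD:
  assumes "\<alpha> \<in> splits \<mu>"
  shows "\<alpha> \<in> pos" "\<mu> - \<alpha> \<in> pos" "\<mu> \<in> pos" "deg \<alpha> \<le> deg \<mu>" "deg (\<mu> - \<alpha>) \<le> deg \<mu>"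
proof -
  show *: "\<alpha> \<in> pos" "\<mu> - \<alpha> \<in> pos"
    using assms by (auto simp: splits_def)
  show "\<mu> \<in> pos"
    using pos_add[OF *] by simp
  show "deg \<alpha> \<le> deg \<mu>" "deg (\<mu> - \<alpha>) \<le> deg \<mu>"
    using deg_nonneg[OF *(1)] deg_nonneg[OF *(2)] by (auto simp: deg_diff)
qed

lemma splits_subset: "deg \<mu> \<le> N \<Longrightarrow> splits \<mu> \<subseteq> trunc N"
  using splitsD by (force simp: trunc_def)

lemma finite_splits [simp]: "finite (splits \<mu>)"
  using splits_subset[OF order_refl] finite_trunc by (rule finite_subset)

lemma zero_splits [simp]: "0 \<in> splits \<mu> \<longleftrightarrow> \<mu> \<in> pos"
  by (simp add: splits_def)

text \<open>\<open>op_comp\<close> sums over its own nonzero terms, an index set that varies with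
  the operators. Any finite set containing all possible intermediate exponents may replace it, which
  makes different compositions comparable term by term.\<close>

lemma op_comp_eq:
  assumes A: "graded pos A" and B: "graded pos B" and F: "finite F"
    and sup: "\<And>\<kappa>. \<kappa> - \<gamma> \<in> pos \<Longrightarrow> \<nu> - \<kappa> \<in> pos \<Longrightarrow> \<kappa> \<in> F"
  shows "op_comp A B \<gamma> \<nu> = (\<Sum>\<kappa>\<in>F. B \<gamma> \<kappa> * A \<kappa> \<nu>)"
  unfolding op_comp_def
proof (rule sum.mono_neutral_left)
  show "{\<kappa>. B \<gamma> \<kappa> * A \<kappa> \<nu> \<noteq> 0} \<subseteq> F"
    using A B sup by (auto simp: graded_def)
qed (use F in auto)

lemma op_comp_splits:
  assumes A: "graded pos A" and B: "graded pos B"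
  shows "op_comp A B \<gamma> (\<gamma> + \<mu>) = (\<Sum>\<alpha>\<in>splits \<mu>. B \<gamma> (\<gamma> + \<alpha>) * A (\<gamma> + \<alpha>) (\<gamma> + \<mu>))"
proof -
  have "op_comp A B \<gamma> (\<gamma> + \<mu>) = (\<Sum>\<kappa>\<in>(+) \<gamma> ` splits \<mu>. B \<gamma> \<kappa> * A \<kappa> (\<gamma> + \<mu>))"
  proof (rule op_comp_eq[OF A B])
    fix \<kappa> assume "\<kappa> - \<gamma> \<in> pos" "\<gamma> + \<mu> - \<kappa> \<in> pos"
    then have "\<kappa> - \<gamma> \<in> splits \<mu>" by (simp add: splits_def algebra_simps)
    then show "\<kappa> \<in> (+) \<gamma> ` splits \<mu>" by (rule rev_image_eqI) simp
  qed simp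
  then show ?thesis by (simp add: sum.reindex)
qed

text \<open>The intermediate exponent is measured from \<gamma> although the operator starts at
  \<gamma> + \<alpha>. This puts both bracketings of a triple product over the same square
  \<open>splits \<mu>\<close> times \<open>splits \<mu>\<close>, so associativity becomes an
  exchange of sums.\<close>

lemma op_comp_shift:
  assumes "graded pos A" "graded pos B" "\<alpha> \<in> pos"
  shows "op_comp A B (\<gamma> + \<alpha>) (\<gamma> + \<mu>) = (\<Sum>\<kappa>\<in>splits \<mu>. B (\<gamma> + \<alpha>) (\<gamma> + \<kappa>) * A (\<gamma> + \<kappa>) (\<gamma> + \<mu>))"
proof -
  have "op_comp A B (\<gamma> + \<alpha>) (\<gamma> + \<mu>) = (\<Sum>\<kappa>\<in>(+) \<gamma> ` splits \<mu>. B (\<gamma> + \<alpha>) \<kappa> * A \<kappa> (\<gamma> + \<mu>))"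
  proof (rule op_comp_eq[OF assms(1,2)])
    fix \<kappa> assume *: "\<kappa> - (\<gamma> + \<alpha>) \<in> pos" "\<gamma> + \<mu> - \<kappa> \<in> pos"
    then have "\<kappa> - \<gamma> \<in> splits \<mu>"
      using pos_add[OF assms(3) *(1)] by (simp add: splits_def algebra_simps)
    then show "\<kappa> \<in> (+) \<gamma> ` splits \<mu>" by (rule rev_image_eqI) simp
  qed simp
  then show ?thesis by (simp add: sum.reindex)
qed

lemma graded_comp:
  assumes S: "submonoid S" and A: "graded S A" and B: "graded S B"
  shows "graded S (op_comp A B)"
  unfolding graded_def
proof (intro allI impI)
  fix \<gamma> \<nu> assume "op_comp A B \<gamma> \<nu> \<noteq> 0"
  then obtain \<kappa> where "B \<gamma> \<kappa> * A \<kappa> \<nu> \<noteq> 0"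
    unfolding op_comp_def using sum.not_neutral_contains_not_neutral by blast
  then have "\<kappa> - \<gamma> \<in> S" "\<nu> - \<kappa> \<in> S"
    using A B by (auto simp: graded_def)
  from submonoidD(3)[OF S this] show "\<nu> - \<gamma> \<in> S" by simp
qed

lemma graded_pos: "submonoid S \<Longrightarrow> graded S A \<Longrightarrow> graded pos A"
  using graded_mono submonoidD(2) by blast

lemma op_comp_one_left: "graded pos A \<Longrightarrow> op_comp op_one A = A"
proof (intro ext)
  fix \<gamma> \<nu> assume "graded pos A"
  have "op_comp op_one A \<gamma> \<nu> = (\<Sum>\<kappa>\<in>{\<kappa>. \<kappa> = \<nu> \<and> A \<gamma> \<nu> \<noteq> 0}. A \<gamma> \<kappa> * op_one \<kappa> \<nu>)"
    unfolding op_comp_def by (intro sum.cong) (auto simp: op_one_def)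
  also have "\<dots> = A \<gamma> \<nu>"
    by (cases "A \<gamma> \<nu> = 0") (auto simp: op_one_def)
  finally show "op_comp op_one A \<gamma> \<nu> = A \<gamma> \<nu>" .
qed

lemma op_comp_one_right: "graded pos A \<Longrightarrow> op_comp A op_one = A"
proof (intro ext)
  fix \<gamma> \<nu> assume "graded pos A"
  have "op_comp A op_one \<gamma> \<nu> = (\<Sum>\<kappa>\<in>{\<kappa>. \<kappa> = \<gamma> \<and> A \<gamma> \<nu> \<noteq> 0}. op_one \<gamma> \<kappa> * A \<kappa> \<nu>)"
    unfolding op_comp_def by (intro sum.cong) (auto simp: op_one_def)
  also have "\<dots> = A \<gamma> \<nu>"
    by (cases "A \<gamma> \<nu> = 0") (auto simp: op_one_def)
  finally show "op_comp A op_one \<gamma> \<nu> = A \<gamma> \<nu>" .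
qed

lemma op_comp_assoc:
  assumes A: "graded pos A" and B: "graded pos B" and C: "graded pos C"
  shows "op_comp (op_comp A B) C = op_comp A (op_comp B C)"
proof (intro ext)
  fix \<gamma> \<nu> :: "'n lattice"
  define \<mu> where "\<mu> = \<nu> - \<gamma>"
  have \<nu>: "\<nu> = \<gamma> + \<mu>" by (simp add: \<mu>_def)
  have gAB: "graded pos (op_comp A B)" and gBC: "graded pos (op_comp B C)"
    using A B C graded_comp submonoid_pos by auto
  have BC: "op_comp B C \<gamma> (\<gamma> + \<kappa>) = (\<Sum>\<alpha>\<in>splits \<mu>. C \<gamma> (\<gamma> + \<alpha>) * B (\<gamma> + \<alpha>) (\<gamma> + \<kappa>))"
    if "\<kappa> \<in> splits \<mu>" for \<kappa>
    unfolding op_comp_splits[OF B C]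
  proof (rule sum.mono_neutral_left)
    show "splits \<kappa> \<subseteq> splits \<mu>"
    proof
      fix \<alpha> assume "\<alpha> \<in> splits \<kappa>"
      then have "\<alpha> \<in> pos" "\<kappa> - \<alpha> \<in> pos" "\<mu> - \<kappa> \<in> pos"
        using splitsD that by auto
      then show "\<alpha> \<in> splits \<mu>"
        using pos_add[of "\<kappa> - \<alpha>" "\<mu> - \<kappa>"] by (simp add: splits_def)
    qed
    show "\<forall>\<alpha>\<in>splits \<mu> - splits \<kappa>. C \<gamma> (\<gamma> + \<alpha>) * B (\<gamma> + \<alpha>) (\<gamma> + \<kappa>) = 0"
    proof
      fix \<alpha> assume "\<alpha> \<in> splits \<mu> - splits \<kappa>"
      then have "\<kappa> - \<alpha> \<notin> pos" by (auto simp: splits_def)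
      then have "B (\<gamma> + \<alpha>) (\<gamma> + \<kappa>) = 0"
        by (intro graded_zero[OF B]) simp
      then show "C \<gamma> (\<gamma> + \<alpha>) * B (\<gamma> + \<alpha>) (\<gamma> + \<kappa>) = 0" by simp
    qed
  qed simp
  have "op_comp (op_comp A B) C \<gamma> \<nu> =
      (\<Sum>\<alpha>\<in>splits \<mu>. C \<gamma> (\<gamma> + \<alpha>) * (\<Sum>\<kappa>\<in>splits \<mu>. B (\<gamma> + \<alpha>) (\<gamma> + \<kappa>) * A (\<gamma> + \<kappa>) (\<gamma> + \<mu>)))"
    unfolding \<nu> op_comp_splits[OF gAB C]
    by (intro sum.cong refl arg_cong2[where f = "(*)"] op_comp_shift[OF A B]) (rule splitsD)
  also have "\<dots> = (\<Sum>\<kappa>\<in>splits \<mu>. \<Sum>\<alpha>\<in>splits \<mu>. C \<gamma> (\<gamma> + \<alpha>) * (B (\<gamma> + \<alpha>) (\<gamma> + \<kappa>) * A (\<gamma> + \<kappa>) (\<gamma> + \<mu>)))"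
    unfolding sum_distrib_left by (rule sum.swap)
  also have "\<dots> = (\<Sum>\<kappa>\<in>splits \<mu>. op_comp B C \<gamma> (\<gamma> + \<kappa>) * A (\<gamma> + \<kappa>) (\<gamma> + \<mu>))"
    by (intro sum.cong refl) (simp add: BC sum_distrib_right mult.assoc)
  also have "\<dots> = op_comp A (op_comp B C) \<gamma> \<nu>"
    unfolding \<nu> op_comp_splits[OF A gBC] ..
  finally show "op_comp (op_comp A B) C \<gamma> \<nu> = op_comp A (op_comp B C) \<gamma> \<nu>" .
qed

lemma op_comp_diff_left:
  assumes A: "graded pos A" and A': "graded pos A'" and B: "graded pos B"
  shows "op_comp (A - A') B = op_comp A B - op_comp A' B"
proof (intro ext)
  fix \<gamma> \<nu> :: "'n lattice"
  show "op_comp (A - A') B \<gamma> \<nu> = (op_comp A B - op_comp A' B) \<gamma> \<nu>"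
    using op_comp_splits[OF graded_diff[OF A A'] B, of \<gamma> "\<nu> - \<gamma>"]
      op_comp_splits[OF A B, of \<gamma> "\<nu> - \<gamma>"] op_comp_splits[OF A' B, of \<gamma> "\<nu> - \<gamma>"]
    by (simp add: sum_subtractf right_diff_distrib)
qed

lemma op_comp_diff_right:
  assumes A: "graded pos A" and B: "graded pos B" and B': "graded pos B'"
  shows "op_comp A (B - B') = op_comp A B - op_comp A B'"
proof (intro ext)
  fix \<gamma> \<nu> :: "'n lattice"
  show "op_comp A (B - B') \<gamma> \<nu> = (op_comp A B - op_comp A B') \<gamma> \<nu>"
    using op_comp_splits[OF A graded_diff[OF B B'], of \<gamma> "\<nu> - \<gamma>"]
      op_comp_splits[OF A B, of \<gamma> "\<nu> - \<gamma>"] op_comp_splits[OF A B', of \<gamma> "\<nu> - \<gamma>"]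
    by (simp add: sum_subtractf left_diff_distrib)
qed

section \<open>Unipotent multiplicative operators\<close>

lemma is_autD:
  assumes "is_aut S g"
  shows "graded S g" "g \<gamma> \<gamma> = 1" "g 0 \<nu> = op_one 0 \<nu>"
    "g (\<gamma> + \<gamma>') (\<gamma> + \<gamma>' + \<mu>) = (\<Sum>\<alpha>\<in>splits \<mu>. g \<gamma> (\<gamma> + \<alpha>) * g \<gamma>' (\<gamma>' + (\<mu> - \<alpha>)))"
  using assms by (auto simp: is_aut_def)

lemma is_aut_mono: "is_aut S g \<Longrightarrow> S \<subseteq> T \<Longrightarrow> is_aut T g"
  unfolding is_aut_def using graded_mono by blast

lemma is_aut_one:
  assumes "0 \<in> S"
  shows "is_aut S op_one"
  unfolding is_aut_def
proof (intro conjI allI)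
  fix \<gamma> \<gamma>' \<mu> :: "'n lattice"
  have "(\<Sum>\<alpha>\<in>splits \<mu>. op_one \<gamma> (\<gamma> + \<alpha>) * op_one \<gamma>' (\<gamma>' + (\<mu> - \<alpha>))) =
      (\<Sum>\<alpha>\<in>splits \<mu>. if \<alpha> = 0 then (if \<mu> = 0 then 1 else 0) else 0)"
    by (intro sum.cong) (auto simp: op_one_def)
  also have "\<dots> = (if 0 \<in> splits \<mu> \<and> \<mu> = 0 then 1 else 0)"
    by (subst sum.delta) auto
  also have "\<dots> = op_one (\<gamma> + \<gamma>') (\<gamma> + \<gamma>' + \<mu>)"
    by (auto simp: op_one_def splits_def)
  finally show "op_one (\<gamma> + \<gamma>') (\<gamma> + \<gamma>' + \<mu>) =
    (\<Sum>\<alpha>\<in>splits \<mu>. op_one \<gamma> (\<gamma> + \<alpha>) * op_one \<gamma>' (\<gamma>' + (\<mu> - \<alpha>)))" by simp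
qed (use assms in \<open>auto simp: op_one_def graded_one\<close>)

lemma is_aut_comp:
  assumes S: "submonoid S" and A: "is_aut S A" and B: "is_aut S B"
  shows "is_aut S (op_comp A B)"
  unfolding is_aut_def
proof (intro conjI allI)
  note gA = graded_pos[OF S is_autD(1)[OF A]]
  note gB = graded_pos[OF S is_autD(1)[OF B]]
  note eq = op_comp_splits[OF gA gB]
  show "graded S (op_comp A B)"
    using graded_comp[OF S] is_autD(1) A B by blast
  show "op_comp A B 0 \<nu> = op_one 0 \<nu>" for \<nu>
  proof -
    have "op_comp A B 0 (0 + \<nu>) = (\<Sum>\<alpha>\<in>splits \<nu>. if \<alpha> = 0 then A 0 \<nu> else 0)"
      unfolding eq by (intro sum.cong) (auto simp: is_autD(3)[OF B] op_one_def)
    also have "\<dots> = A 0 \<nu>"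
      using graded_zero'[OF gA, of \<nu> 0] by (subst sum.delta) auto
    finally show ?thesis using is_autD(3)[OF A] by simp
  qed
  show "op_comp A B \<gamma> \<gamma> = 1" for \<gamma>
  proof -
    have "splits 0 = {0}"
    proof (intro equalityI subsetI)
      fix \<alpha> assume "\<alpha> \<in> splits 0"
      from splitsD[OF this] have "\<alpha> \<in> pos" "deg \<alpha> \<le> 0" by auto
      then show "\<alpha> \<in> {0}" using deg_ge_1[of \<alpha>] by force
    qed (simp add: splits_def)
    then show ?thesis
      using eq[of \<gamma> 0] is_autD(2)[OF A] is_autD(2)[OF B] by simp
  qed
  fix \<gamma> \<gamma>' \<mu>
  define B1 where "B1 = (\<lambda>\<alpha>. B \<gamma> (\<gamma> + \<alpha>))"
  define B2 where "B2 = (\<lambda>\<alpha>. B \<gamma>' (\<gamma>' + \<alpha>))"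
  define A1 where "A1 = (\<lambda>\<alpha> \<beta>. A (\<gamma> + \<alpha>) (\<gamma> + \<alpha> + \<beta>))"
  define A2 where "A2 = (\<lambda>\<alpha> \<beta>. A (\<gamma>' + \<alpha>) (\<gamma>' + \<alpha> + \<beta>))"
  have 1: "op_comp A B (\<gamma> + \<gamma>') (\<gamma> + \<gamma>' + \<mu>) =
    (\<Sum>\<kappa>\<in>splits \<mu>. \<Sum>\<alpha>\<in>splits \<kappa>. \<Sum>\<beta>\<in>splits (\<mu> - \<kappa>).
        B1 \<alpha> * B2 (\<kappa> - \<alpha>) * (A1 \<alpha> \<beta> * A2 (\<kappa> - \<alpha>) (\<mu> - \<kappa> - \<beta>)))"
    unfolding eq
  proof (intro sum.cong refl)
    fix \<kappa>
    \<comment> \<open>Multiplicativity of \<open>A\<close> may be applied to any decomposition of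
      the intermediate exponent; the one chosen is the one that the expansion of \<open>B\<close>
      has just produced.\<close>
    have eqA: "A (\<gamma> + \<gamma>' + \<kappa>) (\<gamma> + \<gamma>' + \<mu>) =
        (\<Sum>\<beta>\<in>splits (\<mu> - \<kappa>). A1 \<alpha> \<beta> * A2 (\<kappa> - \<alpha>) (\<mu> - \<kappa> - \<beta>))" for \<alpha>
      using is_autD(4)[OF A, of "\<gamma> + \<alpha>" "\<gamma>' + (\<kappa> - \<alpha>)" "\<mu> - \<kappa>"]
      by (simp add: A1_def A2_def algebra_simps)
    show "B (\<gamma> + \<gamma>') (\<gamma> + \<gamma>' + \<kappa>) * A (\<gamma> + \<gamma>' + \<kappa>) (\<gamma> + \<gamma>' + \<mu>) =
      (\<Sum>\<alpha>\<in>splits \<kappa>. \<Sum>\<beta>\<in>splits (\<mu> - \<kappa>). B1 \<alpha> * B2 (\<kappa> - \<alpha>) * (A1 \<alpha> \<beta> * A2 (\<kappa> - \<alpha>) (\<mu> - \<kappa> - \<beta>)))"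
      unfolding is_autD(4)[OF B] sum_distrib_right
    proof (intro sum.cong refl, goal_cases)
      case (1 \<alpha>)
      show ?case unfolding eqA[of \<alpha>] by (simp add: sum_distrib_left B1_def B2_def)
    qed
  qed
  have e1: "op_comp A B \<gamma> (\<gamma> + \<rho>) = (\<Sum>\<alpha>\<in>splits \<rho>. B1 \<alpha> * A1 \<alpha> (\<rho> - \<alpha>))" for \<rho>
    unfolding eq by (simp add: B1_def A1_def algebra_simps)
  have e2: "op_comp A B \<gamma>' (\<gamma>' + \<rho>) = (\<Sum>\<alpha>\<in>splits \<rho>. B2 \<alpha> * A2 \<alpha> (\<rho> - \<alpha>))" for \<rho>
    unfolding eq by (simp add: B2_def A2_def algebra_simps)
  have 2: "(\<Sum>\<rho>\<in>splits \<mu>. op_comp A B \<gamma> (\<gamma> + \<rho>) * op_comp A B \<gamma>' (\<gamma>' + (\<mu> - \<rho>))) =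
    (\<Sum>\<rho>\<in>splits \<mu>. \<Sum>\<alpha>\<in>splits \<rho>. \<Sum>\<beta>\<in>splits (\<mu> - \<rho>).
        B1 \<alpha> * A1 \<alpha> (\<rho> - \<alpha>) * (B2 \<beta> * A2 \<beta> (\<mu> - \<rho> - \<beta>)))"
    unfolding e1 e2 by (simp add: sum_product)
  have f1: "\<alpha> + \<beta> \<in> splits \<mu>" "\<alpha> \<in> splits (\<alpha> + \<beta>)" "\<kappa> - \<alpha> \<in> splits (\<mu> - (\<alpha> + \<beta>))"
    if "\<kappa> \<in> splits \<mu>" "\<alpha> \<in> splits \<kappa>" "\<beta> \<in> splits (\<mu> - \<kappa>)" for \<kappa> \<alpha> \<beta>
    using that pos_add[of \<alpha> \<beta>] pos_add[of "\<kappa> - \<alpha>" "\<mu> - \<kappa> - \<beta>"]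
    by (auto simp: splits_def algebra_simps)
  have f2: "\<mu> - (\<alpha> + \<beta>) - (\<kappa> - \<alpha>) = \<mu> - \<kappa> - \<beta>" for \<kappa> \<alpha> \<beta> :: "'n lattice"
    by simp
  have "(\<Sum>\<kappa>\<in>splits \<mu>. \<Sum>\<alpha>\<in>splits \<kappa>. \<Sum>\<beta>\<in>splits (\<mu> - \<kappa>).
        B1 \<alpha> * B2 (\<kappa> - \<alpha>) * (A1 \<alpha> \<beta> * A2 (\<kappa> - \<alpha>) (\<mu> - \<kappa> - \<beta>))) =
    (\<Sum>(\<kappa>, \<alpha>, \<beta>)\<in>(SIGMA \<kappa>:splits \<mu>. splits \<kappa> \<times> splits (\<mu> - \<kappa>)).
        B1 \<alpha> * B2 (\<kappa> - \<alpha>) * (A1 \<alpha> \<beta> * A2 (\<kappa> - \<alpha>) (\<mu> - \<kappa> - \<beta>)))"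
    by (simp add: sum.Sigma sum.cartesian_product split_def)
  also have "\<dots> =
    (\<Sum>(\<rho>, \<alpha>, \<beta>)\<in>(SIGMA \<rho>:splits \<mu>. splits \<rho> \<times> splits (\<mu> - \<rho>)).
        B1 \<alpha> * A1 \<alpha> (\<rho> - \<alpha>) * (B2 \<beta> * A2 \<beta> (\<mu> - \<rho> - \<beta>)))"
  \<comment> \<open>Four shifts add up to \<mu>: those that \<open>B\<close> and \<open>A\<close>
    give to each of the two monomials. On one side they are grouped by operator, \<kappa> being the
    total shift by \<open>B\<close>; on the other by monomial, \<rho> being the total shift of
    x^\<gamma>.\<close>
  by (rule sum.reindex_bij_witness[where
        j = "\<lambda>(\<kappa>, \<alpha>, \<beta>). (\<alpha> + \<beta>, \<alpha>, \<kappa> - \<alpha>)" and i = "\<lambda>(\<rho>, \<alpha>, \<beta>). (\<alpha> + \<beta>, \<alpha>, \<rho> - \<alpha>)"])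
    (use f1 in \<open>auto simp: f2\<close>)
  also have "\<dots> = (\<Sum>\<rho>\<in>splits \<mu>. \<Sum>\<alpha>\<in>splits \<rho>. \<Sum>\<beta>\<in>splits (\<mu> - \<rho>).
        B1 \<alpha> * A1 \<alpha> (\<rho> - \<alpha>) * (B2 \<beta> * A2 \<beta> (\<mu> - \<rho> - \<beta>)))"
    by (simp add: sum.Sigma sum.cartesian_product split_def)
  finally show "op_comp A B (\<gamma> + \<gamma>') (\<gamma> + \<gamma>' + \<mu>) =
    (\<Sum>\<rho>\<in>splits \<mu>. op_comp A B \<gamma> (\<gamma> + \<rho>) * op_comp A B \<gamma>' (\<gamma>' + (\<mu> - \<rho>)))"
    unfolding 1 2 .
qed

section \<open>Exponentials of derivations\<close>

definition supp_in :: "'n lattice set \<Rightarrow> 'n vfield \<Rightarrow> bool" where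
  "supp_in S v \<longleftrightarrow> (\<forall>\<delta>. v \<delta> \<noteq> 0 \<longrightarrow> \<delta> \<in> S \<and> \<delta> \<noteq> 0)"

definition derivation_pow :: "'n vfield \<Rightarrow> nat \<Rightarrow> 'n operator" where
  "derivation_pow v k = (op_comp (derivation v) ^^ k) op_one"

lemma derivation_pow_0 [simp]: "derivation_pow v 0 = op_one"
  by (simp add: derivation_pow_def)

lemma derivation_pow_Suc: "derivation_pow v (Suc k) = op_comp (derivation v) (derivation_pow v k)"
  by (simp add: derivation_pow_def)

lemma derivation_shift: "derivation v (\<gamma> + \<alpha>) (\<gamma> + \<mu>) = (\<Sum>i\<in>UNIV. v (\<mu> - \<alpha>) $ i * of_int ((\<gamma> + \<alpha>) $ i))"
  by (simp add: derivation_def)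

lemma graded_derivation: "supp_in S v \<Longrightarrow> graded S (derivation v)"
  unfolding graded_def derivation_def supp_in_def
  by (metis (no_types, lifting) mult_zero_left sum.neutral zero_index)

lemma graded_derivation_pow:
  assumes S: "submonoid S" and v: "supp_in S v"
  shows "graded S (derivation_pow v k)"
proof (induction k)
  case 0
  then show ?case using submonoidD(1)[OF S] by (simp add: graded_one)
next
  case (Suc k)
  then show ?case unfolding derivation_pow_Suc by (intro graded_comp S graded_derivation v)
qed

lemma supp_in_pos: "submonoid S \<Longrightarrow> supp_in S v \<Longrightarrow> supp_in pos v"
  unfolding supp_in_def using submonoidD(2) by blast

lemma derivation_pow_Suc_splits:
  assumes "supp_in pos v"
  shows "derivation_pow v (Suc k) \<gamma> (\<gamma> + \<mu>) =
    (\<Sum>\<alpha>\<in>splits \<mu>. derivation_pow v k \<gamma> (\<gamma> + \<alpha>) * derivation v (\<gamma> + \<alpha>) (\<gamma> + \<mu>))"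
  unfolding derivation_pow_Suc
  by (intro op_comp_splits graded_derivation graded_derivation_pow submonoid_pos assms)

lemma derivation_diag [simp]: "supp_in S v \<Longrightarrow> derivation v \<gamma> \<gamma> = 0"
  unfolding derivation_def supp_in_def by (metis (no_types, lifting) cancel_comm_monoid_add_class.diff_cancel mult_zero_left sum.neutral zero_index)

text \<open>Pronilpotency: a nonzero exponent in \<open>pos\<close> has degree at least 1, so every
  application of the derivation raises the degree by at least 1. Each entry of the exponential is
  therefore a finite sum.\<close>

lemma derivation_pow_eq_0:
  assumes v: "supp_in pos v"
  shows "deg \<mu> < real k \<Longrightarrow> derivation_pow v k \<gamma> (\<gamma> + \<mu>) = 0"
proof (induction k arbitrary: \<mu>)
  case 0
  then have "\<mu> \<notin> pos" using deg_nonneg[of \<mu>] by auto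
  then show ?case using graded_zero'[OF graded_derivation_pow[OF submonoid_pos v]] by blast
next
  case (Suc k)
  show ?case unfolding derivation_pow_Suc_splits[OF v]
  proof (intro sum.neutral ballI)
    fix \<alpha> assume \<alpha>: "\<alpha> \<in> splits \<mu>"
    show "derivation_pow v k \<gamma> (\<gamma> + \<alpha>) * derivation v (\<gamma> + \<alpha>) (\<gamma> + \<mu>) = 0"
    proof (cases "\<alpha> = \<mu>")
      case True
      then show ?thesis using v by simp
    next
      case False
      then have "1 \<le> deg (\<mu> - \<alpha>)" using splitsD(2)[OF \<alpha>] by (intro deg_ge_1) auto
      then have "deg \<alpha> < real k" using Suc.prems by (simp add: deg_diff)
      then show ?thesis using Suc.IH by simp
    qed
  qed
qed

lemma op_exp_eq:
  assumes v: "supp_in pos v" and K: "deg \<mu> < real K"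
  shows "op_exp (derivation v) \<gamma> (\<gamma> + \<mu>) = (\<Sum>k<K. derivation_pow v k \<gamma> (\<gamma> + \<mu>) / fact k)"
proof -
  have "op_exp (derivation v) \<gamma> (\<gamma> + \<mu>) = (\<Sum>k. derivation_pow v k \<gamma> (\<gamma> + \<mu>) / fact k)"
    by (simp add: op_exp_def derivation_pow_def)
  also have "\<dots> = (\<Sum>k<K. derivation_pow v k \<gamma> (\<gamma> + \<mu>) / fact k)"
    using K by (intro suminf_finite) (auto simp: derivation_pow_eq_0[OF v])
  finally show ?thesis .
qed

lemma op_exp_outside:
  assumes "submonoid S" "supp_in S v" "\<mu> \<notin> S"
  shows "op_exp (derivation v) \<gamma> (\<gamma> + \<mu>) = 0"
  using graded_zero'[OF graded_derivation_pow[OF assms(1,2)] assms(3)]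
  by (simp add: op_exp_def derivation_pow_def)

text \<open>With divided powers the Leibniz rule has no binomial coefficients and is a plain Cauchy
  product, which is the shape needed to multiply two exponential series.\<close>

lemma derivation_pow_leibniz:
  assumes v: "supp_in pos v"
  shows "derivation_pow v k (\<gamma> + \<gamma>') (\<gamma> + \<gamma>' + \<mu>) / fact k =
    (\<Sum>j\<le>k. \<Sum>\<alpha>\<in>splits \<mu>. derivation_pow v j \<gamma> (\<gamma> + \<alpha>) / fact j *
       (derivation_pow v (k - j) \<gamma>' (\<gamma>' + (\<mu> - \<alpha>)) / fact (k - j)))"
proof (induction k arbitrary: \<mu>)
  case 0
  then show ?case using is_autD(4)[OF is_aut_one[of pos]] by simp
next
  case (Suc k)
  define E where "E = (\<lambda>k \<gamma> \<mu>. derivation_pow v k \<gamma> (\<gamma> + \<mu>) / fact k)"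
  define d where "d = (\<lambda>\<gamma> \<alpha>. derivation v \<gamma> (\<gamma> + \<alpha>))"
  have ESuc: "real (Suc k) * E (Suc k) \<gamma> \<mu> = (\<Sum>\<alpha>\<in>splits \<mu>. E k \<gamma> \<alpha> * d (\<gamma> + \<alpha>) (\<mu> - \<alpha>))"
    for k \<gamma> \<mu>
  proof -
    have "real (Suc k) * E (Suc k) \<gamma> \<mu> = derivation_pow v (Suc k) \<gamma> (\<gamma> + \<mu>) / fact k"
      by (simp add: E_def field_simps del: of_nat_Suc)
    then show ?thesis
      by (simp add: derivation_pow_Suc_splits[OF v] E_def d_def sum_divide_distrib)
  qed
  have d_add: "d (\<gamma> + \<gamma>') \<kappa> = d \<gamma> \<kappa> + d \<gamma>' \<kappa>" for \<gamma> \<gamma>' \<kappa>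
    by (simp add: d_def derivation_def sum.distrib ring_distribs)
  \<comment> \<open>\<open>conv\<close> collects the terms in which the outermost derivation hits
    the first factor, \<open>conv'\<close> those in which it hits the second. Reindexing turns them
    into products in which one factor has been differentiated once more.\<close>
  have conv: "(\<Sum>\<kappa>\<in>splits \<mu>. \<Sum>\<alpha>\<in>splits \<kappa>. F \<alpha> * G (\<kappa> - \<alpha>) * d (\<gamma> + \<alpha>) (\<mu> - \<kappa>)) =
      (\<Sum>\<alpha>\<in>splits \<mu>. (\<Sum>\<kappa>\<in>splits \<alpha>. F \<kappa> * d (\<gamma> + \<kappa>) (\<alpha> - \<kappa>)) * G (\<mu> - \<alpha>))"
    (is "?l = ?r") for F G :: "'n lattice \<Rightarrow> complex" and \<gamma>
  proof -
    have "?l = (\<Sum>(\<kappa>,\<alpha>)\<in>(SIGMA \<kappa>:splits \<mu>. splits \<kappa>). F \<alpha> * G (\<kappa> - \<alpha>) * d (\<gamma> + \<alpha>) (\<mu> - \<kappa>))"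
      by (simp add: sum.Sigma)
    also have "\<dots> = (\<Sum>(\<alpha>,\<kappa>)\<in>(SIGMA \<alpha>:splits \<mu>. splits \<alpha>). F \<kappa> * d (\<gamma> + \<kappa>) (\<alpha> - \<kappa>) * G (\<mu> - \<alpha>))"
    proof -
      have f: "\<mu> - \<kappa> + \<alpha> \<in> splits \<mu>" "\<alpha> \<in> splits (\<mu> - \<kappa> + \<alpha>)" if "\<kappa> \<in> splits \<mu>" "\<alpha> \<in> splits \<kappa>" for \<kappa> \<alpha>
        using that pos_add[of \<alpha> "\<mu> - \<kappa>"] by (auto simp: splits_def algebra_simps)
      show ?thesis
        by (rule sum.reindex_bij_witness[where
          j = "\<lambda>(\<kappa>,\<alpha>). (\<mu> - \<kappa> + \<alpha>, \<alpha>)" and i = "\<lambda>(\<alpha>,\<kappa>). (\<mu> - \<alpha> + \<kappa>, \<kappa>)"])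
          (use f in \<open>auto simp: algebra_simps\<close>)
    qed
    also have "\<dots> = ?r"
      by (simp add: sum.Sigma sum_distrib_right)
    finally show ?thesis .
  qed
  have conv': "(\<Sum>\<kappa>\<in>splits \<mu>. \<Sum>\<alpha>\<in>splits \<kappa>. F \<alpha> * G (\<kappa> - \<alpha>) * d (\<gamma> + (\<kappa> - \<alpha>)) (\<mu> - \<kappa>)) =
      (\<Sum>\<alpha>\<in>splits \<mu>. F \<alpha> * (\<Sum>\<kappa>\<in>splits (\<mu> - \<alpha>). G \<kappa> * d (\<gamma> + \<kappa>) (\<mu> - \<alpha> - \<kappa>)))"
    (is "?l = ?r") for F G :: "'n lattice \<Rightarrow> complex" and \<gamma>
  proof -
    have "?l = (\<Sum>(\<kappa>,\<alpha>)\<in>(SIGMA \<kappa>:splits \<mu>. splits \<kappa>). F \<alpha> * G (\<kappa> - \<alpha>) * d (\<gamma> + (\<kappa> - \<alpha>)) (\<mu> - \<kappa>))"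
      by (simp add: sum.Sigma)
    also have "\<dots> = (\<Sum>(\<alpha>,\<kappa>)\<in>(SIGMA \<alpha>:splits \<mu>. splits (\<mu> - \<alpha>)). F \<alpha> * (G \<kappa> * d (\<gamma> + \<kappa>) (\<mu> - \<alpha> - \<kappa>)))"
    proof -
      have f: "\<alpha> \<in> splits \<mu>" "\<kappa> - \<alpha> \<in> splits (\<mu> - \<alpha>)" if "\<kappa> \<in> splits \<mu>" "\<alpha> \<in> splits \<kappa>" for \<kappa> \<alpha>
        using that pos_add[of "\<kappa> - \<alpha>" "\<mu> - \<kappa>"] by (auto simp: splits_def algebra_simps)
      have f': "\<alpha> + \<kappa> \<in> splits \<mu>" "\<alpha> \<in> splits (\<alpha> + \<kappa>)" if "\<alpha> \<in> splits \<mu>" "\<kappa> \<in> splits (\<mu> - \<alpha>)" for \<kappa> \<alpha>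
        using that pos_add[of \<alpha> \<kappa>] by (auto simp: splits_def algebra_simps)
      show ?thesis
        by (rule sum.reindex_bij_witness[where
          j = "\<lambda>(\<kappa>,\<alpha>). (\<alpha>, \<kappa> - \<alpha>)" and i = "\<lambda>(\<alpha>,\<kappa>). (\<alpha> + \<kappa>, \<alpha>)"])
          (use f f' in \<open>auto simp: algebra_simps\<close>)
    qed
    also have "\<dots> = ?r"
      by (simp add: sum.Sigma sum_distrib_left)
    finally show ?thesis .
  qed
  define P where "P = (\<lambda>i j. \<Sum>\<alpha>\<in>splits \<mu>. E i \<gamma> \<alpha> * E j \<gamma>' (\<mu> - \<alpha>))"
  have IH: "E k (\<gamma> + \<gamma>') \<kappa> = (\<Sum>j\<le>k. \<Sum>\<alpha>\<in>splits \<kappa>. E j \<gamma> \<alpha> * E (k - j) \<gamma>' (\<kappa> - \<alpha>))" for \<kappa>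
    using Suc.IH[of \<kappa>] by (simp add: E_def)
  have "real (Suc k) * E (Suc k) (\<gamma> + \<gamma>') \<mu> =
     (\<Sum>\<kappa>\<in>splits \<mu>. \<Sum>j\<le>k. \<Sum>\<alpha>\<in>splits \<kappa>. E j \<gamma> \<alpha> * E (k - j) \<gamma>' (\<kappa> - \<alpha>) * d (\<gamma> + \<gamma>' + \<kappa>) (\<mu> - \<kappa>))"
    unfolding ESuc IH by (simp add: sum_distrib_right)
  also have "\<dots> = (\<Sum>j\<le>k. \<Sum>\<kappa>\<in>splits \<mu>. \<Sum>\<alpha>\<in>splits \<kappa>.
      E j \<gamma> \<alpha> * E (k - j) \<gamma>' (\<kappa> - \<alpha>) * d (\<gamma> + \<gamma>' + \<kappa>) (\<mu> - \<kappa>))"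
    by (rule sum.swap)
  \<comment> \<open>By \<open>ESuc\<close>, differentiating the j-th divided power gives j + 1 times
    the next one. So \<open>P j (Suc k - j)\<close> occurs with weight j from the first factor and k
    + 1 - j from the second, together k + 1, which cancels the factor on the left.\<close>
  also have "\<dots> = (\<Sum>j\<le>k. real (Suc j) * P (Suc j) (k - j) + real (Suc (k - j)) * P j (Suc (k - j)))"
  proof (intro sum.cong refl)
    fix j
    have "d (\<gamma> + \<gamma>' + \<kappa>) \<nu> = d (\<gamma> + \<alpha>) \<nu> + d (\<gamma>' + (\<kappa> - \<alpha>)) \<nu>" for \<kappa> \<alpha> \<nu>
      using d_add[of "\<gamma> + \<alpha>" "\<gamma>' + (\<kappa> - \<alpha>)"] by (simp add: algebra_simps)
    then have "(\<Sum>\<kappa>\<in>splits \<mu>. \<Sum>\<alpha>\<in>splits \<kappa>.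
        E j \<gamma> \<alpha> * E (k - j) \<gamma>' (\<kappa> - \<alpha>) * d (\<gamma> + \<gamma>' + \<kappa>) (\<mu> - \<kappa>)) =
      (\<Sum>\<kappa>\<in>splits \<mu>. \<Sum>\<alpha>\<in>splits \<kappa>. E j \<gamma> \<alpha> * E (k - j) \<gamma>' (\<kappa> - \<alpha>) * d (\<gamma> + \<alpha>) (\<mu> - \<kappa>)) +
      (\<Sum>\<kappa>\<in>splits \<mu>. \<Sum>\<alpha>\<in>splits \<kappa>. E j \<gamma> \<alpha> * E (k - j) \<gamma>' (\<kappa> - \<alpha>) * d (\<gamma>' + (\<kappa> - \<alpha>)) (\<mu> - \<kappa>))"
      unfolding sum.distrib[symmetric] distrib_left[symmetric]
      by (intro sum.cong refl arg_cong2[where f = "(*)"])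
    also have "\<dots> = real (Suc j) * P (Suc j) (k - j) + real (Suc (k - j)) * P j (Suc (k - j))"
      unfolding conv conv' ESuc[symmetric] P_def
      by (simp add: sum_distrib_left mult_ac del: of_nat_Suc)
    finally show "(\<Sum>\<kappa>\<in>splits \<mu>. \<Sum>\<alpha>\<in>splits \<kappa>.
        E j \<gamma> \<alpha> * E (k - j) \<gamma>' (\<kappa> - \<alpha>) * d (\<gamma> + \<gamma>' + \<kappa>) (\<mu> - \<kappa>)) =
      real (Suc j) * P (Suc j) (k - j) + real (Suc (k - j)) * P j (Suc (k - j))" .
  qed
  also have "\<dots> = (\<Sum>j\<le>Suc k. real j * P j (Suc k - j)) + (\<Sum>j\<le>Suc k. real (Suc k - j) * P j (Suc k - j))"
    unfolding sum.distrib
  proof (intro arg_cong2[where f = "(+)"])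
    show "(\<Sum>j\<le>k. real (Suc j) * P (Suc j) (k - j)) = (\<Sum>j\<le>Suc k. real j * P j (Suc k - j))"
      by (subst sum.atMost_Suc_shift) simp
    show "(\<Sum>j\<le>k. real (Suc (k - j)) * P j (Suc (k - j))) = (\<Sum>j\<le>Suc k. real (Suc k - j) * P j (Suc k - j))"
      by (simp add: Suc_diff_le add_diff_eq)
  qed
  also have "\<dots> = real (Suc k) * (\<Sum>j\<le>Suc k. P j (Suc k - j))"
    unfolding sum.distrib[symmetric] sum_distrib_left
  proof (intro sum.cong refl)
    fix j assume "j \<in> {..Suc k}"
    then have "complex_of_real (real (Suc k)) = real j + real (Suc k - j)"
      by (simp add: of_nat_diff flip: of_real_add)
    then show "real j * P j (Suc k - j) + real (Suc k - j) * P j (Suc k - j) = real (Suc k) * P j (Suc k - j)"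
      by (simp add: distrib_right)
  qed
  finally have "E (Suc k) (\<gamma> + \<gamma>') \<mu> = (\<Sum>j\<le>Suc k. P j (Suc k - j))"
    by (simp del: of_nat_Suc sum.atMost_Suc)
  then show ?case by (simp add: E_def P_def)
qed

lemma is_aut_exp:
  assumes S: "submonoid S" and v: "supp_in S v"
  shows "is_aut S (op_exp (derivation v))"
proof -
  note vp = supp_in_pos[OF S v]
  show ?thesis
    unfolding is_aut_def
  proof (intro conjI allI)
    show "graded S (op_exp (derivation v))"
      unfolding graded_def using op_exp_outside[OF S v]
      by (metis add_diff_cancel_left' diff_add_cancel add.commute)
    show "op_exp (derivation v) \<gamma> \<gamma> = 1" for \<gamma>
      using op_exp_eq[OF vp, of 0 1 \<gamma>] by (simp add: op_one_def)
    show "op_exp (derivation v) 0 \<nu> = op_one 0 \<nu>" for \<nu>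
    proof -
      \<comment> \<open>A derivation annihilates the constant x^0.\<close>
      have "derivation_pow v (Suc k) 0 (0 + \<nu>) = 0" for k \<nu>
      proof (induction k arbitrary: \<nu>)
        case 0
        show ?case
          unfolding derivation_pow_Suc_splits[OF vp]
          by (intro sum.neutral) (auto simp: op_one_def derivation_def)
      next
        case (Suc k)
        show ?case
          unfolding derivation_pow_Suc_splits[OF vp, of "Suc k"] using Suc.IH by (intro sum.neutral) simp
      qed
      then have "(\<lambda>k. derivation_pow v k 0 \<nu> / fact k) = (\<lambda>k. if k = 0 then op_one 0 \<nu> else 0)"
        by (intro ext) (metis add_0 div_by_1 divide_eq_0_iff derivation_pow_0 fact_0 not0_implies_Suc)
      then show ?thesis
        unfolding op_exp_def derivation_pow_def[symmetric]
        using sums_unique[OF sums_single[of 0 "\<lambda>_. op_one 0 \<nu> :: complex"]] by simp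
    qed
    fix \<gamma> \<gamma>' \<mu>
    obtain K where K: "deg \<mu> < real K" using reals_Archimedean2 by blast
    let ?E = "\<lambda>k \<gamma> \<mu>. derivation_pow v k \<gamma> (\<gamma> + \<mu>) / fact k"
    have zero: "?E k \<gamma> \<nu> = 0" if "deg \<nu> < real k" for k \<gamma> \<nu>
      using derivation_pow_eq_0[OF vp that] by simp
    have "op_exp (derivation v) (\<gamma> + \<gamma>') (\<gamma> + \<gamma>' + \<mu>) =
        (\<Sum>k<K. \<Sum>j\<le>k. \<Sum>\<alpha>\<in>splits \<mu>. ?E j \<gamma> \<alpha> * ?E (k - j) \<gamma>' (\<mu> - \<alpha>))"
      unfolding op_exp_eq[OF vp K] derivation_pow_leibniz[OF vp] ..
    also have "\<dots> = (\<Sum>(k,j)\<in>(SIGMA k:{..<K}. {..k}). \<Sum>\<alpha>\<in>splits \<mu>. ?E j \<gamma> \<alpha> * ?E (k - j) \<gamma>' (\<mu> - \<alpha>))"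
      by (rule sum.Sigma) auto
    also have "\<dots> = (\<Sum>(i,j)\<in>{(i,j). i < K \<and> j < K \<and> i + j < K}. \<Sum>\<alpha>\<in>splits \<mu>. ?E i \<gamma> \<alpha> * ?E j \<gamma>' (\<mu> - \<alpha>))"
      by (rule sum.reindex_bij_witness[where j = "\<lambda>(k,j). (j, k - j)" and i = "\<lambda>(i,j). (i + j, i)"]) auto
    \<comment> \<open>The triangle may be completed to a square: when i + j is at least
      \<open>K\<close>, the degrees of the two parts of \<mu> sum to less than i + j, so one of the
      two powers has no entry in its degree.\<close>
    also have "\<dots> = (\<Sum>(i,j)\<in>{..<K} \<times> {..<K}. \<Sum>\<alpha>\<in>splits \<mu>. ?E i \<gamma> \<alpha> * ?E j \<gamma>' (\<mu> - \<alpha>))"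
    proof (rule sum.mono_neutral_left)
      show "\<forall>x\<in>{..<K} \<times> {..<K} - {(i, j). i < K \<and> j < K \<and> i + j < K}.
        (case x of (i, j) \<Rightarrow> \<Sum>\<alpha>\<in>splits \<mu>. ?E i \<gamma> \<alpha> * ?E j \<gamma>' (\<mu> - \<alpha>)) = 0"
      proof
        fix x assume x: "x \<in> {..<K} \<times> {..<K} - {(i, j). i < K \<and> j < K \<and> i + j < K}"
        obtain i j where ij: "x = (i, j)" by fastforce
        show "(case x of (i, j) \<Rightarrow> \<Sum>\<alpha>\<in>splits \<mu>. ?E i \<gamma> \<alpha> * ?E j \<gamma>' (\<mu> - \<alpha>)) = 0"
          unfolding ij prod.case
      proof (intro sum.neutral ballI)
        fix \<alpha> assume \<alpha>: "\<alpha> \<in> splits \<mu>"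
        have *: "i < K" "j < K" "\<not> i + j < K" using x ij by auto
        have "deg \<alpha> + deg (\<mu> - \<alpha>) < real i + real j"
          using K *(3) by (simp add: deg_diff flip: of_nat_add)
        then have "deg \<alpha> < real i \<or> deg (\<mu> - \<alpha>) < real j" by linarith
        then show "?E i \<gamma> \<alpha> * ?E j \<gamma>' (\<mu> - \<alpha>) = 0"
          using zero by (metis mult_eq_0_iff)
      qed
      qed
    qed auto
    also have "\<dots> = (\<Sum>i<K. \<Sum>j<K. \<Sum>\<alpha>\<in>splits \<mu>. ?E i \<gamma> \<alpha> * ?E j \<gamma>' (\<mu> - \<alpha>))"
      by (rule sum.cartesian_product[symmetric])
    also have "\<dots> = (\<Sum>i<K. \<Sum>\<alpha>\<in>splits \<mu>. \<Sum>j<K. ?E i \<gamma> \<alpha> * ?E j \<gamma>' (\<mu> - \<alpha>))"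
      by (intro sum.cong refl sum.swap)
    also have "\<dots> = (\<Sum>\<alpha>\<in>splits \<mu>. \<Sum>i<K. \<Sum>j<K. ?E i \<gamma> \<alpha> * ?E j \<gamma>' (\<mu> - \<alpha>))"
      by (rule sum.swap)
    also have "\<dots> = (\<Sum>\<alpha>\<in>splits \<mu>. op_exp (derivation v) \<gamma> (\<gamma> + \<alpha>) *
        op_exp (derivation v) \<gamma>' (\<gamma>' + (\<mu> - \<alpha>)))"
    proof (intro sum.cong refl)
      fix \<alpha> assume \<alpha>: "\<alpha> \<in> splits \<mu>"
      have "deg \<alpha> < real K" "deg (\<mu> - \<alpha>) < real K"
        using splitsD(4,5)[OF \<alpha>] K by linarith+
      then show "(\<Sum>i<K. \<Sum>j<K. ?E i \<gamma> \<alpha> * ?E j \<gamma>' (\<mu> - \<alpha>)) =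
        op_exp (derivation v) \<gamma> (\<gamma> + \<alpha>) * op_exp (derivation v) \<gamma>' (\<gamma>' + (\<mu> - \<alpha>))"
        by (simp only: op_exp_eq[OF vp] sum_product)
    qed
    finally show "op_exp (derivation v) (\<gamma> + \<gamma>') (\<gamma> + \<gamma>' + \<mu>) = \<dots>" .
  qed
qed

section \<open>Logarithms of automorphisms\<close>

lemma splits_interior:
  assumes "\<alpha> \<in> splits \<mu>" "\<alpha> \<noteq> 0" "deg \<mu> < N + 1"
  shows "deg (\<mu> - \<alpha>) < N"
  using deg_ge_1[OF splitsD(1)[OF assms(1)] assms(2)] assms(3) by (simp add: deg_diff)

text \<open>A term of order two or more in the field is a chain of steps of degree at least 1 each,
  with total degree below N + 1. So every step has degree below N, where the fields agree, and only
  the linear term can see the change.\<close>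

lemma op_exp_change:
  assumes v: "supp_in pos v" and w: "supp_in pos w"
    and eq: "\<And>\<delta>. deg \<delta> < N \<Longrightarrow> v \<delta> = w \<delta>" and \<mu>: "deg \<mu> < N + 1"
  shows "op_exp (derivation w) \<gamma> (\<gamma> + \<mu>) - op_exp (derivation v) \<gamma> (\<gamma> + \<mu>) =
    derivation w \<gamma> (\<gamma> + \<mu>) - derivation v \<gamma> (\<gamma> + \<mu>)"
proof -
  have D: "derivation v (\<gamma> + \<alpha>) (\<gamma> + \<mu>) = derivation w (\<gamma> + \<alpha>) (\<gamma> + \<mu>)"
    if "deg (\<mu> - \<alpha>) < N \<or> \<mu> = \<alpha>" for \<gamma> \<alpha> \<mu>
  proof -
    have "v 0 = 0" "w 0 = 0" using v w by (auto simp: supp_in_def)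
    then have "v (\<mu> - \<alpha>) = w (\<mu> - \<alpha>)" using that eq by auto
    then show ?thesis by (simp add: derivation_shift)
  qed
  have low: "derivation_pow v k \<gamma> (\<gamma> + \<nu>) = derivation_pow w k \<gamma> (\<gamma> + \<nu>)" if "deg \<nu> < N" for k \<gamma> \<nu>
    using that
  proof (induction k arbitrary: \<nu>)
    case (Suc k)
    show ?case
      unfolding derivation_pow_Suc_splits[OF v] derivation_pow_Suc_splits[OF w]
    proof (intro sum.cong refl arg_cong2[where f = "(*)"])
      fix \<alpha> assume "\<alpha> \<in> splits \<nu>"
      from splitsD(4,5)[OF this] Suc.prems
      show "derivation_pow v k \<gamma> (\<gamma> + \<alpha>) = derivation_pow w k \<gamma> (\<gamma> + \<alpha>)"
        "derivation v (\<gamma> + \<alpha>) (\<gamma> + \<nu>) = derivation w (\<gamma> + \<alpha>) (\<gamma> + \<nu>)"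
        by (auto intro!: Suc.IH D)
    qed
  qed simp
  have high: "derivation_pow v (Suc (Suc k)) \<gamma> (\<gamma> + \<mu>) = derivation_pow w (Suc (Suc k)) \<gamma> (\<gamma> + \<mu>)" for k
    unfolding derivation_pow_Suc_splits[OF v, of "Suc k" \<gamma> \<mu>] derivation_pow_Suc_splits[OF w, of "Suc k" \<gamma> \<mu>]
  proof (intro sum.cong refl)
    fix \<alpha> assume \<alpha>: "\<alpha> \<in> splits \<mu>"
    show "derivation_pow v (Suc k) \<gamma> (\<gamma> + \<alpha>) * derivation v (\<gamma> + \<alpha>) (\<gamma> + \<mu>) =
      derivation_pow w (Suc k) \<gamma> (\<gamma> + \<alpha>) * derivation w (\<gamma> + \<alpha>) (\<gamma> + \<mu>)"
    proof (cases "\<alpha> = 0")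
      case True
      then show ?thesis
        using derivation_pow_eq_0[OF v, of 0 "Suc k" \<gamma>] derivation_pow_eq_0[OF w, of 0 "Suc k" \<gamma>] by simp
    next
      case False
      then have d: "deg (\<mu> - \<alpha>) < N" using splits_interior \<alpha> \<mu> by blast
      have "derivation_pow v (Suc k) \<gamma> (\<gamma> + \<alpha>) = derivation_pow w (Suc k) \<gamma> (\<gamma> + \<alpha>)" if "\<mu> \<noteq> \<alpha>"
      proof (rule low)
        show "deg \<alpha> < N"
          using splits_interior[of "\<mu> - \<alpha>" \<mu> N] that splitsD[OF \<alpha>] \<mu> by (simp add: splits_def)
      qed
      moreover have "derivation v (\<gamma> + \<alpha>) (\<gamma> + \<mu>) = derivation w (\<gamma> + \<alpha>) (\<gamma> + \<mu>)"
        using D d by blast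
      moreover have "derivation v (\<gamma> + \<mu>) (\<gamma> + \<mu>) = 0" "derivation w (\<gamma> + \<mu>) (\<gamma> + \<mu>) = 0"
        using v w by auto
      ultimately show ?thesis by (cases "\<mu> = \<alpha>") auto
    qed
  qed
  have one: "derivation_pow v (Suc 0) \<gamma> (\<gamma> + \<mu>) = derivation v \<gamma> (\<gamma> + \<mu>)" if "supp_in pos v" for v
    unfolding derivation_pow_Suc using op_comp_one_right[OF graded_derivation[OF that]] by simp
  obtain K where K: "deg \<mu> < real K" using reals_Archimedean2 by blast
  then have K': "deg \<mu> < real (Suc (Suc K))" by simp
  have "op_exp (derivation w) \<gamma> (\<gamma> + \<mu>) - op_exp (derivation v) \<gamma> (\<gamma> + \<mu>) =
     (\<Sum>k<Suc (Suc K). (derivation_pow w k \<gamma> (\<gamma> + \<mu>) - derivation_pow v k \<gamma> (\<gamma> + \<mu>)) / fact k)"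
    unfolding op_exp_eq[OF v K'] op_exp_eq[OF w K'] sum_subtractf[symmetric] diff_divide_distrib ..
  also have "\<dots> = derivation_pow w (Suc 0) \<gamma> (\<gamma> + \<mu>) - derivation_pow v (Suc 0) \<gamma> (\<gamma> + \<mu>)"
    unfolding sum.lessThan_Suc_shift by (simp add: high)
  finally show ?thesis using one v w by simp
qed

text \<open>
  In the convolution expressing multiplicativity, only the summands \<open>\<alpha> = 0\<close> and \<open>\<alpha> = \<mu>\<close> can tell
  \<open>g\<close> and \<open>h\<close> apart.
\<close>

lemma is_aut_diff_additive:
  assumes S: "submonoid S" and g: "is_aut S g" and h: "is_aut S h"
    and eq: "\<And>\<gamma> \<mu>. deg \<mu> < N \<Longrightarrow> g \<gamma> (\<gamma> + \<mu>) = h \<gamma> (\<gamma> + \<mu>)" and \<mu>: "deg \<mu> < N + 1"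
  shows "g \<gamma> (\<gamma> + \<mu>) - h \<gamma> (\<gamma> + \<mu>) =
    (\<Sum>i\<in>UNIV. (g (axis i 1) (axis i 1 + \<mu>) - h (axis i 1) (axis i 1 + \<mu>)) * of_int (\<gamma> $ i))"
proof -
  define d where "d = (\<lambda>\<gamma>. g \<gamma> (\<gamma> + \<mu>) - h \<gamma> (\<gamma> + \<mu>))"
  have "d (\<gamma> + \<gamma>') = d \<gamma> + d \<gamma>'" for \<gamma> \<gamma>'
  proof (cases "\<mu> = 0 \<or> \<mu> \<notin> pos")
    case True
    have "d \<gamma> = 0" for \<gamma>
      using True
    proof
      assume "\<mu> = 0" then show ?thesis
        using is_autD(2)[OF g] is_autD(2)[OF h] by (simp add: d_def)
    next
      assume "\<mu> \<notin> pos" then show ?thesis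
        using graded_zero'[OF graded_pos[OF S is_autD(1)[OF g]]]
          graded_zero'[OF graded_pos[OF S is_autD(1)[OF h]]] by (simp add: d_def)
    qed
    then show ?thesis by simp
  next
    case False
    then have sub: "{0, \<mu>} \<subseteq> splits \<mu>" by (simp add: splits_def)
    have "d (\<gamma> + \<gamma>') = (\<Sum>\<alpha>\<in>splits \<mu>. g \<gamma> (\<gamma> + \<alpha>) * g \<gamma>' (\<gamma>' + (\<mu> - \<alpha>)) -
        h \<gamma> (\<gamma> + \<alpha>) * h \<gamma>' (\<gamma>' + (\<mu> - \<alpha>)))"
      unfolding d_def is_autD(4)[OF g] is_autD(4)[OF h] sum_subtractf ..
    also have "\<dots> = (\<Sum>\<alpha>\<in>{0, \<mu>}. g \<gamma> (\<gamma> + \<alpha>) * g \<gamma>' (\<gamma>' + (\<mu> - \<alpha>)) -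
        h \<gamma> (\<gamma> + \<alpha>) * h \<gamma>' (\<gamma>' + (\<mu> - \<alpha>)))"
    proof (rule sum.mono_neutral_right[OF finite_splits sub], intro ballI)
      fix \<alpha> assume "\<alpha> \<in> splits \<mu> - {0, \<mu>}"
      then have \<alpha>: "\<alpha> \<in> splits \<mu>" "\<alpha> \<noteq> 0" "\<alpha> \<noteq> \<mu>" by auto
      have "deg (\<mu> - \<alpha>) < N" using splits_interior \<alpha> \<mu> by blast
      moreover have "deg \<alpha> < N"
        using splits_interior[of "\<mu> - \<alpha>" \<mu> N] \<alpha> splitsD[OF \<alpha>(1)] \<mu> by (simp add: splits_def)
      ultimately show "g \<gamma> (\<gamma> + \<alpha>) * g \<gamma>' (\<gamma>' + (\<mu> - \<alpha>)) - h \<gamma> (\<gamma> + \<alpha>) * h \<gamma>' (\<gamma>' + (\<mu> - \<alpha>)) = 0"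
        using eq by simp
    qed
    also have "\<dots> = d \<gamma> + d \<gamma>'"
      using False is_autD(2)[OF g] is_autD(2)[OF h] by (simp add: d_def)
    finally show ?thesis .
  qed
  from additive_lattice_expand[of d \<gamma>, OF this]
  have "d \<gamma> = (\<Sum>i\<in>UNIV. d (axis i 1) * of_int (\<gamma> $ i))"
    unfolding scaleR_conv_of_real of_real_of_int_eq by (subst (asm) mult.commute)
  then show ?thesis unfolding d_def .
qed

text \<open>
  The degrees are real, so the logarithm is built up in layers \<open>N \<le> deg \<delta> < N + 1\<close>. This works because
  nonzero elements of \<open>pos\<close> have degree at least 1.
\<close>

primrec log_approx :: "'n operator \<Rightarrow> nat \<Rightarrow> 'n vfield" where
  "log_approx g 0 = (\<lambda>_. 0)"
| "log_approx g (Suc N) = (\<lambda>\<delta>. if real N \<le> deg \<delta> \<and> deg \<delta> < real N + 1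
     then (\<chi> i. g (axis i 1) (axis i 1 + \<delta>) -
       op_exp (derivation (log_approx g N)) (axis i 1) (axis i 1 + \<delta>)) else log_approx g N \<delta>)"

lemma supp_in_0: "supp_in S (\<lambda>_. 0)"
  by (simp add: supp_in_def)

lemma log_approx_zero: "real N \<le> deg \<delta> \<Longrightarrow> log_approx g N \<delta> = 0"
  by (induction N) auto

lemma log_approx_stable:
  assumes "deg \<delta> < real N"
  shows "log_approx g (N + k) \<delta> = log_approx g N \<delta>"
  using assms by (induction k) auto

text \<open>On the next layer the error of the current exponential is linear in \<gamma> by
  \<open>is_aut_diff_additive\<close>, hence is itself a derivation, determined by its values on the
  coordinates. By \<open>op_exp_change\<close> adding exactly this derivation to the field removes
  the error and disturbs nothing below.\<close>

lemma log_approx: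
  assumes S: "submonoid S" and g: "is_aut S g"
  shows "supp_in S (log_approx g N) \<and> (\<forall>\<gamma> \<mu>. deg \<mu> < real N \<longrightarrow>
    op_exp (derivation (log_approx g N)) \<gamma> (\<gamma> + \<mu>) = g \<gamma> (\<gamma> + \<mu>))"
proof (induction N)
  case 0
  have "op_exp (derivation (\<lambda>_. 0)) \<gamma> (\<gamma> + \<mu>) = g \<gamma> (\<gamma> + \<mu>)" if "deg \<mu> < 0" for \<gamma> \<mu>
  proof -
    have "\<mu> \<notin> pos" using that deg_nonneg by fastforce
    then have "\<mu> \<notin> S" using submonoidD(2)[OF S] by blast
    then show ?thesis
      using op_exp_outside[OF S supp_in_0] graded_zero'[OF is_autD(1)[OF g]] by simp
  qed
  then show ?case by (simp add: supp_in_0)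
next
  case (Suc N)
  define v where "v = log_approx g N"
  define e where "e = op_exp (derivation v)"
  define w where "w = (\<lambda>\<delta>. if real N \<le> deg \<delta> \<and> deg \<delta> < real N + 1
     then (\<chi> i. g (axis i 1) (axis i 1 + \<delta>) - e (axis i 1) (axis i 1 + \<delta>)) else v \<delta>)"
  have next_eq: "log_approx g (Suc N) = w"
    unfolding v_def w_def e_def by (rule log_approx.simps(2))
  have v: "supp_in S v" and eq: "\<And>\<gamma> \<mu>. deg \<mu> < real N \<Longrightarrow> e \<gamma> (\<gamma> + \<mu>) = g \<gamma> (\<gamma> + \<mu>)"
    using Suc by (auto simp: v_def e_def)
  have e: "is_aut S e" unfolding e_def by (rule is_aut_exp[OF S v])
  have w: "supp_in S w"
    unfolding supp_in_def
  proof (intro allI impI)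
    fix \<delta> assume "w \<delta> \<noteq> 0"
    show "\<delta> \<in> S \<and> \<delta> \<noteq> 0"
    proof (cases "v \<delta> = 0")
      case True
      then obtain i where "g (axis i 1) (axis i 1 + \<delta>) \<noteq> e (axis i 1) (axis i 1 + \<delta>)"
        using \<open>w \<delta> \<noteq> 0\<close> by (auto simp: w_def vec_eq_iff split: if_splits)
      then show ?thesis
        using is_autD(2)[OF g] is_autD(2)[OF e]
          graded_zero'[OF is_autD(1)[OF g]] graded_zero'[OF is_autD(1)[OF e]] by fastforce
    qed (use v in \<open>auto simp: supp_in_def\<close>)
  qed
  have "op_exp (derivation w) \<gamma> (\<gamma> + \<mu>) = g \<gamma> (\<gamma> + \<mu>)" if \<mu>: "deg \<mu> < real N + 1" for \<gamma> \<mu>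
  proof -
    have "op_exp (derivation w) \<gamma> (\<gamma> + \<mu>) - e \<gamma> (\<gamma> + \<mu>) =
        derivation w \<gamma> (\<gamma> + \<mu>) - derivation v \<gamma> (\<gamma> + \<mu>)"
      unfolding e_def
      by (rule op_exp_change[OF supp_in_pos[OF S v] supp_in_pos[OF S w] _ \<mu>]) (simp add: w_def)
    also have "\<dots> = g \<gamma> (\<gamma> + \<mu>) - e \<gamma> (\<gamma> + \<mu>)"
    proof (cases "deg \<mu> < real N")
      case True
      then show ?thesis using eq by (simp add: derivation_def w_def)
    next
      case False
      \<comment> \<open>The layer being filled is still empty in \<open>v\<close>, so replacing the
        value and adding the correction are the same.\<close>
      then have "v \<mu> = 0" by (simp add: v_def log_approx_zero)
      with False show ?thesis
        using is_aut_diff_additive[OF S g e _ \<mu>, of \<gamma>] eq \<mu> by (simp add: derivation_def w_def)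
    qed
    finally show ?thesis by simp
  qed
  then show ?case using w unfolding next_eq by (simp add: add.commute[of 1 "real N"])
qed

text \<open>Converse of \<open>is_aut_exp\<close>. In each degree the approximate logarithms become
  stationary, and an entry of the exponential depends on finitely many degrees only.\<close>

lemma is_aut_imp_exp:
  assumes S: "submonoid S" and g: "is_aut S g"
  obtains v where "supp_in S v" "g = op_exp (derivation v)"
proof -
  \<comment> \<open>For nonnegative degree this is the first stage whose range contains \<delta>;
    later stages leave the value alone.\<close>
  define v where "v = (\<lambda>\<delta>. log_approx g (Suc (nat \<lfloor>deg \<delta>\<rfloor>)) \<delta>)"
  have eq: "v \<delta> = log_approx g N \<delta>" if "deg \<delta> < real N" for N \<delta>
  proof (cases "deg \<delta> \<ge> 0")
    case True
    let ?M = "Suc (nat \<lfloor>deg \<delta>\<rfloor>)"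
    have "?M \<le> N" using that True by linarith
    moreover have "deg \<delta> < real ?M" using True by linarith
    ultimately show ?thesis
      using log_approx_stable[of \<delta> ?M g "N - ?M"] by (simp add: v_def)
  next
    case False
    then have "\<delta> \<notin> S" using submonoidD(2)[OF S] deg_nonneg by auto
    then show ?thesis using log_approx[OF S g] unfolding v_def supp_in_def by metis
  qed
  have v: "supp_in S v"
    using log_approx[OF S g] unfolding supp_in_def v_def by blast
  have "op_exp (derivation v) \<gamma> (\<gamma> + \<mu>) = g \<gamma> (\<gamma> + \<mu>)" for \<gamma> \<mu>
  proof -
    obtain N where N: "deg \<mu> < real N" using reals_Archimedean2 by blast
    have "op_exp (derivation v) \<gamma> (\<gamma> + \<mu>) - op_exp (derivation (log_approx g N)) \<gamma> (\<gamma> + \<mu>) =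
        derivation v \<gamma> (\<gamma> + \<mu>) - derivation (log_approx g N) \<gamma> (\<gamma> + \<mu>)"
      using N eq log_approx[OF S g]
      by (intro op_exp_change[where N = "real N"] supp_in_pos[OF S] v) auto
    also have "\<dots> = 0" using eq[OF N] by (simp add: derivation_def)
    finally show ?thesis using log_approx[OF S g] N by simp
  qed
  then have "g = op_exp (derivation v)"
    by (intro ext) (metis add_diff_cancel_left' add_diff_eq)
  with v show thesis by (rule that)
qed

end

section \<open>Weighted norms\<close>

text \<open>Convexity of \<open>exp\<close> between 0 and \<tau> x. It trades a small growth rate
  \<eta> for a small prefactor \<eta>/\<tau> at a fixed rate \<tau>; this is how closeness to the
  identity turns into a numerical gain.\<close>

lemma exp_chord:
  fixes \<eta> \<tau> x :: real
  assumes "0 \<le> \<eta>" "\<eta> \<le> \<tau>" "0 < \<tau>"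
  shows "exp (\<eta> * x) - 1 \<le> \<eta> / \<tau> * exp (\<tau> * x)"
proof -
  have "convex_on UNIV (exp :: real \<Rightarrow> real)"
    by (rule exp_convex)
  then have "exp ((1 - \<eta>/\<tau>) * 0 + \<eta>/\<tau> * (\<tau> * x)) \<le> (1 - \<eta>/\<tau>) * exp 0 + \<eta>/\<tau> * exp (\<tau> * x)"
    using assms convex_onD[of UNIV exp "\<eta>/\<tau>" 0 "\<tau> * x"] by simp
  moreover have "(1 - \<eta>/\<tau>) * 0 + \<eta>/\<tau> * (\<tau> * x) = \<eta> * x" using assms by simp
  moreover have "0 \<le> \<eta> / \<tau>" using assms by simp
  ultimately show ?thesis by simp
qed

text \<open>The right-hand side is the maximum, attained at w = 1/\<tau>. This is the Cauchy
  estimate in disguise: the linear growth in \<gamma> of a derivation is absorbed by a loss \<tau>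
  of radius.\<close>

lemma mult_exp_neg_le:
  fixes \<tau> w :: real
  assumes "0 < \<tau>"
  shows "w * exp (- \<tau> * w) \<le> 1 / (exp 1 * \<tau>)"
proof -
  have "\<tau> * w \<le> exp (\<tau> * w - 1)"
    using exp_ge_add_one_self[of "\<tau> * w - 1"] by simp
  then have "\<tau> * w * exp (- (\<tau> * w)) \<le> exp (\<tau> * w - 1) * exp (- (\<tau> * w))"
    by (rule mult_right_mono) simp
  also have "\<dots> = 1 / exp 1"
    by (simp add: exp_diff exp_minus)
  finally show ?thesis using assms by (simp add: field_simps)
qed

text \<open>A crude Stirling bound: k^k/k! is one term of the series for e^k.\<close>

lemma power_self_le_exp_fact: "real k ^ k \<le> exp (real k) * fact k"
proof -
  have "real k ^ k / fact k = (\<Sum>n\<in>{k}. real k ^ n / fact n)" by simp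
  also have "\<dots> \<le> (\<Sum>n. real k ^ n / fact n)"
    using summable_exp[of "real k"]
    by (intro sum_le_suminf) (auto simp: field_simps)
  also have "\<dots> = exp (real k)"
    by (simp add: exp_def field_simps)
  finally show ?thesis by (simp add: field_simps)
qed

lemma exp_minus_one_le:
  fixes x :: real
  assumes "0 \<le> x" "x \<le> 1"
  shows "exp x - 1 \<le> 2 * x"
  using exp_bound[OF assms] power_le_one_iff[of x 2] mult_left_le[of x x] assms
  by (simp add: power2_eq_square)

lemma exp_le_3: "(\<delta>::real) \<le> 1 \<Longrightarrow> exp \<delta> \<le> 3"
  using exp_le order_trans exp_le_cancel_iff by blast

context grading
begin

text \<open>The weighted l1-norm of g(x^\<gamma>)/x^\<gamma> at logarithmic radius \<open>s\<close>,
  cut off at degree \<open>N\<close>. Bounds uniform in \<open>N\<close> replace summability, so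
  every manipulation is one of finite sums and every norm is finite from the outset.\<close>

definition trunc_norm :: "'n operator \<Rightarrow> real \<Rightarrow> real \<Rightarrow> 'n lattice \<Rightarrow> real" where
  "trunc_norm A s N \<gamma> = (\<Sum>\<mu>\<in>trunc N. cmod (A \<gamma> (\<gamma> + \<mu>)) * exp (s * deg \<mu>))"

text \<open>
  The parameter \<open>s\<close> is a logarithmic radius of convergence. Bounds of the form \<open>exp (\<eta> * ell \<gamma>)\<close> are
  respected by products of monomials and, after lowering \<open>s\<close> by \<open>\<eta>\<close>, by composition of operators.
\<close>

definition exp_bounded :: "'n operator \<Rightarrow> real \<Rightarrow> real \<Rightarrow> bool" where
  "exp_bounded A s \<eta> \<longleftrightarrow> (\<forall>N \<gamma>. trunc_norm A s N \<gamma> \<le> exp (\<eta> * ell \<gamma>))"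

lemma trunc_norm_nonneg [simp]: "0 \<le> trunc_norm A s N \<gamma>"
  by (simp add: trunc_norm_def sum_nonneg)

lemma truncD: "\<mu> \<in> trunc N \<Longrightarrow> \<mu> \<in> pos" "\<mu> \<in> trunc N \<Longrightarrow> deg \<mu> \<le> N"
  by (auto simp: trunc_def)

lemma trunc_neg: "N < 0 \<Longrightarrow> trunc N = {}"
  using deg_nonneg by (fastforce simp: trunc_def)

lemma zero_in_trunc [simp]: "0 \<in> trunc N \<longleftrightarrow> 0 \<le> N"
  by (simp add: trunc_def)

lemma exp_deg_mono: "\<mu> \<in> trunc N \<Longrightarrow> s \<le> s' \<Longrightarrow> exp (s * deg \<mu>) \<le> exp (s' * deg \<mu>)"
  using deg_nonneg truncD(1) by (simp add: mult_right_mono)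

lemma trunc_norm_mono: "s \<le> s' \<Longrightarrow> trunc_norm A s N \<gamma> \<le> trunc_norm A s' N \<gamma>"
  unfolding trunc_norm_def by (intro sum_mono mult_left_mono exp_deg_mono) auto

lemma exp_bounded_mono: "exp_bounded A s' \<eta> \<Longrightarrow> s \<le> s' \<Longrightarrow> \<eta> \<le> \<eta>' \<Longrightarrow> exp_bounded A s \<eta>'"
  unfolding exp_bounded_def
  by (meson ell_nonneg exp_le_cancel_iff mult_right_mono order_trans trunc_norm_mono)

lemma entry_le_trunc_norm:
  assumes "\<mu> \<in> trunc N"
  shows "cmod (A \<gamma> (\<gamma> + \<mu>)) * exp (s * deg \<mu>) \<le> trunc_norm A s N \<gamma>"
  unfolding trunc_norm_def using assms by (intro member_le_sum) auto

text \<open>The weight is multiplicative, and both parts of an exponent of degree at most N again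
  have degree at most N. The kernel depends on both parts jointly so that compositions, where the
  second factor depends on the first shift, are covered along with products.\<close>

lemma trunc_conv_le:
  "(\<Sum>\<mu>\<in>trunc N. cmod (\<Sum>\<alpha>\<in>splits \<mu>. k \<alpha> (\<mu> - \<alpha>)) * exp (s * deg \<mu>)) \<le>
   (\<Sum>\<alpha>\<in>trunc N. \<Sum>\<beta>\<in>trunc N. cmod (k \<alpha> \<beta>) * exp (s * deg \<alpha>) * exp (s * deg \<beta>))"
proof -
  let ?f = "\<lambda>\<alpha> \<beta>. cmod (k \<alpha> \<beta>) * exp (s * deg \<alpha>) * exp (s * deg \<beta>)"
  have "(\<Sum>\<mu>\<in>trunc N. cmod (\<Sum>\<alpha>\<in>splits \<mu>. k \<alpha> (\<mu> - \<alpha>)) * exp (s * deg \<mu>)) \<le>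
      (\<Sum>\<mu>\<in>trunc N. \<Sum>\<alpha>\<in>splits \<mu>. ?f \<alpha> (\<mu> - \<alpha>))"
  proof (rule sum_mono)
    fix \<mu>
    have "cmod (\<Sum>\<alpha>\<in>splits \<mu>. k \<alpha> (\<mu> - \<alpha>)) * exp (s * deg \<mu>) \<le>
        (\<Sum>\<alpha>\<in>splits \<mu>. cmod (k \<alpha> (\<mu> - \<alpha>))) * exp (s * deg \<mu>)"
      by (intro mult_right_mono norm_sum) simp
    also have "\<dots> = (\<Sum>\<alpha>\<in>splits \<mu>. ?f \<alpha> (\<mu> - \<alpha>))"
      unfolding sum_distrib_right
      by (intro sum.cong refl) (simp add: deg_diff algebra_simps flip: exp_add)
    finally show "cmod (\<Sum>\<alpha>\<in>splits \<mu>. k \<alpha> (\<mu> - \<alpha>)) * exp (s * deg \<mu>) \<le> (\<Sum>\<alpha>\<in>splits \<mu>. ?f \<alpha> (\<mu> - \<alpha>))" .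
  qed
  also have "\<dots> = (\<Sum>(\<mu>,\<alpha>)\<in>(SIGMA \<mu>:trunc N. splits \<mu>). ?f \<alpha> (\<mu> - \<alpha>))"
    by (rule sum.Sigma) auto
  also have "\<dots> = (\<Sum>(\<alpha>,\<beta>)\<in>{(\<alpha>,\<beta>). \<alpha> \<in> trunc N \<and> \<beta> \<in> trunc N \<and> \<alpha> + \<beta> \<in> trunc N}. ?f \<alpha> \<beta>)"
  proof -
    have a: "\<alpha> \<in> trunc N" "\<mu> - \<alpha> \<in> trunc N" if "\<mu> \<in> trunc N" "\<alpha> \<in> splits \<mu>" for \<mu> \<alpha>
      using that splitsD[OF that(2)] by (auto simp: trunc_def)
    have b: "\<alpha> \<in> splits (\<alpha> + \<beta>)" if "\<alpha> \<in> trunc N" "\<beta> \<in> trunc N" for \<alpha> \<beta>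
      using that by (auto simp: trunc_def splits_def)
    show ?thesis
      by (rule sum.reindex_bij_witness[where j = "\<lambda>(\<mu>,\<alpha>). (\<alpha>, \<mu> - \<alpha>)" and i = "\<lambda>(\<alpha>,\<beta>). (\<alpha> + \<beta>, \<alpha>)"])
        (use a b in auto)
  qed
  also have "\<dots> \<le> (\<Sum>(\<alpha>,\<beta>)\<in>trunc N \<times> trunc N. ?f \<alpha> \<beta>)"
    by (rule sum_mono2) auto
  also have "\<dots> = (\<Sum>\<alpha>\<in>trunc N. \<Sum>\<beta>\<in>trunc N. ?f \<alpha> \<beta>)"
    by (rule sum.cartesian_product[symmetric])
  finally show ?thesis .
qed

lemma trunc_norm_comp:
  assumes "graded pos A" "graded pos B"
  shows "trunc_norm (op_comp A B) s N \<gamma> \<le>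
    (\<Sum>\<alpha>\<in>trunc N. cmod (B \<gamma> (\<gamma> + \<alpha>)) * exp (s * deg \<alpha>) * trunc_norm A s N (\<gamma> + \<alpha>))"
proof -
  let ?k = "\<lambda>\<alpha> \<beta>. B \<gamma> (\<gamma> + \<alpha>) * A (\<gamma> + \<alpha>) (\<gamma> + \<alpha> + \<beta>)"
  have "trunc_norm (op_comp A B) s N \<gamma> = (\<Sum>\<mu>\<in>trunc N. cmod (\<Sum>\<alpha>\<in>splits \<mu>. ?k \<alpha> (\<mu> - \<alpha>)) * exp (s * deg \<mu>))"
    unfolding trunc_norm_def op_comp_splits[OF assms] by simp
  also have "\<dots> \<le> (\<Sum>\<alpha>\<in>trunc N. \<Sum>\<beta>\<in>trunc N. cmod (?k \<alpha> \<beta>) * exp (s * deg \<alpha>) * exp (s * deg \<beta>))"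
    by (rule trunc_conv_le)
  also have "\<dots> = (\<Sum>\<alpha>\<in>trunc N. cmod (B \<gamma> (\<gamma> + \<alpha>)) * exp (s * deg \<alpha>) * trunc_norm A s N (\<gamma> + \<alpha>))"
    unfolding trunc_norm_def sum_distrib_left by (intro sum.cong refl) (simp add: norm_mult algebra_simps)
  finally show ?thesis .
qed

lemma trunc_norm_comp_le:
  assumes A: "graded pos A" and B: "graded pos B"
    and le: "\<And>\<alpha>. \<alpha> \<in> trunc N \<Longrightarrow> exp (s * deg \<alpha>) * trunc_norm A s N (\<gamma> + \<alpha>) \<le> c * exp (s' * deg \<alpha>)"
  shows "trunc_norm (op_comp A B) s N \<gamma> \<le> c * trunc_norm B s' N \<gamma>"
proof -
  have "trunc_norm (op_comp A B) s N \<gamma> \<le> (\<Sum>\<alpha>\<in>trunc N. cmod (B \<gamma> (\<gamma> + \<alpha>)) * (exp (s * deg \<alpha>) * trunc_norm A s N (\<gamma> + \<alpha>)))"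
    using trunc_norm_comp[OF A B] by (simp add: mult.assoc)
  also have "\<dots> \<le> (\<Sum>\<alpha>\<in>trunc N. cmod (B \<gamma> (\<gamma> + \<alpha>)) * (c * exp (s' * deg \<alpha>)))"
    by (intro sum_mono mult_left_mono le) auto
  also have "\<dots> = c * trunc_norm B s' N \<gamma>"
    by (simp add: trunc_norm_def sum_distrib_left mult_ac)
  finally show ?thesis .
qed

lemma ell_shift: "\<alpha> \<in> trunc N \<Longrightarrow> ell (\<gamma> + \<alpha>) \<le> ell \<gamma> + deg \<alpha>"
  using ell_add[of \<gamma> \<alpha>] ell_le_deg[OF truncD(1)] by fastforce

text \<open>\<open>A\<close> is applied to x^(\<gamma> + \<alpha>), where its growth is at most exp
  (\<eta> (ell \<gamma> + deg \<alpha>)); the second part is charged to the radius at which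
  \<open>B\<close> is measured.\<close>

lemma trunc_norm_comp_exp_bounded:
  assumes A: "graded pos A" and B: "graded pos B" and bound: "exp_bounded A s \<eta>" and \<eta>: "0 \<le> \<eta>"
  shows "trunc_norm (op_comp A B) s N \<gamma> \<le> exp (\<eta> * ell \<gamma>) * trunc_norm B (s + \<eta>) N \<gamma>"
proof (rule trunc_norm_comp_le[OF A B])
  fix \<alpha> assume \<alpha>: "\<alpha> \<in> trunc N"
  have "exp (s * deg \<alpha>) * trunc_norm A s N (\<gamma> + \<alpha>) \<le> exp (s * deg \<alpha>) * exp (\<eta> * (ell \<gamma> + deg \<alpha>))"
    using bound mult_left_mono[OF ell_shift[OF \<alpha>, of \<gamma>] \<eta>] unfolding exp_bounded_def
    by (intro mult_left_mono order_trans[OF bound[unfolded exp_bounded_def, rule_format]]) auto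
  then show "exp (s * deg \<alpha>) * trunc_norm A s N (\<gamma> + \<alpha>) \<le> exp (\<eta> * ell \<gamma>) * exp ((s + \<eta>) * deg \<alpha>)"
    by (simp add: algebra_simps flip: exp_add)
qed

lemma exp_bounded_comp:
  assumes A: "graded pos A" and B: "graded pos B" and bA: "exp_bounded A s \<eta>" and bB: "exp_bounded B (s + \<eta>) \<eta>'"
    and \<eta>: "0 \<le> \<eta>"
  shows "exp_bounded (op_comp A B) s (\<eta> + \<eta>')"
  unfolding exp_bounded_def
proof (intro allI)
  fix N \<gamma>
  have "trunc_norm (op_comp A B) s N \<gamma> \<le> exp (\<eta> * ell \<gamma>) * trunc_norm B (s + \<eta>) N \<gamma>"
    by (rule trunc_norm_comp_exp_bounded[OF A B bA \<eta>])
  also have "\<dots> \<le> exp (\<eta> * ell \<gamma>) * exp (\<eta>' * ell \<gamma>)"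
    using bB by (auto simp: exp_bounded_def)
  finally show "trunc_norm (op_comp A B) s N \<gamma> \<le> exp ((\<eta> + \<eta>') * ell \<gamma>)"
    by (simp add: algebra_simps flip: exp_add)
qed

lemma trunc_norm_one: "trunc_norm op_one s N \<gamma> = (if 0 \<le> N then 1 else 0)"
proof -
  have "trunc_norm op_one s N \<gamma> = (\<Sum>\<mu>\<in>trunc N. if \<mu> = 0 then 1 else 0)"
    unfolding trunc_norm_def by (intro sum.cong) (auto simp: op_one_def)
  then show ?thesis by simp
qed

lemma exp_bounded_one: "exp_bounded op_one s 0"
  by (simp add: exp_bounded_def trunc_norm_one)

lemma trunc_norm_minus_one:
  assumes "g \<gamma> \<gamma> = 1"
  shows "trunc_norm (g - op_one) s N \<gamma> = (if 0 \<le> N then trunc_norm g s N \<gamma> - 1 else 0)"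
proof (cases "0 \<le> N")
  case True
  have "trunc_norm (g - op_one) s N \<gamma> = (\<Sum>\<mu>\<in>trunc N. cmod (g \<gamma> (\<gamma> + \<mu>)) * exp (s * deg \<mu>) - (if \<mu> = 0 then 1 else 0))"
    unfolding trunc_norm_def using assms by (intro sum.cong) (auto simp: op_one_def)
  then show ?thesis using True by (simp add: sum_subtractf trunc_norm_def)
qed (simp add: trunc_norm_def trunc_neg)

lemma trunc_norm_minus_one_le:
  assumes "g \<gamma> \<gamma> = 1" "exp_bounded g s \<eta>" "0 \<le> \<eta>"
  shows "trunc_norm (g - op_one) s N \<gamma> \<le> exp (\<eta> * ell \<gamma>) - 1"
  using assms ell_nonneg[of \<gamma>] by (auto simp: trunc_norm_minus_one exp_bounded_def)

lemma trunc_norm_le_minus_one: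
  assumes "g \<gamma> \<gamma> = 1"
  shows "trunc_norm g s N \<gamma> \<le> 1 + trunc_norm (g - op_one) s N \<gamma>"
  using trunc_norm_minus_one[of g \<gamma> s N, OF assms]
  by (cases "0 \<le> N") (simp, simp add: trunc_norm_def trunc_neg)

text \<open>Subtracting the identity gains the factor \<eta>/\<tau>, by \<open>exp_chord\<close>, at
  the price of measuring \<open>X\<close> at a radius larger by \<tau> instead of \<eta>.\<close>

lemma trunc_norm_comp_minus_one:
  assumes A: "graded pos A" "\<And>\<gamma>. A \<gamma> \<gamma> = 1" and X: "graded pos X" and bound: "exp_bounded A s \<eta>"
    and \<eta>: "0 \<le> \<eta>" "\<eta> \<le> \<tau>" "0 < \<tau>"
  shows "trunc_norm (op_comp (A - op_one) X) s N \<gamma> \<le> \<eta> / \<tau> * exp (\<tau> * ell \<gamma>) * trunc_norm X (s + \<tau>) N \<gamma>"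
proof (rule trunc_norm_comp_le[OF _ X])
  show "graded pos (A - op_one)"
    by (intro graded_diff A graded_one zero_pos)
  fix \<alpha> assume \<alpha>: "\<alpha> \<in> trunc N"
  have "trunc_norm (A - op_one) s N (\<gamma> + \<alpha>) \<le> exp (\<eta> * ell (\<gamma> + \<alpha>)) - 1"
    by (rule trunc_norm_minus_one_le[OF A(2) bound \<eta>(1)])
  also have "\<dots> \<le> \<eta> / \<tau> * exp (\<tau> * ell (\<gamma> + \<alpha>))"
    by (rule exp_chord[OF \<eta>])
  also have "\<dots> \<le> \<eta> / \<tau> * exp (\<tau> * (ell \<gamma> + deg \<alpha>))"
    using \<eta> ell_shift[OF \<alpha>, of \<gamma>] by (intro mult_left_mono) auto
  finally have "exp (s * deg \<alpha>) * trunc_norm (A - op_one) s N (\<gamma> + \<alpha>) \<le>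
      exp (s * deg \<alpha>) * (\<eta> / \<tau> * exp (\<tau> * (ell \<gamma> + deg \<alpha>)))"
    by (rule mult_left_mono) simp
  then show "exp (s * deg \<alpha>) * trunc_norm (A - op_one) s N (\<gamma> + \<alpha>) \<le>
      \<eta> / \<tau> * exp (\<tau> * ell \<gamma>) * exp ((s + \<tau>) * deg \<alpha>)"
    by (simp add: algebra_simps exp_add)
qed

lemma trunc_norm_aut_add:
  assumes "is_aut S g"
  shows "trunc_norm g s N (\<gamma> + \<gamma>') \<le> trunc_norm g s N \<gamma> * trunc_norm g s N \<gamma>'"
proof -
  have "trunc_norm g s N (\<gamma> + \<gamma>') = (\<Sum>\<mu>\<in>trunc N. cmod (\<Sum>\<alpha>\<in>splits \<mu>. g \<gamma> (\<gamma> + \<alpha>) * g \<gamma>' (\<gamma>' + (\<mu> - \<alpha>))) * exp (s * deg \<mu>))"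
    unfolding trunc_norm_def is_autD(4)[OF assms] ..
  also have "\<dots> \<le> (\<Sum>\<alpha>\<in>trunc N. \<Sum>\<beta>\<in>trunc N. cmod (g \<gamma> (\<gamma> + \<alpha>) * g \<gamma>' (\<gamma>' + \<beta>)) * exp (s * deg \<alpha>) * exp (s * deg \<beta>))"
    by (rule trunc_conv_le[where k = "\<lambda>\<alpha> \<beta>. g \<gamma> (\<gamma> + \<alpha>) * g \<gamma>' (\<gamma>' + \<beta>)"])
  also have "\<dots> = trunc_norm g s N \<gamma> * trunc_norm g s N \<gamma>'"
    unfolding trunc_norm_def sum_product by (intro sum.cong refl) (simp add: norm_mult mult_ac)
  finally show ?thesis .
qed

text \<open>Multiplicativity makes the truncated norm submultiplicative in \<gamma>, and \<gamma> is
  a sum of \<open>ell \<gamma>\<close> coordinate vectors up to sign.\<close>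

lemma exp_bounded_from_axes:
  assumes g: "is_aut S g" and \<eta>: "0 \<le> \<eta>"
    and plus: "\<And>i N. trunc_norm g s N (axis i 1) \<le> exp \<eta>"
    and minus: "\<And>i N. trunc_norm g s N (- axis i 1) \<le> exp \<eta>"
  shows "exp_bounded g s \<eta>"
  unfolding exp_bounded_def
proof (intro allI)
  fix N \<gamma>
  have zero: "trunc_norm g s N 0 \<le> 1"
  proof -
    have "trunc_norm g s N 0 = trunc_norm op_one s N 0"
      unfolding trunc_norm_def using is_autD(3)[OF g] by simp
    then show ?thesis by (simp add: trunc_norm_one)
  qed
  have nat: "trunc_norm g s N (axis i (int k)) \<le> exp (\<eta> * real k) \<and> trunc_norm g s N (axis i (- int k)) \<le> exp (\<eta> * real k)" for i k
  proof (induction k)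
    case 0
    have "axis i (0::int) = 0"
      by (simp add: vec_eq_iff axis_def)
    then show ?case using zero by (simp only: of_nat_0 minus_zero mult_zero_right exp_zero)
  next
    case (Suc k)
    have e: "axis i (int (Suc k)) = axis i (int k) + axis i 1"
      "axis i (- int (Suc k)) = axis i (- int k) + - axis i 1"
      by (auto simp: vec_eq_iff axis_def)
    have "trunc_norm g s N (axis i (int (Suc k))) \<le> exp (\<eta> * real k) * exp \<eta>"
      unfolding e using Suc plus
      by (intro order_trans[OF trunc_norm_aut_add[OF g]] mult_mono) auto
    moreover have "trunc_norm g s N (axis i (- int (Suc k))) \<le> exp (\<eta> * real k) * exp \<eta>"
      unfolding e using Suc minus
      by (intro order_trans[OF trunc_norm_aut_add[OF g]] mult_mono) auto
    ultimately show ?case by (simp add: algebra_simps exp_add)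
  qed
  have int: "trunc_norm g s N (axis i k) \<le> exp (\<eta> * \<bar>real_of_int k\<bar>)" for i k
  proof (cases "k \<ge> 0")
    case True
    then show ?thesis using nat[of i "nat k"] by simp
  next
    case False
    then show ?thesis using nat[of i "nat (- k)"] by simp
  qed
  have "trunc_norm g s N (\<Sum>i\<in>I. axis i (\<gamma> $ i)) \<le> exp (\<eta> * (\<Sum>i\<in>I. \<bar>real_of_int (\<gamma> $ i)\<bar>))"
    if "finite I" for I
    using that
  proof (induction I)
    case empty
    then show ?case using zero by simp
  next
    case (insert j I)
    have "trunc_norm g s N (\<Sum>i\<in>insert j I. axis i (\<gamma> $ i)) \<le>
        exp (\<eta> * \<bar>real_of_int (\<gamma> $ j)\<bar>) * exp (\<eta> * (\<Sum>i\<in>I. \<bar>real_of_int (\<gamma> $ i)\<bar>))"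
      using insert int
      by (simp, intro order_trans[OF trunc_norm_aut_add[OF g]] mult_mono) auto
    then show ?case using insert by (simp add: algebra_simps flip: exp_add)
  qed
  from this[of UNIV] have "trunc_norm g s N (\<Sum>i\<in>UNIV. axis i (\<gamma> $ i)) \<le> exp (\<eta> * ell \<gamma>)"
    by (simp add: ell_def)
  also have "(\<Sum>i\<in>UNIV. axis i (\<gamma> $ i)) = \<gamma>"
    by (simp add: vec_eq_iff axis_def)
  finally show "trunc_norm g s N \<gamma> \<le> exp (\<eta> * ell \<gamma>)" .
qed

text \<open>The series y of x^(-\<gamma>) inverts 1 + u, where u has norm at most \<epsilon>. From y
  = 1 - u y follows |y| \<le> 1 + \<epsilon> |y|, which may be solved for |y| because the truncated
  norm is finite; then 1/(1 - \<epsilon>) \<le> 1 + 2 \<epsilon> for \<epsilon> up to 1/2.\<close>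

lemma trunc_norm_aut_minus:
  assumes S: "submonoid S" and g: "is_aut S g" and le: "trunc_norm (g - op_one) s N \<gamma> \<le> \<epsilon>" and \<epsilon>: "\<epsilon> \<le> 1/2"
  shows "trunc_norm g s N (- \<gamma>) \<le> exp (2 * \<epsilon>)"
proof -
  define u where "u = (\<lambda>\<alpha>. (g - op_one) \<gamma> (\<gamma> + \<alpha>))"
  define y where "y = (\<lambda>\<alpha>. g (- \<gamma>) (- \<gamma> + \<alpha>))"
  have y_eq: "y \<mu> = op_one 0 \<mu> - (\<Sum>\<alpha>\<in>splits \<mu>. u \<alpha> * y (\<mu> - \<alpha>))" if "\<mu> \<in> pos" for \<mu>
  proof -
    have "op_one 0 \<mu> = (\<Sum>\<alpha>\<in>splits \<mu>. g \<gamma> (\<gamma> + \<alpha>) * y (\<mu> - \<alpha>))"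
      using is_autD(4)[OF g, of \<gamma> "- \<gamma>" \<mu>] is_autD(3)[OF g, of \<mu>] by (simp add: y_def)
    also have "\<dots> = (\<Sum>\<alpha>\<in>splits \<mu>. u \<alpha> * y (\<mu> - \<alpha>) + (if \<alpha> = 0 then y \<mu> else 0))"
      by (intro sum.cong) (auto simp: u_def op_one_def algebra_simps)
    finally show ?thesis using that by (simp add: sum.distrib)
  qed
  have "trunc_norm g s N (- \<gamma>) = (\<Sum>\<mu>\<in>trunc N. cmod (y \<mu>) * exp (s * deg \<mu>))"
    by (simp add: trunc_norm_def y_def)
  also have "\<dots> \<le> (\<Sum>\<mu>\<in>trunc N. cmod (op_one 0 (0 + \<mu>)) * exp (s * deg \<mu>) +
      cmod (\<Sum>\<alpha>\<in>splits \<mu>. u \<alpha> * y (\<mu> - \<alpha>)) * exp (s * deg \<mu>))"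
    unfolding distrib_right[symmetric]
    by (intro sum_mono mult_right_mono, subst y_eq) (auto intro: norm_triangle_ineq4 dest: truncD)
  also have "\<dots> \<le> 1 + (\<Sum>\<alpha>\<in>trunc N. \<Sum>\<beta>\<in>trunc N. cmod (u \<alpha> * y \<beta>) * exp (s * deg \<alpha>) * exp (s * deg \<beta>))"
    unfolding sum.distrib
    using trunc_norm_one[of s N 0] by (intro add_mono trunc_conv_le[where k = "\<lambda>\<alpha> \<beta>. u \<alpha> * y \<beta>"]) (simp add: trunc_norm_def)
  also have "(\<Sum>\<alpha>\<in>trunc N. \<Sum>\<beta>\<in>trunc N. cmod (u \<alpha> * y \<beta>) * exp (s * deg \<alpha>) * exp (s * deg \<beta>)) =
      trunc_norm (g - op_one) s N \<gamma> * trunc_norm g s N (- \<gamma>)"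
    unfolding trunc_norm_def sum_product by (intro sum.cong refl) (simp add: norm_mult mult_ac u_def y_def)
  also have "\<dots> \<le> \<epsilon> * trunc_norm g s N (- \<gamma>)"
    using le by (intro mult_right_mono) auto
  finally have *: "trunc_norm g s N (- \<gamma>) * (1 - \<epsilon>) \<le> 1" by (simp add: algebra_simps)
  have "0 \<le> \<epsilon>" using le trunc_norm_nonneg order_trans by blast
  then have "1 \<le> (1 + 2 * \<epsilon>) * (1 - \<epsilon>)"
    using \<epsilon> mult_nonneg_nonneg[of \<epsilon> "1 - 2 * \<epsilon>"] by (simp add: algebra_simps)
  with * have "trunc_norm g s N (- \<gamma>) * (1 - \<epsilon>) \<le> (1 + 2 * \<epsilon>) * (1 - \<epsilon>)" by linarith
  then have "trunc_norm g s N (- \<gamma>) \<le> 1 + 2 * \<epsilon>" using \<epsilon> by simp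
  then show ?thesis using exp_ge_add_one_self[of "2 * \<epsilon>"] by linarith
qed

text \<open>Only the images of the coordinates enter, since these carry the linear part that a
  vector field has to match; their inverses are recovered from \<open>trunc_norm_aut_minus\<close>.
  Summing over the coordinates agrees with the norm in \<open>vfield_bounded\<close>.\<close>

definition close_to_one :: "'n operator \<Rightarrow> real \<Rightarrow> real \<Rightarrow> bool" where
  "close_to_one g s \<epsilon> \<longleftrightarrow> (\<forall>N. (\<Sum>i\<in>UNIV. trunc_norm (g - op_one) s N (axis i 1)) \<le> \<epsilon>)"

lemma close_to_oneD:
  assumes "close_to_one g s \<epsilon>"
  shows "trunc_norm (g - op_one) s N (axis i 1) \<le> \<epsilon>"
proof -
  have "trunc_norm (g - op_one) s N (axis i 1) \<le> (\<Sum>i\<in>UNIV. trunc_norm (g - op_one) s N (axis i 1))"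
    by (rule member_le_sum) (auto simp del: fun_diff_def)
  also have "\<dots> \<le> \<epsilon>" using assms unfolding close_to_one_def by blast
  finally show ?thesis .
qed

lemma close_to_one_nonneg: "close_to_one g s \<epsilon> \<Longrightarrow> 0 \<le> \<epsilon>"
  unfolding close_to_one_def by (meson order_trans trunc_norm_nonneg sum_nonneg)

text \<open>The coordinates themselves satisfy the bound 1 + \<epsilon>; the factor 2 is due to
  their inverses.\<close>

lemma exp_bounded_of_close_to_one:
  assumes S: "submonoid S" and g: "is_aut S g" and close: "close_to_one g s \<epsilon>" and \<epsilon>: "\<epsilon> \<le> 1/2"
  shows "exp_bounded g s (2 * \<epsilon>)"
proof (rule exp_bounded_from_axes[OF g])
  show nn: "0 \<le> 2 * \<epsilon>" using close_to_one_nonneg[OF close] by simp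
  show "trunc_norm g s N (axis i 1) \<le> exp (2 * \<epsilon>)" for i N
    using trunc_norm_le_minus_one[of g "axis i 1" s N, OF is_autD(2)[OF g]] close_to_oneD[OF close, of N i]
      exp_ge_add_one_self[of "2 * \<epsilon>"] nn by linarith
  show "trunc_norm g s N (- axis i 1) \<le> exp (2 * \<epsilon>)" for i N
    by (rule trunc_norm_aut_minus[OF S g close_to_oneD[OF close] \<epsilon>])
qed

section \<open>Estimates for exponentials of vector fields\<close>

definition vfield_bounded :: "'n vfield \<Rightarrow> real \<Rightarrow> real \<Rightarrow> bool" where
  "vfield_bounded v s \<epsilon> \<longleftrightarrow> (\<forall>N. (\<Sum>\<delta>\<in>trunc N. (\<Sum>i\<in>UNIV. cmod (v \<delta> $ i)) * exp (s * deg \<delta>)) \<le> \<epsilon>)"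

lemma vfield_bounded_nonneg: "vfield_bounded v s \<epsilon> \<Longrightarrow> 0 \<le> \<epsilon>"
  unfolding vfield_bounded_def using trunc_neg[of "-1"] by (auto dest: spec[of _ "-1"])

lemma vfield_bounded_mono:
  assumes "vfield_bounded v s' \<epsilon>" "s \<le> s'"
  shows "vfield_bounded v s \<epsilon>"
  unfolding vfield_bounded_def
proof
  fix N
  have "(\<Sum>\<delta>\<in>trunc N. (\<Sum>i\<in>UNIV. cmod (v \<delta> $ i)) * exp (s * deg \<delta>)) \<le>
      (\<Sum>\<delta>\<in>trunc N. (\<Sum>i\<in>UNIV. cmod (v \<delta> $ i)) * exp (s' * deg \<delta>))"
    using assms(2) by (intro sum_mono mult_left_mono exp_deg_mono) (auto intro: sum_nonneg)
  also have "\<dots> \<le> \<epsilon>" using assms(1) by (simp add: vfield_bounded_def)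
  finally show "(\<Sum>\<delta>\<in>trunc N. (\<Sum>i\<in>UNIV. cmod (v \<delta> $ i)) * exp (s * deg \<delta>)) \<le> \<epsilon>" .
qed

lemma trunc_norm_derivation:
  assumes "vfield_bounded v s \<epsilon>"
  shows "trunc_norm (derivation v) s N \<gamma> \<le> \<epsilon> * ell \<gamma>"
proof -
  have "trunc_norm (derivation v) s N \<gamma> \<le> (\<Sum>\<delta>\<in>trunc N. (\<Sum>i\<in>UNIV. cmod (v \<delta> $ i)) * ell \<gamma> * exp (s * deg \<delta>))"
    unfolding trunc_norm_def
  proof (intro sum_mono mult_right_mono)
    fix \<delta>
    have "cmod (derivation v \<gamma> (\<gamma> + \<delta>)) \<le> (\<Sum>i\<in>UNIV. cmod (v \<delta> $ i) * \<bar>real_of_int (\<gamma> $ i)\<bar>)"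
      unfolding derivation_def by (rule order_trans[OF norm_sum]) (simp add: norm_mult)
    also have "\<dots> \<le> (\<Sum>i\<in>UNIV. cmod (v \<delta> $ i) * ell \<gamma>)"
      by (intro sum_mono mult_left_mono ell_ge_comp) auto
    finally show "cmod (derivation v \<gamma> (\<gamma> + \<delta>)) \<le> (\<Sum>i\<in>UNIV. cmod (v \<delta> $ i)) * ell \<gamma>"
      by (simp add: sum_distrib_right)
  qed auto
  also have "\<dots> = (\<Sum>\<delta>\<in>trunc N. (\<Sum>i\<in>UNIV. cmod (v \<delta> $ i)) * exp (s * deg \<delta>)) * ell \<gamma>"
    by (simp add: sum_distrib_left sum_distrib_right mult_ac)
  also have "\<dots> \<le> \<epsilon> * ell \<gamma>"
    using assms ell_nonneg by (intro mult_right_mono) (auto simp: vfield_bounded_def)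
  finally show ?thesis .
qed

text \<open>Each application multiplies by at most \<epsilon> times the \<open>ell\<close> of the
  current exponent; \<open>mult_exp_neg_le\<close> replaces that factor by 1/(e \<tau>) at a cost
  \<tau> of radius.\<close>

lemma trunc_norm_derivation_pow:
  assumes v: "supp_in pos v" and v_bound: "vfield_bounded v s \<epsilon>" and \<tau>: "0 < \<tau>"
  shows "trunc_norm (derivation_pow v k) (s - real k * \<tau>) N \<gamma> \<le> (\<epsilon> / (exp 1 * \<tau>)) ^ k * exp (real k * \<tau> * ell \<gamma>)"
proof (induction k)
  case 0
  then show ?case by (simp add: trunc_norm_one)
next
  case (Suc k)
  let ?s = "s - real (Suc k) * \<tau>"
  have v_bound': "vfield_bounded v ?s \<epsilon>" using \<tau> by (intro vfield_bounded_mono[OF v_bound]) simp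
  have \<epsilon>: "0 \<le> \<epsilon>" using v_bound by (rule vfield_bounded_nonneg)
  have "trunc_norm (derivation_pow v (Suc k)) ?s N \<gamma> \<le> (\<epsilon> / (exp 1 * \<tau>) * exp (\<tau> * ell \<gamma>)) * trunc_norm (derivation_pow v k) (s - real k * \<tau>) N \<gamma>"
    unfolding derivation_pow_Suc
  proof (rule trunc_norm_comp_le[OF graded_derivation[OF v] graded_derivation_pow[OF submonoid_pos v]])
    fix \<alpha> assume \<alpha>: "\<alpha> \<in> trunc N"
    define w where "w = ell \<gamma> + deg \<alpha>"
    have "trunc_norm (derivation v) ?s N (\<gamma> + \<alpha>) \<le> \<epsilon> * w"
      using trunc_norm_derivation[OF v_bound', of N "\<gamma> + \<alpha>"] mult_left_mono[OF ell_shift[OF \<alpha>, of \<gamma>] \<epsilon>]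
      by (simp add: w_def)
    also have "\<dots> = \<epsilon> * (w * exp (- \<tau> * w)) * exp (\<tau> * w)"
      by (simp add: exp_minus)
    also have "\<dots> \<le> \<epsilon> * (1 / (exp 1 * \<tau>)) * exp (\<tau> * w)"
      by (intro mult_right_mono mult_left_mono mult_exp_neg_le \<tau> \<epsilon>) simp
    finally have "exp (?s * deg \<alpha>) * trunc_norm (derivation v) ?s N (\<gamma> + \<alpha>) \<le>
        exp (?s * deg \<alpha>) * (\<epsilon> * (1 / (exp 1 * \<tau>)) * exp (\<tau> * w))"
      by (rule mult_left_mono) simp
    also have "\<dots> = \<epsilon> / (exp 1 * \<tau>) * (exp (?s * deg \<alpha>) * exp (\<tau> * w))" by simp
    also have "exp (?s * deg \<alpha>) * exp (\<tau> * w) = exp (\<tau> * ell \<gamma>) * exp ((s - real k * \<tau>) * deg \<alpha>)"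
      unfolding w_def exp_add[symmetric] by (simp add: algebra_simps)
    finally show "exp (?s * deg \<alpha>) * trunc_norm (derivation v) ?s N (\<gamma> + \<alpha>) \<le>
        \<epsilon> / (exp 1 * \<tau>) * exp (\<tau> * ell \<gamma>) * exp ((s - real k * \<tau>) * deg \<alpha>)"
      by (simp add: mult.assoc)
  qed
  also have "\<dots> \<le> (\<epsilon> / (exp 1 * \<tau>) * exp (\<tau> * ell \<gamma>)) * ((\<epsilon> / (exp 1 * \<tau>)) ^ k * exp (real k * \<tau> * ell \<gamma>))"
    using \<epsilon> \<tau> by (intro mult_left_mono Suc.IH) auto
  also have "\<dots> = (\<epsilon> / (exp 1 * \<tau>)) ^ Suc k * (exp (\<tau> * ell \<gamma>) * exp (real k * \<tau> * ell \<gamma>))"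
    by simp
  also have "exp (\<tau> * ell \<gamma>) * exp (real k * \<tau> * ell \<gamma>) = exp (real (Suc k) * \<tau> * ell \<gamma>)"
    unfolding exp_add[symmetric] by (simp add: algebra_simps)
  finally show ?case .
qed

lemma trunc_norm_derivation_pow_fact:
  assumes v: "supp_in pos v" and v_bound: "vfield_bounded v s \<epsilon>" and \<delta>: "0 < \<delta>"
  shows "trunc_norm (derivation_pow v k) (s - \<delta>) N \<gamma> / fact k \<le> (\<epsilon> / \<delta>) ^ k * exp (\<delta> * ell \<gamma>)"
proof (cases "k = 0")
  case True
  then show ?thesis using \<delta> ell_nonneg[of \<gamma>] by (simp add: trunc_norm_one)
next
  case False
  \<comment> \<open>Splitting the loss into k equal shares keeps the total at \<delta> for every k.
    The resulting (k/e)^k is compensated by k!.\<close>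
  define \<tau> where "\<tau> = \<delta> / real k"
  have \<tau>: "0 < \<tau>" "real k * \<tau> = \<delta>" using False \<delta> by (auto simp: \<tau>_def)
  have \<epsilon>: "0 \<le> \<epsilon>" using v_bound by (rule vfield_bounded_nonneg)
  have "\<epsilon> / (exp 1 * \<tau>) = (\<epsilon> / \<delta>) * (real k / exp 1)"
    using False by (simp add: \<tau>_def field_simps)
  then have "trunc_norm (derivation_pow v k) (s - \<delta>) N \<gamma> \<le> ((\<epsilon> / \<delta>) ^ k * (real k / exp 1) ^ k) * exp (\<delta> * ell \<gamma>)"
    using trunc_norm_derivation_pow[OF v v_bound \<tau>(1), of k N \<gamma>] unfolding \<tau>(2) by (simp only: power_mult_distrib)
  also have "\<dots> \<le> ((\<epsilon> / \<delta>) ^ k * fact k) * exp (\<delta> * ell \<gamma>)"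
  proof (intro mult_right_mono mult_left_mono)
    have "exp (real k) = exp 1 ^ k" by (metis exp_of_nat_mult mult.right_neutral)
    then show "(real k / exp 1) ^ k \<le> fact k"
      using power_self_le_exp_fact[of k] by (simp add: power_divide divide_le_eq mult.commute)
  qed (use \<epsilon> \<delta> in auto)
  finally show ?thesis by (simp add: divide_le_eq mult_ac)
qed

text \<open>A geometric series of ratio \<epsilon>/\<delta> \<le> 1/2, whence the factor 2. It is
  used with m = 1 for the distance to the identity and with m = 2 for the remainder after the linear
  term.\<close>

lemma trunc_norm_op_exp_tail:
  assumes v: "supp_in pos v" and v_bound: "vfield_bounded v s \<epsilon>" and \<delta>: "0 < \<delta>" "2 * \<epsilon> \<le> \<delta>"
    and A: "\<And>\<mu>. A \<gamma> (\<gamma> + \<mu>) = op_exp (derivation v) \<gamma> (\<gamma> + \<mu>) - (\<Sum>k<m. derivation_pow v k \<gamma> (\<gamma> + \<mu>) / fact k)"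
  shows "trunc_norm A (s - \<delta>) N \<gamma> \<le> 2 * (\<epsilon> / \<delta>) ^ m * exp (\<delta> * ell \<gamma>)"
proof -
  obtain K where K: "N < real K" using reals_Archimedean2 by blast
  \<comment> \<open>Powers from \<open>M\<close> on have no entries of degree up to
    \<open>N\<close>, so the tail is a finite sum.\<close>
  define M where "M = m + K"
  have M: "N < real M" "m \<le> M" using K by (auto simp: M_def)
  have \<epsilon>: "0 \<le> \<epsilon>" using v_bound by (rule vfield_bounded_nonneg)
  define q where "q = \<epsilon> / \<delta>"
  have q: "0 \<le> q" "q \<le> 1/2" using \<epsilon> \<delta> by (auto simp: q_def field_simps)
  have "trunc_norm A (s - \<delta>) N \<gamma> \<le> (\<Sum>\<mu>\<in>trunc N. (\<Sum>k=m..<M. cmod (derivation_pow v k \<gamma> (\<gamma> + \<mu>)) / fact k) * exp ((s - \<delta>) * deg \<mu>))"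
    unfolding trunc_norm_def
  proof (intro sum_mono mult_right_mono)
    fix \<mu> assume "\<mu> \<in> trunc N"
    then have "deg \<mu> < real M" using M truncD(2) by fastforce
    then have "A \<gamma> (\<gamma> + \<mu>) = (\<Sum>k<M. derivation_pow v k \<gamma> (\<gamma> + \<mu>) / fact k) - (\<Sum>k<m. derivation_pow v k \<gamma> (\<gamma> + \<mu>) / fact k)"
      unfolding A by (simp add: op_exp_eq[OF v])
    also have "\<dots> = (\<Sum>k=m..<M. derivation_pow v k \<gamma> (\<gamma> + \<mu>) / fact k)"
      using sum_diff_nat_ivl[of 0 m M "\<lambda>k. derivation_pow v k \<gamma> (\<gamma> + \<mu>) / fact k"] M(2)
      by (simp add: atLeast0LessThan)
    finally have eqA: "A \<gamma> (\<gamma> + \<mu>) = (\<Sum>k=m..<M. derivation_pow v k \<gamma> (\<gamma> + \<mu>) / fact k)" .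
    have "cmod (A \<gamma> (\<gamma> + \<mu>)) \<le> (\<Sum>k=m..<M. cmod (derivation_pow v k \<gamma> (\<gamma> + \<mu>) / fact k))"
      unfolding eqA by (rule norm_sum)
    then show "cmod (A \<gamma> (\<gamma> + \<mu>)) \<le> (\<Sum>k=m..<M. cmod (derivation_pow v k \<gamma> (\<gamma> + \<mu>)) / fact k)"
      by (simp add: norm_divide)
  qed simp
  also have "\<dots> = (\<Sum>k=m..<M. trunc_norm (derivation_pow v k) (s - \<delta>) N \<gamma> / fact k)"
    unfolding trunc_norm_def sum_distrib_right sum_divide_distrib by (subst sum.swap) simp
  also have "\<dots> \<le> (\<Sum>k=m..<M. q ^ k * exp (\<delta> * ell \<gamma>))"
    unfolding q_def by (intro sum_mono trunc_norm_derivation_pow_fact[OF v v_bound \<delta>(1)])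
  also have "\<dots> = (\<Sum>k=m..<M. q ^ k) * exp (\<delta> * ell \<gamma>)"
    by (simp add: sum_distrib_right)
  also have "\<dots> \<le> 2 * q ^ m * exp (\<delta> * ell \<gamma>)"
  proof (rule mult_right_mono)
    have "(\<Sum>k=m..<M. q ^ k) = q ^ m * (\<Sum>k<K. q ^ k)"
      unfolding M_def sum_distrib_left
      by (rule sum.reindex_bij_witness[where i = "\<lambda>k. k + m" and j = "\<lambda>k. k - m"])
        (auto simp: power_add[symmetric])
    also have "(\<Sum>k<K. q ^ k) \<le> 2"
    proof -
      have "(\<Sum>k<K. q ^ k) \<le> (\<Sum>k. q ^ k)"
        using q by (intro sum_le_suminf summable_geometric) auto
      also have "\<dots> = 1 / (1 - q)" using q by (intro suminf_geometric) auto
      also have "\<dots> \<le> 2" using q by (simp add: divide_le_eq)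
      finally show ?thesis .
    qed
    then have "q ^ m * (\<Sum>k<K. q ^ k) \<le> q ^ m * 2"
      using q by (intro mult_left_mono) auto
    finally show "(\<Sum>k=m..<M. q ^ k) \<le> 2 * q ^ m" by simp
  qed simp
  finally show ?thesis by (simp add: q_def)
qed

section \<open>Newton iteration\<close>

lemma trunc_norm_triangle:
  assumes "\<And>\<mu>. C \<gamma> (\<gamma> + \<mu>) = A \<gamma> (\<gamma> + \<mu>) + B \<gamma> (\<gamma> + \<mu>)"
  shows "trunc_norm C s N \<gamma> \<le> trunc_norm A s N \<gamma> + trunc_norm B s N \<gamma>"
  unfolding trunc_norm_def assms sum.distrib[symmetric] distrib_right[symmetric]
  by (intro sum_mono mult_right_mono norm_triangle_ineq) simp

lemma trunc_norm_exp_minus_one: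
  assumes v: "supp_in pos v" and v_bound: "vfield_bounded v s \<epsilon>" and \<delta>: "0 < \<delta>" "\<delta> \<le> 1" "2 * \<epsilon> \<le> \<delta>"
  shows "trunc_norm (op_exp (derivation v) - op_one) (s - \<delta>) N \<gamma> \<le> 2 * (\<epsilon> / \<delta>) * exp (\<delta> * ell \<gamma>)"
  using trunc_norm_op_exp_tail[OF v v_bound \<delta>(1,3), of "op_exp (derivation v) - op_one" \<gamma> 1 N] by simp

text \<open>On vectors with \<open>ell\<close> equal to 1 the bound 2 (\<epsilon>/\<delta>) exp
  \<delta> is at most 6 \<epsilon>/\<delta>, since exp \<delta> \<le> 3; the axes then determine the
  growth rate.\<close>

lemma exp_bounded_exp:
  assumes v: "supp_in pos v" and v_bound: "vfield_bounded v s \<epsilon>" and \<delta>: "0 < \<delta>" "\<delta> \<le> 1" "2 * \<epsilon> \<le> \<delta>"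
  shows "exp_bounded (op_exp (derivation v)) (s - \<delta>) (6 * \<epsilon> / \<delta>)"
proof -
  note e = is_aut_exp[OF submonoid_pos v]
  have \<epsilon>: "0 \<le> \<epsilon>" using v_bound by (rule vfield_bounded_nonneg)
  have "trunc_norm (op_exp (derivation v)) (s - \<delta>) N \<gamma> \<le> exp (6 * \<epsilon> / \<delta>)" if "ell \<gamma> = 1" for N \<gamma>
  proof -
    have "trunc_norm (op_exp (derivation v)) (s - \<delta>) N \<gamma> \<le> 1 + 2 * (\<epsilon> / \<delta>) * exp \<delta>"
      using trunc_norm_le_minus_one[of "op_exp (derivation v)" \<gamma> "s - \<delta>" N, OF is_autD(2)[OF e]]
        trunc_norm_exp_minus_one[OF v v_bound \<delta>, of N \<gamma>] that by simp
    also have "2 * (\<epsilon> / \<delta>) * exp \<delta> \<le> 2 * (\<epsilon> / \<delta>) * 3"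
      using \<epsilon> \<delta> by (intro mult_left_mono exp_le_3) auto
    finally have "trunc_norm (op_exp (derivation v)) (s - \<delta>) N \<gamma> \<le> 1 + 6 * \<epsilon> / \<delta>" by simp
    then show ?thesis using exp_ge_add_one_self[of "6 * \<epsilon> / \<delta>"] by linarith
  qed
  then show ?thesis
    using \<epsilon> \<delta> by (intro exp_bounded_from_axes[OF e]) (auto simp: ell_axis)
qed

text \<open>
  The sign makes \<open>newton_factor T g\<close> a first-order approximation of the inverse of the
  \<open>T\<close>-component of \<open>g\<close>.
\<close>

definition neg_part :: "'n lattice set \<Rightarrow> 'n operator \<Rightarrow> 'n vfield" where
  "neg_part T g \<delta> = (if \<delta> \<in> T \<and> \<delta> \<noteq> 0 then (\<chi> i. - g (axis i 1) (axis i 1 + \<delta>)) else 0)"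

definition newton_factor :: "'n lattice set \<Rightarrow> 'n operator \<Rightarrow> 'n operator" where
  "newton_factor T g = op_exp (derivation (neg_part T g))"

lemma supp_in_neg_part: "T \<subseteq> S \<Longrightarrow> supp_in S (neg_part T g)"
  by (auto simp: supp_in_def neg_part_def)

text \<open>Passing to a component discards coefficients and divides by nothing, so neither the
  radius nor the constant deteriorates. This is the precise form of the absence of small
  divisors.\<close>

lemma vfield_bounded_neg_part:
  assumes "close_to_one g s \<epsilon>"
  shows "vfield_bounded (neg_part T g) s \<epsilon>"
  unfolding vfield_bounded_def
proof
  fix N
  have "(\<Sum>\<delta>\<in>trunc N. (\<Sum>i\<in>UNIV. cmod (neg_part T g \<delta> $ i)) * exp (s * deg \<delta>)) \<le>
      (\<Sum>\<delta>\<in>trunc N. (\<Sum>i\<in>UNIV. cmod ((g - op_one) (axis i 1) (axis i 1 + \<delta>))) * exp (s * deg \<delta>))"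
    by (intro sum_mono mult_right_mono) (auto simp: neg_part_def op_one_def)
  also have "\<dots> = (\<Sum>i\<in>UNIV. trunc_norm (g - op_one) s N (axis i 1))"
    unfolding trunc_norm_def sum_distrib_right by (rule sum.swap)
  also have "\<dots> \<le> \<epsilon>" using assms unfolding close_to_one_def by blast
  finally show "(\<Sum>\<delta>\<in>trunc N. (\<Sum>i\<in>UNIV. cmod (neg_part T g \<delta> $ i)) * exp (s * deg \<delta>)) \<le> \<epsilon>" .
qed

lemma is_aut_newton_factor: "submonoid S \<Longrightarrow> T \<subseteq> S \<Longrightarrow> is_aut S (newton_factor T g)"
  unfolding newton_factor_def by (intro is_aut_exp supp_in_neg_part)

lemma derivation_axis: "derivation v (axis i 1) (axis i 1 + \<mu>) = v \<mu> $ i"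
proof -
  have "derivation v (axis i 1) (axis i 1 + \<mu>) = (\<Sum>j\<in>UNIV. if j = i then v \<mu> $ j else 0)"
    unfolding derivation_def by (intro sum.cong) (auto simp: axis_def)
  then show ?thesis by simp
qed

text \<open>
  With \<open>X = g b\<close> one has
  \<open>a g b - 1 = (a - 1) (X - 1) + (g - 1) (b - 1) + (a - 1) + (g - 1) + (b - 1)\<close>,
  and the linear parts of the last three terms cancel on the coordinates \<open>x\<^sub>i\<close>.
\<close>

lemma newton_step:
  assumes S: "submonoid S" "S1 \<subseteq> S" "S2 \<subseteq> S" "S \<subseteq> S1 \<union> S2"
    and g: "is_aut S g" and close: "close_to_one g s \<epsilon>" and \<delta>: "0 < \<delta>" "\<delta> \<le> 1" "8 * \<epsilon> \<le> \<delta>\<^sup>2"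
  defines "a \<equiv> newton_factor S1 g" and "b \<equiv> newton_factor (S2 - S1) g"
  shows "close_to_one (op_comp a (op_comp g b)) (s - 3 * \<delta>) (336 * real CARD('n) * \<epsilon>\<^sup>2 / \<delta> ^ 3)"
proof -
  define X where "X = op_comp g b"
  define v1 where "v1 = neg_part S1 g"
  define v2 where "v2 = neg_part (S2 - S1) g"
  have \<epsilon>: "0 \<le> \<epsilon>" using close by (rule close_to_one_nonneg)
  have "\<delta>\<^sup>2 \<le> \<delta>" using \<delta> by (simp add: power2_eq_square mult_left_le)
  then have small: "8 * \<epsilon> \<le> \<delta>" "2 * \<epsilon> \<le> \<delta>" "\<epsilon> \<le> 1/2" using \<delta> \<epsilon> by auto
  have Sp: "S \<subseteq> pos" by (rule submonoidD(2)[OF S(1)])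
  have v: "supp_in pos v1" "supp_in pos v2"
    unfolding v1_def v2_def using S Sp by (auto intro!: supp_in_neg_part)
  have v_bound: "vfield_bounded v1 s \<epsilon>" "vfield_bounded v2 s \<epsilon>"
    unfolding v1_def v2_def by (rule vfield_bounded_neg_part[OF close])+
  have a: "is_aut S a" and b: "is_aut S b"
    unfolding a_def b_def using S by (auto intro!: is_aut_newton_factor)
  have X: "is_aut S X" unfolding X_def by (rule is_aut_comp[OF S(1) g b])
  note gr = graded_pos[OF S(1) is_autD(1)]
  have ga: "graded pos a" and gb: "graded pos b" and gg: "graded pos g" and gX: "graded pos X"
    using gr a b g X by auto
  have g1: "graded pos op_one" by (simp add: graded_one)
  have bda: "exp_bounded a (s - \<delta>) (6 * \<epsilon> / \<delta>)" and bdb: "exp_bounded b (s - \<delta>) (6 * \<epsilon> / \<delta>)"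
    using exp_bounded_exp[OF v(1) v_bound(1) \<delta>(1,2) small(2)] exp_bounded_exp[OF v(2) v_bound(2) \<delta>(1,2) small(2)]
    by (auto simp: a_def b_def newton_factor_def v1_def v2_def)
  have bdg: "exp_bounded g s (2 * \<epsilon>)" by (rule exp_bounded_of_close_to_one[OF S(1) g close small(3)])
  \<comment> \<open>One \<delta> was spent on exponentiating, a second pays for composing with
    \<open>g\<close>, whose rate is 2 \<epsilon> \<le> \<delta>.\<close>
  have bdX: "exp_bounded X (s - 2 * \<delta>) (8 * \<epsilon> / \<delta>)"
  proof (rule exp_bounded_mono[where s' = "s - 2 * \<delta>"])
    show "exp_bounded X (s - 2 * \<delta>) (2 * \<epsilon> + 6 * \<epsilon> / \<delta>)"
      unfolding X_def using small \<epsilon> \<delta>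
      by (intro exp_bounded_comp gg gb exp_bounded_mono[OF bdg] exp_bounded_mono[OF bdb]) auto
    have "2 * \<epsilon> \<le> 2 * \<epsilon> / \<delta>" using \<delta> \<epsilon> by (simp add: le_divide_eq mult_left_le)
    then have "2 * \<epsilon> + 6 * \<epsilon> / \<delta> \<le> 2 * \<epsilon> / \<delta> + 6 * \<epsilon> / \<delta>" by simp
    also have "\<dots> = 8 * \<epsilon> / \<delta>" by (simp flip: add_divide_distrib)
    finally show "2 * \<epsilon> + 6 * \<epsilon> / \<delta> \<le> 8 * \<epsilon> / \<delta>" .
  qed simp
  define q where "q = \<epsilon> / \<delta>"
  have q: "0 \<le> q" using \<epsilon> \<delta> by (simp add: q_def)
  \<comment> \<open>The remainder of an exponential after its linear term, already quadratic in
    \<epsilon>/\<delta>.\<close>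
  define ra where "ra = (\<lambda>(v :: 'n vfield) \<gamma> \<nu>. op_exp (derivation v) \<gamma> \<nu> - op_one \<gamma> \<nu> - derivation v \<gamma> \<nu>)"
  have dp1: "derivation_pow v (Suc 0) = derivation v" if "supp_in pos v" for v
    unfolding derivation_pow_Suc using op_comp_one_right[OF graded_derivation[OF that]] by simp
  have pra: "trunc_norm (ra v) (s - 3 * \<delta>) N (axis i 1) \<le> 6 * q\<^sup>2" if "supp_in pos v" "vfield_bounded v s \<epsilon>" for v N i
  proof -
    have "trunc_norm (ra v) (s - 3 * \<delta>) N (axis i 1) \<le> trunc_norm (ra v) (s - \<delta>) N (axis i 1)"
      using \<delta> by (intro trunc_norm_mono) simp
    also have "\<dots> \<le> 2 * q ^ 2 * exp (\<delta> * ell (axis i 1))"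
      unfolding q_def
      by (rule trunc_norm_op_exp_tail[OF that \<delta>(1) small(2)])
        (simp add: ra_def numeral_2_eq_2 dp1[OF that(1)])
    also have "\<dots> \<le> 2 * q\<^sup>2 * 3"
      using \<delta> by (intro mult_left_mono) (auto simp: ell_axis exp_le_3)
    finally show ?thesis by simp
  qed
  have pb: "trunc_norm (b - op_one) (s - \<delta>) N (axis i 1) \<le> 6 * q" for N i
  proof -
    have "trunc_norm (b - op_one) (s - \<delta>) N (axis i 1) \<le> 2 * q * exp (\<delta> * ell (axis i 1))"
      unfolding q_def b_def newton_factor_def v2_def[symmetric]
      by (rule trunc_norm_exp_minus_one[OF v(2) v_bound(2) \<delta>(1,2) small(2)])
    also have "\<dots> \<le> 2 * q * 3"
      using \<delta> q by (intro mult_left_mono) (auto simp: ell_axis exp_le_3)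
    finally show ?thesis by simp
  qed
  have pgb: "trunc_norm (op_comp (g - op_one) (b - op_one)) (s - 3 * \<delta>) N (axis i 1) \<le> 36 * q\<^sup>2" for N i
  proof -
    have "trunc_norm (op_comp (g - op_one) (b - op_one)) (s - 3 * \<delta>) N (axis i 1) \<le>
        trunc_norm (op_comp (g - op_one) (b - op_one)) (s - 2 * \<delta>) N (axis i 1)"
      using \<delta> by (intro trunc_norm_mono) simp
    also have "\<dots> \<le> 2 * \<epsilon> / \<delta> * exp (\<delta> * ell (axis i 1)) * trunc_norm (b - op_one) (s - 2 * \<delta> + \<delta>) N (axis i 1)"
      using \<delta> \<epsilon> small
      by (intro trunc_norm_comp_minus_one gg is_autD(2)[OF g] graded_diff gb g1 exp_bounded_mono[OF bdg]) auto
    also have "\<dots> \<le> 2 * \<epsilon> / \<delta> * 3 * (6 * q)"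
      using \<delta> \<epsilon> pb[of N i] by (intro mult_mono) (auto simp: ell_axis exp_le_3 simp del: fun_diff_def)
    finally show ?thesis by (simp add: q_def power2_eq_square)
  qed
  have paX: "trunc_norm (op_comp (a - op_one) (X - op_one)) (s - 3 * \<delta>) N (axis i 1) \<le> 288 * (\<epsilon>\<^sup>2 / \<delta> ^ 3)" for N i
  proof -
    have "trunc_norm (X - op_one) (s - 2 * \<delta>) N (axis i 1) \<le> exp (8 * \<epsilon> / \<delta> * ell (axis i 1)) - 1"
      using \<epsilon> \<delta> by (intro trunc_norm_minus_one_le is_autD(2)[OF X] bdX) auto
    also have "\<dots> \<le> 2 * (8 * \<epsilon> / \<delta>)"
      using exp_minus_one_le[of "8 * \<epsilon> / \<delta>"] \<epsilon> \<delta> small by (simp add: ell_axis divide_le_eq)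
    finally have pX: "trunc_norm (X - op_one) (s - 2 * \<delta>) N (axis i 1) \<le> 16 * \<epsilon> / \<delta>" by simp
    \<comment> \<open>The rate of \<open>a\<close> must not exceed the radius \<delta> still
      available; this calls for \<epsilon> small relative to the square of \<delta>. The bound
      obtained below, 18 \<epsilon>/\<delta>^2 times 16 \<epsilon>/\<delta>, is the source of the
      cube in the denominator.\<close>
    have "6 * \<epsilon> / \<delta> \<le> \<delta>" using \<delta> \<epsilon> by (simp add: divide_le_eq power2_eq_square)
    then have "trunc_norm (op_comp (a - op_one) (X - op_one)) (s - 3 * \<delta>) N (axis i 1) \<le>
        (6 * \<epsilon> / \<delta>) / \<delta> * exp (\<delta> * ell (axis i 1)) * trunc_norm (X - op_one) (s - 3 * \<delta> + \<delta>) N (axis i 1)"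
      using \<delta> \<epsilon> small
      by (intro trunc_norm_comp_minus_one ga is_autD(2)[OF a] graded_diff gX g1 exp_bounded_mono[OF bda]) auto
    also have "\<dots> \<le> (6 * \<epsilon> / \<delta>) / \<delta> * 3 * (16 * \<epsilon> / \<delta>)"
      using \<delta> \<epsilon> pX by (intro mult_mono) (auto simp: ell_axis exp_le_3 simp del: fun_diff_def)
    also have "\<dots> = 288 * (\<epsilon>\<^sup>2 / \<delta> ^ 3)"
      by (simp add: power2_eq_square power3_eq_cube)
    finally show ?thesis .
  qed
  \<comment> \<open>\<open>S1\<close> and \<open>S2 - S1\<close> are disjoint and cover
    \<open>S\<close>, so each nonzero exponent of \<open>S\<close> is corrected by exactly one of
    the two fields, including those in the overlap.\<close>
  have cancel: "v1 \<mu> $ i + v2 \<mu> $ i + (g - op_one) (axis i 1) (axis i 1 + \<mu>) = 0" for i \<mu>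
  proof (cases "\<mu> = 0")
    case True
    then show ?thesis using is_autD(2)[OF g] by (simp add: v1_def v2_def neg_part_def op_one_def)
  next
    case False
    then show ?thesis
      using S graded_zero'[OF is_autD(1)[OF g], of \<mu> "axis i 1"]
      by (auto simp: v1_def v2_def neg_part_def op_one_def)
  qed
  have ra_a: "ra v1 \<gamma> \<nu> = a \<gamma> \<nu> - op_one \<gamma> \<nu> - derivation v1 \<gamma> \<nu>"
    and ra_b: "ra v2 \<gamma> \<nu> = b \<gamma> \<nu> - op_one \<gamma> \<nu> - derivation v2 \<gamma> \<nu>" for \<gamma> \<nu>
    by (simp_all add: ra_def a_def b_def newton_factor_def v1_def v2_def)
  have 1: "op_comp (a - op_one) (X - op_one) = op_comp a X - X - (a - op_one)"
    using op_comp_diff_right[OF graded_diff[OF ga g1] gX g1] op_comp_diff_left[OF ga g1 gX]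
      op_comp_one_left[OF gX] op_comp_one_right[OF graded_diff[OF ga g1]] by simp
  have 2: "op_comp (g - op_one) (b - op_one) = X - b - (g - op_one)"
    using op_comp_diff_right[OF graded_diff[OF gg g1] gb g1] op_comp_diff_left[OF gg g1 gb]
      op_comp_one_left[OF gb] op_comp_one_right[OF graded_diff[OF gg g1]] by (simp add: X_def)
  \<comment> \<open>336 = 288 + 36 + 6 + 6: the two products and the two exponential
    remainders.\<close>
  have "trunc_norm (op_comp a X - op_one) (s - 3 * \<delta>) N (axis i 1) \<le> 336 * (\<epsilon>\<^sup>2 / \<delta> ^ 3)" for N i
  proof -
    let ?e = "axis i 1 :: 'n lattice"
    let ?P = "op_comp (a - op_one) (X - op_one)" and ?Q = "op_comp (g - op_one) (b - op_one)"
    define R where "R = (\<lambda>\<gamma> \<nu>. ra v1 \<gamma> \<nu> + ra v2 \<gamma> \<nu>)"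
    define R' where "R' = (\<lambda>\<gamma> \<nu>. ?Q \<gamma> \<nu> + R \<gamma> \<nu>)"
    have "(op_comp a X - op_one) ?e (?e + \<mu>) = ?P ?e (?e + \<mu>) + R' ?e (?e + \<mu>)" for \<mu>
      using cancel[of \<mu> i]
      unfolding R'_def R_def 1 2 ra_a ra_b derivation_axis
      by (simp add: algebra_simps)
    then have "trunc_norm (op_comp a X - op_one) (s - 3 * \<delta>) N ?e \<le> trunc_norm ?P (s - 3 * \<delta>) N ?e + trunc_norm R' (s - 3 * \<delta>) N ?e"
      by (rule trunc_norm_triangle)
    also have "trunc_norm R' (s - 3 * \<delta>) N ?e \<le> trunc_norm ?Q (s - 3 * \<delta>) N ?e + trunc_norm R (s - 3 * \<delta>) N ?e"
      by (rule trunc_norm_triangle) (simp add: R'_def)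
    also have "trunc_norm R (s - 3 * \<delta>) N ?e \<le> trunc_norm (ra v1) (s - 3 * \<delta>) N ?e + trunc_norm (ra v2) (s - 3 * \<delta>) N ?e"
      by (rule trunc_norm_triangle) (simp add: R_def)
    finally have "trunc_norm (op_comp a X - op_one) (s - 3 * \<delta>) N ?e \<le> 288 * (\<epsilon>\<^sup>2 / \<delta> ^ 3) + 48 * q\<^sup>2"
      using paX[of N i] pgb[of N i] pra[OF v(1) v_bound(1), of N i] pra[OF v(2) v_bound(2), of N i] by linarith
    moreover have "q\<^sup>2 \<le> \<epsilon>\<^sup>2 / \<delta> ^ 3"
      unfolding q_def power_divide using \<delta> by (intro divide_left_mono power_decreasing) auto
    ultimately show ?thesis by linarith
  qed
  then have "(\<Sum>i\<in>UNIV. trunc_norm (op_comp a X - op_one) (s - 3 * \<delta>) N (axis i 1)) \<le>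
      real CARD('n) * (336 * (\<epsilon>\<^sup>2 / \<delta> ^ 3))" for N
    by (intro sum_bounded_above) auto
  then show ?thesis unfolding close_to_one_def X_def by (simp add: mult_ac)
qed

text \<open>A bound on the truncated norm bounds each entry up to a factor independent of k.
  Entrywise convergence is enough for what follows: multiplicativity, composition and the bounds for
  each \<open>N\<close> all involve finitely many entries at a time.\<close>

lemma entrywise_limit:
  assumes gr: "\<And>k. graded pos (X k)"
    and le: "\<And>k N \<gamma>. trunc_norm (X (Suc k) - X k) s N \<gamma> \<le> c \<gamma> * q ^ k" and q: "0 \<le> q" "q < 1"
  shows "\<exists>Y. \<forall>\<gamma> \<nu>. (\<lambda>k. X k \<gamma> \<nu>) \<longlonglongrightarrow> Y \<gamma> \<nu>"
proof -
  have "convergent (\<lambda>k. X k \<gamma> \<nu>)" for \<gamma> \<nu>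
  proof (cases "\<nu> - \<gamma> \<in> pos")
    case False
    then have "X k \<gamma> \<nu> = 0" for k using graded_zero[OF gr] by blast
    then show ?thesis by (simp add: convergent_const)
  next
    case True
    define \<mu> where "\<mu> = \<nu> - \<gamma>"
    have \<mu>: "\<mu> \<in> trunc (deg \<mu>)" using True by (simp add: trunc_def \<mu>_def)
    have h: "norm (X (Suc k) \<gamma> \<nu> - X k \<gamma> \<nu>) \<le> c \<gamma> / exp (s * deg \<mu>) * q ^ k" for k
    proof -
      have "cmod ((X (Suc k) - X k) \<gamma> (\<gamma> + \<mu>)) * exp (s * deg \<mu>) \<le> c \<gamma> * q ^ k"
        using entry_le_trunc_norm[OF \<mu>] le order_trans by blast
      then show ?thesis by (simp add: \<mu>_def field_simps)
    qed
    have "summable (\<lambda>k. c \<gamma> / exp (s * deg \<mu>) * q ^ k)"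
      using q by (intro summable_mult summable_geometric) simp
    from summable_comparison_test'[OF this h] have "summable (\<lambda>k. X (Suc k) \<gamma> \<nu> - X k \<gamma> \<nu>)" .
    then have "convergent (\<lambda>n. \<Sum>k<n. X (Suc k) \<gamma> \<nu> - X k \<gamma> \<nu>)"
      by (simp add: summable_iff_convergent)
    then have "convergent (\<lambda>n. X n \<gamma> \<nu> - X 0 \<gamma> \<nu>)"
      unfolding sum_lessThan_telescope[of "\<lambda>k. X k \<gamma> \<nu>"] .
    from convergent_add[OF this convergent_const[of "X 0 \<gamma> \<nu>"]] show ?thesis by simp
  qed
  then have "\<forall>\<gamma> \<nu>. (\<lambda>k. X k \<gamma> \<nu>) \<longlonglongrightarrow> lim (\<lambda>k. X k \<gamma> \<nu>)"
    by (simp add: convergent_LIMSEQ_iff)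
  then show ?thesis by (rule exI[of _ "\<lambda>\<gamma> \<nu>. lim (\<lambda>k. X k \<gamma> \<nu>)"])
qed

lemma graded_lim:
  assumes X: "\<And>k. graded S (X k)" and lim: "\<And>\<gamma> \<nu>. (\<lambda>k. X k \<gamma> \<nu>) \<longlonglongrightarrow> Y \<gamma> \<nu>"
  shows "graded S Y"
  unfolding graded_def
proof (intro allI impI)
  fix \<gamma> \<nu> assume nz: "Y \<gamma> \<nu> \<noteq> 0"
  show "\<nu> - \<gamma> \<in> S"
  proof (rule ccontr)
    assume "\<nu> - \<gamma> \<notin> S"
    then have "(\<lambda>k. X k \<gamma> \<nu>) = (\<lambda>_. 0)" using graded_zero[OF X] by blast
    then show False using lim[of \<gamma> \<nu>] nz by (simp add: LIMSEQ_const_iff)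
  qed
qed

lemma is_aut_lim:
  assumes X: "\<And>k. is_aut S (X k)" and lim: "\<And>\<gamma> \<nu>. (\<lambda>k. X k \<gamma> \<nu>) \<longlonglongrightarrow> Y \<gamma> \<nu>"
  shows "is_aut S Y"
  unfolding is_aut_def
proof (intro conjI allI)
  show "graded S Y" using is_autD(1)[OF X] lim by (rule graded_lim)
  show "Y \<gamma> \<gamma> = 1" for \<gamma>
    using lim[of \<gamma> \<gamma>] is_autD(2)[OF X] by (simp add: LIMSEQ_const_iff)
  show "Y 0 \<nu> = op_one 0 \<nu>" for \<nu>
    using lim[of 0 \<nu>] is_autD(3)[OF X] by (simp add: LIMSEQ_const_iff)
  fix \<gamma> \<gamma>' \<mu>
  have "(\<lambda>k. X k (\<gamma> + \<gamma>') (\<gamma> + \<gamma>' + \<mu>)) \<longlonglongrightarrow> (\<Sum>\<alpha>\<in>splits \<mu>. Y \<gamma> (\<gamma> + \<alpha>) * Y \<gamma>' (\<gamma>' + (\<mu> - \<alpha>)))"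
    unfolding is_autD(4)[OF X] by (intro tendsto_sum tendsto_mult lim)
  with lim show "Y (\<gamma> + \<gamma>') (\<gamma> + \<gamma>' + \<mu>) = (\<Sum>\<alpha>\<in>splits \<mu>. Y \<gamma> (\<gamma> + \<alpha>) * Y \<gamma>' (\<gamma>' + (\<mu> - \<alpha>)))"
    by (rule LIMSEQ_unique)
qed

lemma exp_bounded_lim:
  assumes X: "\<And>k. exp_bounded (X k) s \<eta>" and lim: "\<And>\<gamma> \<nu>. (\<lambda>k. X k \<gamma> \<nu>) \<longlonglongrightarrow> Y \<gamma> \<nu>"
  shows "exp_bounded Y s \<eta>"
  unfolding exp_bounded_def
proof (intro allI)
  fix N \<gamma>
  have "(\<lambda>k. trunc_norm (X k) s N \<gamma>) \<longlonglongrightarrow> trunc_norm Y s N \<gamma>"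
    unfolding trunc_norm_def by (intro tendsto_sum tendsto_mult tendsto_norm lim tendsto_const)
  then show "trunc_norm Y s N \<gamma> \<le> exp (\<eta> * ell \<gamma>)"
    by (rule LIMSEQ_le_const2) (use X in \<open>auto simp: exp_bounded_def\<close>)
qed

lemma op_comp_lim:
  assumes A: "\<And>k. graded pos (A k)" and B: "\<And>k. graded pos (B k)"
    and limA: "\<And>\<gamma> \<nu>. (\<lambda>k. A k \<gamma> \<nu>) \<longlonglongrightarrow> A' \<gamma> \<nu>" and limB: "\<And>\<gamma> \<nu>. (\<lambda>k. B k \<gamma> \<nu>) \<longlonglongrightarrow> B' \<gamma> \<nu>"
  shows "(\<lambda>k. op_comp (A k) (B k) \<gamma> \<nu>) \<longlonglongrightarrow> op_comp A' B' \<gamma> \<nu>"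
proof -
  have "(\<lambda>k. op_comp (A k) (B k) \<gamma> (\<gamma> + (\<nu> - \<gamma>))) \<longlonglongrightarrow> op_comp A' B' \<gamma> (\<gamma> + (\<nu> - \<gamma>))"
    unfolding op_comp_splits[OF A B]
      op_comp_splits[OF graded_lim[OF A limA] graded_lim[OF B limB]]
    by (intro tendsto_sum tendsto_mult limA limB)
  then show ?thesis by simp
qed

primrec newton :: "'n lattice set \<Rightarrow> 'n lattice set \<Rightarrow> 'n operator \<Rightarrow> nat \<Rightarrow> 'n operator" where
  "newton S1 S2 g 0 = g"
| "newton S1 S2 g (Suc k) =
     op_comp (newton_factor S1 (newton S1 S2 g k)) (op_comp (newton S1 S2 g k) (newton_factor (S2 - S1) (newton S1 S2 g k)))"

primrec newton_left :: "'n lattice set \<Rightarrow> 'n lattice set \<Rightarrow> 'n operator \<Rightarrow> nat \<Rightarrow> 'n operator" where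
  "newton_left S1 S2 g 0 = op_one"
| "newton_left S1 S2 g (Suc k) = op_comp (newton_factor S1 (newton S1 S2 g k)) (newton_left S1 S2 g k)"

primrec newton_right :: "'n lattice set \<Rightarrow> 'n lattice set \<Rightarrow> 'n operator \<Rightarrow> nat \<Rightarrow> 'n operator" where
  "newton_right S1 S2 g 0 = op_one"
| "newton_right S1 S2 g (Suc k) = op_comp (newton_right S1 S2 g k) (newton_factor (S2 - S1) (newton S1 S2 g k))"

text \<open>
  The \<open>k\<close>-th step costs \<open>3 / 2 ^ k\<close> of logarithmic radius, 6 in total; one further unit is spent on
  composing the right factors. The distance to 1 decays like \<open>1 / 16 ^ k\<close>, which beats the factor
  \<open>8 ^ k\<close> lost in \<open>newton_step\<close>.
\<close>

lemma small_factorization: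
  assumes S: "submonoid S" "submonoid S1" "submonoid S2" "S1 \<subseteq> S" "S2 \<subseteq> S" "S \<subseteq> S1 \<union> S2"
    and g: "is_aut S g" and close: "close_to_one g s \<epsilon>0" and \<epsilon>0: "5376 * real CARD('n) * \<epsilon>0 \<le> 1"
  shows "\<exists>A B. is_aut S1 A \<and> is_aut S2 B \<and> exp_bounded A (s - 7) 1 \<and> exp_bounded B (s - 7) 1 \<and>
    op_comp A (op_comp g B) = op_one"
proof -
  define G where "G = newton S1 S2 g"
  define L where "L = newton_left S1 S2 g"
  define R where "R = newton_right S1 S2 g"
  define a where "a k = newton_factor S1 (G k)" for k
  define b where "b k = newton_factor (S2 - S1) (G k)" for k
  define \<delta> where "\<delta> k = (1/2::real) ^ k" for k
  define \<epsilon> where "\<epsilon> k = \<epsilon>0 * (1/16::real) ^ k" for k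
  define t where "t k = s - 6 + 6 * \<delta> k" for k
  define \<eta> where "\<eta> k = 6 * \<epsilon>0 * (1/8::real) ^ k" for k
  \<comment> \<open>Dominates the sum of the rates of the first k factors: \<eta> j is at most 6
    \<epsilon>0/2^j, and these sum to 12 \<epsilon>0 (1 - 1/2^k).\<close>
  define \<rho> where "\<rho> k = 12 * \<epsilon>0 * (1 - \<delta> k)" for k
  have n: "real CARD('n) \<ge> 1" by (simp add: Suc_leI)
  have \<epsilon>0nn: "0 \<le> \<epsilon>0" using close by (rule close_to_one_nonneg)
  have \<epsilon>0s: "5376 * \<epsilon>0 \<le> 1"
    using \<epsilon>0 mult_right_mono[OF n, of "5376 * \<epsilon>0"] \<epsilon>0nn by (simp add: mult_ac)
  have \<delta>: "0 < \<delta> k" "\<delta> k \<le> 1" for k by (auto simp: \<delta>_def power_le_one)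
  have tS: "t (Suc k) = t k - 3 * \<delta> k" for k by (simp add: t_def \<delta>_def)
  have t_ge: "s - 6 \<le> t k" for k using \<delta>[of k] by (simp add: t_def)
  have t\<delta>: "s - 6 \<le> t k - \<delta> k" for k using \<delta>[of k] by (simp add: t_def)
  have pow: "(x ^ k) ^ m = (x ^ m) ^ k" for x :: real and k m
    unfolding power_mult[symmetric] by (simp only: mult.commute)
  have \<delta>2: "(\<delta> k)\<^sup>2 = (1/4) ^ k" and \<delta>3: "(\<delta> k) ^ 3 = (1/8) ^ k" for k
    unfolding \<delta>_def pow[of _ k] by (simp_all add: power_divide)
  have \<epsilon>_small: "8 * \<epsilon> k \<le> (\<delta> k)\<^sup>2" for k
  proof -
    have "8 * \<epsilon> k = (8 * \<epsilon>0) * (1/16) ^ k" by (simp add: \<epsilon>_def)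
    also have "\<dots> \<le> 1 * (1/4) ^ k"
      using \<epsilon>0s \<epsilon>0nn by (intro mult_mono power_mono) auto
    finally show ?thesis by (simp add: \<delta>2)
  qed
  \<comment> \<open>The quotient of \<epsilon>^2 by \<delta>^3 is \<epsilon>0^2/32^k. Comparing with
    \<epsilon>0/16^(k+1) requires 336 * 16 n \<epsilon>0 \<le> 1, which is where 5376 comes
    from.\<close>
  have \<epsilon>_step: "336 * real CARD('n) * (\<epsilon> k)\<^sup>2 / (\<delta> k) ^ 3 \<le> \<epsilon> (Suc k)" for k
  proof -
    have "336 * real CARD('n) * (\<epsilon> k)\<^sup>2 / (\<delta> k) ^ 3 = (336 * real CARD('n) * \<epsilon>0) * \<epsilon>0 * (1/32) ^ k"
    proof -
      have "(\<epsilon> k)\<^sup>2 / (\<delta> k) ^ 3 = \<epsilon>0\<^sup>2 * ((1/256) ^ k / (1/8) ^ k)"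
        unfolding \<delta>3 \<epsilon>_def power_mult_distrib pow[of _ k] by (simp add: power_divide)
      also have "(1/256) ^ k / (1/8) ^ k = (1/32 :: real) ^ k"
        by (simp flip: power_divide)
      finally have e: "(\<epsilon> k)\<^sup>2 / (\<delta> k) ^ 3 = \<epsilon>0\<^sup>2 * (1/32) ^ k" .
      have "336 * real CARD('n) * (\<epsilon> k)\<^sup>2 / (\<delta> k) ^ 3 = 336 * real CARD('n) * ((\<epsilon> k)\<^sup>2 / (\<delta> k) ^ 3)"
        by simp
      then show ?thesis unfolding e by (simp add: power2_eq_square)
    qed
    also have "\<dots> \<le> (1/16) * \<epsilon>0 * (1/16) ^ k"
      using \<epsilon>0 \<epsilon>0nn by (intro mult_mono power_mono) auto
    finally show ?thesis by (simp add: \<epsilon>_def)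
  qed
  have \<eta>_eq: "6 * \<epsilon> k / \<delta> k = \<eta> k" for k
  proof -
    have "6 * \<epsilon> k / \<delta> k = 6 * \<epsilon>0 * ((1/16) ^ k / (1/2) ^ k)" by (simp add: \<epsilon>_def \<delta>_def)
    also have "(1/16) ^ k / (1/2) ^ k = (1/8 :: real) ^ k"
      by (simp flip: power_divide)
    finally show ?thesis by (simp add: \<eta>_def)
  qed
  have \<eta>: "0 \<le> \<eta> k" "\<eta> k \<le> \<delta> k" "\<eta> k \<le> 1" for k
  proof -
    show "0 \<le> \<eta> k" using \<epsilon>0nn by (simp add: \<eta>_def)
    have "6 * \<epsilon>0 * (1/8) ^ k \<le> 1 * (1/2) ^ k"
      using \<epsilon>0s \<epsilon>0nn by (intro mult_mono power_mono) auto
    then show "\<eta> k \<le> \<delta> k" by (simp add: \<eta>_def \<delta>_def)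
    then show "\<eta> k \<le> 1" using \<delta>(2)[of k] by linarith
  qed
  have \<rho>S: "\<rho> k + \<eta> k \<le> \<rho> (Suc k)" for k
  proof -
    have "6 * \<epsilon>0 * (1/8) ^ k \<le> 6 * \<epsilon>0 * (1/2) ^ k"
      using \<epsilon>0nn by (intro mult_left_mono power_mono) auto
    then show ?thesis by (simp add: \<rho>_def \<eta>_def \<delta>_def algebra_simps)
  qed
  have \<rho>: "0 \<le> \<rho> k" "\<rho> k \<le> 1" for k
  proof -
    show "0 \<le> \<rho> k" using \<epsilon>0nn \<delta> by (simp add: \<rho>_def)
    have "12 * \<epsilon>0 * (1 - \<delta> k) \<le> 12 * \<epsilon>0 * 1"
      using \<epsilon>0nn \<delta>[of k] by (intro mult_left_mono) auto
    then show "\<rho> k \<le> 1" using \<epsilon>0s \<epsilon>0nn by (simp add: \<rho>_def)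
  qed
  have a: "is_aut S1 (a k)" and b: "is_aut S2 (b k)" for k
    unfolding a_def b_def using S by (auto intro!: is_aut_newton_factor)
  have aS: "is_aut S (a k)" and bS: "is_aut S (b k)" for k
    using is_aut_mono[OF a] is_aut_mono[OF b] S by auto
  have G0: "G 0 = g" and GS: "G (Suc k) = op_comp (a k) (op_comp (G k) (b k))" for k
    by (auto simp: G_def a_def b_def)
  have L0: "L 0 = op_one" and LS: "L (Suc k) = op_comp (a k) (L k)" for k
    by (auto simp: L_def a_def G_def)
  have R0: "R 0 = op_one" and RS: "R (Suc k) = op_comp (R k) (b k)" for k
    by (auto simp: R_def b_def G_def)
  have G: "is_aut S (G k) \<and> close_to_one (G k) (t k) (\<epsilon> k)" for k
  proof (induction k)
    case 0
    then show ?case using g close by (simp add: G0 t_def \<delta>_def \<epsilon>_def)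
  next
    case (Suc k)
    have "close_to_one (G (Suc k)) (t k - 3 * \<delta> k) (336 * real CARD('n) * (\<epsilon> k)\<^sup>2 / (\<delta> k) ^ 3)"
      unfolding GS a_def b_def using Suc \<delta> \<epsilon>_small
      by (intro newton_step[OF S(1,4,5,6)]) auto
    then have "close_to_one (G (Suc k)) (t (Suc k)) (\<epsilon> (Suc k))"
      unfolding close_to_one_def tS using \<epsilon>_step order_trans by blast
    moreover have "is_aut S (G (Suc k))"
      unfolding GS using Suc by (intro is_aut_comp S(1) aS bS) auto
    ultimately show ?case by blast
  qed
  have \<epsilon>\<delta>: "2 * \<epsilon> k \<le> \<delta> k" "\<epsilon> k \<le> 1/2" "0 \<le> \<epsilon> k" for k
  proof -
    show nn: "0 \<le> \<epsilon> k" using \<epsilon>0nn by (simp add: \<epsilon>_def)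
    have "(\<delta> k)\<^sup>2 \<le> \<delta> k" using \<delta>[of k] by (simp add: power2_eq_square mult_left_le)
    then show "2 * \<epsilon> k \<le> \<delta> k" "\<epsilon> k \<le> 1/2" using \<epsilon>_small[of k] \<delta>[of k] nn by linarith+
  qed
  have exp_bounded_newton_factor: "exp_bounded (newton_factor T (G k)) (t k - \<delta> k) (\<eta> k)" if "T \<subseteq> S" for T k
    unfolding newton_factor_def \<eta>_eq[symmetric]
    using G[of k] \<delta>[of k] \<epsilon>\<delta>[of k] that submonoidD(2)[OF S(1)]
    by (intro exp_bounded_exp vfield_bounded_neg_part supp_in_neg_part) auto
  have bda: "exp_bounded (a k) (t k - \<delta> k) (\<eta> k)" and bdb: "exp_bounded (b k) (t k - \<delta> k) (\<eta> k)" for k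
    unfolding a_def b_def using S by (auto intro!: exp_bounded_newton_factor)
  note gr = graded_pos[OF S(1) is_autD(1)]
  have ga: "graded pos (a k)" and gb: "graded pos (b k)" and gG: "graded pos (G k)" for k
    using gr[OF aS] gr[OF bS] gr G by auto
  have L: "is_aut S1 (L k)" for k
    by (induction k) (auto simp: L0 LS intro: is_aut_one submonoidD(1)[OF S(2)] is_aut_comp[OF S(2) a])
  have R: "is_aut S2 (R k)" for k
    by (induction k) (auto simp: R0 RS intro: is_aut_one submonoidD(1)[OF S(3)] is_aut_comp[OF S(3) _ b])
  have gL: "graded pos (L k)" and gR: "graded pos (R k)" for k
    using graded_pos[OF S(2) is_autD(1)[OF L]] graded_pos[OF S(3) is_autD(1)[OF R]] by auto
  have g1: "graded pos op_one" by (simp add: graded_one)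
  note gc = graded_comp[OF submonoid_pos]
  have gg: "graded pos g" using gG[of 0] by (simp add: G0)
  have LgR: "op_comp (L k) (op_comp g (R k)) = G k" for k
  proof (induction k)
    case 0
    then show ?case using gg g1 gc by (simp add: L0 R0 G0 op_comp_one_left op_comp_one_right)
  next
    case (Suc k)
    have "op_comp (L (Suc k)) (op_comp g (R (Suc k))) =
        op_comp (a k) (op_comp (op_comp (L k) (op_comp g (R k))) (b k))"
      unfolding LS RS
      by (simp add: op_comp_assoc ga gb gL gR gg gc)
    then show ?case by (simp add: Suc GS)
  qed
  \<comment> \<open>The new factor is applied last, so the accumulated product must be bounded at
    the next radius plus \<eta> k; a decrement of 3 \<delta> k leaves room for that.\<close>
  have bdL: "exp_bounded (L k) (t k) (\<rho> k)" for k
  proof (induction k)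
    case 0
    then show ?case using exp_bounded_one by (simp add: L0 \<rho>_def \<delta>_def)
  next
    case (Suc k)
    have "exp_bounded (L (Suc k)) (t (Suc k)) (\<eta> k + \<rho> k)"
      unfolding LS
    proof (rule exp_bounded_comp[OF ga gL])
      show "exp_bounded (a k) (t (Suc k)) (\<eta> k)"
        using \<delta>[of k] by (intro exp_bounded_mono[OF bda]) (auto simp: tS)
      show "exp_bounded (L k) (t (Suc k) + \<eta> k) (\<rho> k)"
        using \<delta>[of k] \<eta>[of k] by (intro exp_bounded_mono[OF Suc]) (auto simp: tS)
    qed (rule \<eta>)
    then show ?case by (rule exp_bounded_mono) (use \<rho>S[of k] in auto)
  qed
  \<comment> \<open>Here the accumulated product is applied last, so its radius stays fixed, and
    each new factor must be bounded at \<rho> k above it. As \<rho> k \<le> 1, the radius s - 6,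
    available for all factors, suffices.\<close>
  have bdR: "exp_bounded (R k) (s - 7) (\<rho> k)" for k
  proof (induction k)
    case 0
    then show ?case using exp_bounded_one by (simp add: R0 \<rho>_def \<delta>_def)
  next
    case (Suc k)
    have "exp_bounded (R (Suc k)) (s - 7) (\<rho> k + \<eta> k)"
      unfolding RS
    proof (rule exp_bounded_comp[OF gR gb Suc])
      show "exp_bounded (b k) (s - 7 + \<rho> k) (\<eta> k)"
        using \<rho>[of k] t\<delta>[of k] by (intro exp_bounded_mono[OF bdb]) auto
    qed (rule \<rho>)
    then show ?case by (rule exp_bounded_mono) (use \<rho>S[of k] in auto)
  qed
  have chord: "exp (\<eta> k * ell \<gamma>) - 1 \<le> \<eta> k * exp (ell \<gamma>)" for k \<gamma>
    using exp_chord[of "\<eta> k" 1 "ell \<gamma>"] \<eta>[of k] by simp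
  have "\<exists>A. \<forall>\<gamma> \<nu>. (\<lambda>k. L k \<gamma> \<nu>) \<longlonglongrightarrow> A \<gamma> \<nu>"
  proof (rule entrywise_limit[OF gL])
    fix k N \<gamma>
    \<comment> \<open>The increment contains the newest factor minus 1 and inherits the decay of
      \<eta> k. The estimate is applied with \<tau> = 1, the gap between s - 7 and s - 6.\<close>
    have eq: "L (Suc k) - L k = op_comp (a k - op_one) (L k)"
      unfolding LS op_comp_diff_left[OF ga g1 gL] op_comp_one_left[OF gL] ..
    have "trunc_norm (L (Suc k) - L k) (s - 7) N \<gamma> \<le> \<eta> k / 1 * exp (1 * ell \<gamma>) * trunc_norm (L k) (s - 7 + 1) N \<gamma>"
      unfolding eq using \<eta>[of k] t\<delta>[of k]
      by (intro trunc_norm_comp_minus_one ga gL is_autD(2)[OF a] exp_bounded_mono[OF bda]) auto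
    also have "\<dots> \<le> \<eta> k / 1 * exp (1 * ell \<gamma>) * exp (1 * ell \<gamma>)"
      using \<eta>[of k] exp_bounded_mono[OF bdL, of "s - 7 + 1" k 1] t_ge[of k] \<rho>[of k]
      by (intro mult_left_mono) (auto simp: exp_bounded_def)
    finally show "trunc_norm (L (Suc k) - L k) (s - 7) N \<gamma> \<le> (6 * \<epsilon>0 * exp (ell \<gamma>) * exp (ell \<gamma>)) * (1/8) ^ k"
      by (simp add: \<eta>_def mult_ac)
  qed auto
  then obtain A where A: "\<And>\<gamma> \<nu>. (\<lambda>k. L k \<gamma> \<nu>) \<longlonglongrightarrow> A \<gamma> \<nu>" by blast
  have "\<exists>B. \<forall>\<gamma> \<nu>. (\<lambda>k. R k \<gamma> \<nu>) \<longlonglongrightarrow> B \<gamma> \<nu>"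
  proof (rule entrywise_limit[OF gR])
    fix k N \<gamma>
    have eq: "R (Suc k) - R k = op_comp (R k) (b k - op_one)"
      unfolding RS op_comp_diff_right[OF gR gb g1] op_comp_one_right[OF gR] ..
    have "trunc_norm (R (Suc k) - R k) (s - 7) N \<gamma> \<le> exp (1 * ell \<gamma>) * trunc_norm (b k - op_one) (s - 7 + 1) N \<gamma>"
      unfolding eq using \<rho>[of k]
      by (intro trunc_norm_comp_exp_bounded gR graded_diff gb g1 exp_bounded_mono[OF bdR]) auto
    also have "trunc_norm (b k - op_one) (s - 7 + 1) N \<gamma> \<le> exp (\<eta> k * ell \<gamma>) - 1"
      using \<eta>[of k] t\<delta>[of k] by (intro trunc_norm_minus_one_le is_autD(2)[OF b] exp_bounded_mono[OF bdb]) auto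
    also have "\<dots> \<le> \<eta> k * exp (ell \<gamma>)" by (rule chord)
    finally show "trunc_norm (R (Suc k) - R k) (s - 7) N \<gamma> \<le> (6 * \<epsilon>0 * exp (ell \<gamma>) * exp (ell \<gamma>)) * (1/8) ^ k"
      by (simp add: \<eta>_def mult_ac)
  qed auto
  then obtain B where B: "\<And>\<gamma> \<nu>. (\<lambda>k. R k \<gamma> \<nu>) \<longlonglongrightarrow> B \<gamma> \<nu>" by blast
  have Glim: "(\<lambda>k. G k \<gamma> \<nu>) \<longlonglongrightarrow> op_one \<gamma> \<nu>" for \<gamma> \<nu>
  proof (cases "\<nu> - \<gamma> \<in> pos")
    case False
    then have "G k \<gamma> \<nu> = op_one \<gamma> \<nu>" for k
      using graded_zero[OF gG] graded_zero[OF g1] by simp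
    then show ?thesis by simp
  next
    case True
    define \<mu> where "\<mu> = \<nu> - \<gamma>"
    have \<mu>: "\<mu> \<in> trunc (deg \<mu>)" using True by (simp add: trunc_def \<mu>_def)
    have h1: "cmod (G k \<gamma> \<nu> - op_one \<gamma> \<nu>) \<le> (2 * \<epsilon>0 * exp (ell \<gamma>) / exp ((s - 6) * deg \<mu>)) * (1/16) ^ k" for k
    proof -
      have Gk: "is_aut S (G k)" "close_to_one (G k) (t k) (\<epsilon> k)" using G by auto
      have "cmod ((G k - op_one) \<gamma> (\<gamma> + \<mu>)) * exp ((s - 6) * deg \<mu>) \<le> trunc_norm (G k - op_one) (s - 6) (deg \<mu>) \<gamma>"
        by (rule entry_le_trunc_norm[OF \<mu>])
      also have "\<dots> \<le> exp (2 * \<epsilon> k * ell \<gamma>) - 1"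
        using \<epsilon>\<delta>[of k] t_ge[of k]
        by (intro trunc_norm_minus_one_le is_autD(2)[OF Gk(1)] exp_bounded_mono[OF exp_bounded_of_close_to_one[OF S(1) Gk]]) auto
      also have "\<dots> \<le> 2 * \<epsilon> k * exp (ell \<gamma>)"
        using exp_chord[of "2 * \<epsilon> k" 1 "ell \<gamma>"] \<epsilon>\<delta>[of k] by simp
      finally have "cmod ((G k - op_one) \<gamma> (\<gamma> + \<mu>)) \<le> 2 * \<epsilon> k * exp (ell \<gamma>) / exp ((s - 6) * deg \<mu>)"
        by (simp add: pos_le_divide_eq)
      then show ?thesis by (simp add: \<mu>_def \<epsilon>_def mult_ac)
    qed
    have h2: "(\<lambda>k. (2 * \<epsilon>0 * exp (ell \<gamma>) / exp ((s - 6) * deg \<mu>)) * (1/16) ^ k) \<longlonglongrightarrow> 0"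
      by (intro tendsto_mult_right_zero LIMSEQ_power_zero) simp
    have "(\<lambda>k. G k \<gamma> \<nu> - op_one \<gamma> \<nu>) \<longlonglongrightarrow> 0"
      by (rule Lim_null_comparison[OF always_eventually[OF allI[OF h1]] h2])
    then show ?thesis by (simp add: LIM_zero_iff)
  qed
  have "op_comp A (op_comp g B) \<gamma> \<nu> = op_one \<gamma> \<nu>" for \<gamma> \<nu>
  proof -
    have "(\<lambda>k. op_comp (L k) (op_comp g (R k)) \<gamma> \<nu>) \<longlonglongrightarrow> op_comp A (op_comp g B) \<gamma> \<nu>"
      by (intro op_comp_lim gL gc gg gR A B tendsto_const)
    with Glim show ?thesis unfolding LgR by (metis LIMSEQ_unique)
  qed
  then have "op_comp A (op_comp g B) = op_one" by (intro ext)
  moreover have "exp_bounded A (s - 7) 1"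
  proof (rule exp_bounded_lim[OF _ A])
    show "exp_bounded (L k) (s - 7) 1" for k
      by (rule exp_bounded_mono[OF bdL]) (use t_ge[of k] \<rho>(2)[of k] in auto)
  qed
  moreover have "exp_bounded B (s - 7) 1"
    using \<rho>(2) by (intro exp_bounded_lim[OF _ B] exp_bounded_mono[OF bdR]) auto
  moreover have "is_aut S1 A" "is_aut S2 B"
    using is_aut_lim[OF L A] is_aut_lim[OF R B] by auto
  ultimately show ?thesis by blast
qed

section \<open>Analytic automorphisms\<close>

definition analytic_aut :: "'n operator \<Rightarrow> bool" where
  "analytic_aut g \<longleftrightarrow> (\<exists>s \<epsilon>. close_to_one g s \<epsilon>)"

text \<open>The diagonal term cancels against the identity and every other exponent has degree at
  least 1, so the gain exp (-r) is uniform.\<close>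

lemma close_to_one_shift:
  assumes g: "is_aut S g" "S \<subseteq> pos" and close: "close_to_one g s \<epsilon>" and r: "0 \<le> r"
  shows "close_to_one g (s - r) (exp (- r) * \<epsilon>)"
  unfolding close_to_one_def
proof
  fix N
  have "trunc_norm (g - op_one) (s - r) N (axis i 1) \<le> exp (- r) * trunc_norm (g - op_one) s N (axis i 1)" for i
    unfolding trunc_norm_def sum_distrib_left
  proof (rule sum_mono)
    fix \<mu> assume \<mu>: "\<mu> \<in> trunc N"
    show "cmod ((g - op_one) (axis i 1) (axis i 1 + \<mu>)) * exp ((s - r) * deg \<mu>) \<le>
      exp (- r) * (cmod ((g - op_one) (axis i 1) (axis i 1 + \<mu>)) * exp (s * deg \<mu>))"
    proof (cases "\<mu> = 0")
      case True
      then show ?thesis using is_autD(2)[OF g(1)] by (simp add: op_one_def)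
    next
      case False
      then have "r * 1 \<le> r * deg \<mu>"
        using r \<mu> by (intro mult_left_mono deg_ge_1) (auto dest: truncD)
      then have "exp ((s - r) * deg \<mu>) \<le> exp (- r) * exp (s * deg \<mu>)"
        by (simp add: algebra_simps flip: exp_add)
      then have "cmod ((g - op_one) (axis i 1) (axis i 1 + \<mu>)) * exp ((s - r) * deg \<mu>) \<le>
          cmod ((g - op_one) (axis i 1) (axis i 1 + \<mu>)) * (exp (- r) * exp (s * deg \<mu>))"
        by (rule mult_left_mono) simp
      then show ?thesis by (simp only: mult.left_commute)
    qed
  qed
  then have "(\<Sum>i\<in>UNIV. trunc_norm (g - op_one) (s - r) N (axis i 1)) \<le>
      (\<Sum>i\<in>UNIV. exp (- r) * trunc_norm (g - op_one) s N (axis i 1))"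
    by (intro sum_mono)
  also have "\<dots> \<le> exp (- r) * \<epsilon>"
    using close unfolding close_to_one_def sum_distrib_left[symmetric] by (intro mult_left_mono) auto
  finally show "(\<Sum>i\<in>UNIV. trunc_norm (g - op_one) (s - r) N (axis i 1)) \<le> exp (- r) * \<epsilon>" .
qed

lemma analytic_aut_small:
  assumes g: "is_aut S g" "S \<subseteq> pos" and analytic: "analytic_aut g" and c: "0 < c"
  obtains s \<epsilon> where "close_to_one g s \<epsilon>" "\<epsilon> \<le> c"
proof -
  obtain s \<epsilon> where close: "close_to_one g s \<epsilon>" using analytic by (auto simp: analytic_aut_def)
  then have \<epsilon>: "0 \<le> \<epsilon>" by (rule close_to_one_nonneg)
  \<comment> \<open>The radius is lowered by \<epsilon>/c; the inequality x \<le> exp x shows that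
    this is enough.\<close>
  have "exp (- (\<epsilon> / c)) * \<epsilon> \<le> c"
  proof -
    have "\<epsilon> / c \<le> exp (\<epsilon> / c)" using exp_ge_add_one_self[of "\<epsilon> / c"] by linarith
    then show ?thesis using c by (simp add: exp_minus field_simps)
  qed
  moreover have "close_to_one g (s - \<epsilon> / c) (exp (- (\<epsilon> / c)) * \<epsilon>)"
    using \<epsilon> c by (intro close_to_one_shift[OF g close]) simp
  ultimately show thesis using that by blast
qed

lemma analytic_aut_of_exp_bounded:
  assumes g: "is_aut S g" and bound: "exp_bounded g s \<eta>" and \<eta>: "0 \<le> \<eta>"
  shows "analytic_aut g"
proof -
  have "(\<Sum>i\<in>UNIV. trunc_norm (g - op_one) s N (axis i 1)) \<le> real CARD('n) * (exp \<eta> - 1)" for N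
    using trunc_norm_minus_one_le[OF is_autD(2)[OF g] bound \<eta>, of N "axis _ 1"]
    by (intro sum_bounded_above) (simp add: ell_axis del: fun_diff_def)
  then show ?thesis unfolding analytic_aut_def close_to_one_def by blast
qed

lemma exp_bounded_of_analytic_aut:
  assumes S: "submonoid S" and g: "is_aut S g" and analytic: "analytic_aut g"
  obtains s where "exp_bounded g s 1"
proof -
  obtain s \<epsilon> where close: "close_to_one g s \<epsilon>" and \<epsilon>: "\<epsilon> \<le> 1/2"
    using analytic_aut_small[OF g submonoidD(2)[OF S] analytic, of "1/2"] by auto
  have "exp_bounded g s 1"
    by (rule exp_bounded_mono[OF exp_bounded_of_close_to_one[OF S g close \<epsilon>]]) (use \<epsilon> in auto)
  then show thesis by (rule that)
qed

lemma analytic_aut_comp: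
  assumes S: "submonoid S" and A: "is_aut S A" "analytic_aut A" and B: "is_aut S B" "analytic_aut B"
  shows "analytic_aut (op_comp A B)"
proof -
  obtain s where s: "exp_bounded A s 1" using exp_bounded_of_analytic_aut[OF S A] by blast
  obtain t where t: "exp_bounded B t 1" using exp_bounded_of_analytic_aut[OF S B] by blast
  have "exp_bounded (op_comp A B) (min s (t - 1)) (1 + 1)"
    by (intro exp_bounded_comp graded_pos[OF S] is_autD(1)[OF A(1)] is_autD(1)[OF B(1)] exp_bounded_mono[OF s] exp_bounded_mono[OF t]) auto
  then show ?thesis by (rule analytic_aut_of_exp_bounded[OF is_aut_comp[OF S A(1) B(1)]]) simp
qed

lemma analytic_aut_factorization_one:
  assumes S: "submonoid S" "submonoid S1" "submonoid S2" "S1 \<subseteq> S" "S2 \<subseteq> S" "S \<subseteq> S1 \<union> S2"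
    and g: "is_aut S g" and analytic: "analytic_aut g"
  obtains A B where "is_aut S1 A" "is_aut S2 B" "analytic_aut A" "analytic_aut B" "op_comp A (op_comp g B) = op_one"
proof -
  obtain s \<epsilon> where close: "close_to_one g s \<epsilon>" and \<epsilon>: "\<epsilon> \<le> 1 / (5376 * real CARD('n))"
    using analytic_aut_small[OF g submonoidD(2)[OF S(1)] analytic, of "1 / (5376 * real CARD('n))"] by auto
  have "5376 * real CARD('n) * \<epsilon> \<le> 1" using \<epsilon> by (simp add: pos_le_divide_eq mult_ac)
  from small_factorization[OF S g close this] show thesis
    using analytic_aut_of_exp_bounded that by (metis zero_le_one)
qed

lemma is_aut_trivial:
  assumes "is_aut {0} B"
  shows "B = op_one"
proof (intro ext)
  fix \<gamma> \<nu>
  show "B \<gamma> \<nu> = op_one \<gamma> \<nu>"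
    using is_autD(2)[OF assms, of \<gamma>] graded_zero[OF is_autD(1)[OF assms], of \<nu> \<gamma>]
    by (cases "\<nu> = \<gamma>") (auto simp: op_one_def)
qed

lemma analytic_aut_inverse:
  assumes S: "submonoid S" and A: "is_aut S A" "analytic_aut A"
  obtains A' where "is_aut S A'" "analytic_aut A'" "op_comp A' A = op_one" "op_comp A A' = op_one"
proof -
  have inv: "\<exists>X. is_aut S X \<and> analytic_aut X \<and> op_comp X Y = op_one" if Y: "is_aut S Y" "analytic_aut Y" for Y
  proof -
    obtain X B where X: "is_aut S X" "is_aut {0} B" "analytic_aut X" "op_comp X (op_comp Y B) = op_one"
      by (rule analytic_aut_factorization_one[OF S S submonoid_0 _ _ _ Y]) (use submonoidD(1)[OF S] in auto)
    have "B = op_one" by (rule is_aut_trivial[OF X(2)])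
    then have "op_comp X Y = op_one"
      using X(4) op_comp_one_right[OF graded_pos[OF S is_autD(1)[OF Y(1)]]] by simp
    then show ?thesis using X by blast
  qed
  note gr = graded_pos[OF S is_autD(1)]
  obtain X where X: "is_aut S X" "analytic_aut X" "op_comp X A = op_one" using inv A by blast
  obtain Y where Y: "is_aut S Y" "analytic_aut Y" "op_comp Y X = op_one" using inv X by blast
  \<comment> \<open>The factorization yields left inverses only. \<open>X\<close> has
    \<open>A\<close> as right inverse and \<open>Y\<close> as left inverse, so the two coincide and
    \<open>X\<close> is two-sided.\<close>
  have "Y = op_comp Y (op_comp X A)"
    using X op_comp_one_right[OF gr[OF Y(1)]] by simp
  also have "\<dots> = op_comp (op_comp Y X) A"
    by (simp add: op_comp_assoc gr[OF Y(1)] gr[OF X(1)] gr[OF A(1)])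
  also have "\<dots> = A" using Y op_comp_one_left[OF gr[OF A(1)]] by simp
  finally have "op_comp A X = op_one" using Y by simp
  with X show thesis using that by blast
qed

lemma analytic_aut_factorization:
  assumes S: "submonoid S" "submonoid S1" "submonoid S2" "S1 \<subseteq> S" "S2 \<subseteq> S" "S \<subseteq> S1 \<union> S2"
    and g: "is_aut S g" and analytic: "analytic_aut g"
  obtains g1 g2 where "is_aut S1 g1" "is_aut S2 g2" "analytic_aut g1" "analytic_aut g2" "g = op_comp g1 g2"
proof -
  obtain A B where AB: "is_aut S1 A" "is_aut S2 B" "analytic_aut A" "analytic_aut B" "op_comp A (op_comp g B) = op_one"
    using analytic_aut_factorization_one[OF S g analytic] by blast
  obtain A' where A': "is_aut S1 A'" "analytic_aut A'" "op_comp A' A = op_one"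
    using analytic_aut_inverse[OF S(2) AB(1,3)] by blast
  obtain B' where B': "is_aut S2 B'" "analytic_aut B'" "op_comp B B' = op_one"
    using analytic_aut_inverse[OF S(3) AB(2,4)] by blast
  have gr: "graded pos A" "graded pos A'" "graded pos B" "graded pos B'" "graded pos g"
    using graded_pos[OF S(1) is_autD(1)[OF g]] graded_pos[OF S(2) is_autD(1)[OF AB(1)]]
      graded_pos[OF S(2) is_autD(1)[OF A'(1)]] graded_pos[OF S(3) is_autD(1)[OF AB(2)]]
      graded_pos[OF S(3) is_autD(1)[OF B'(1)]] by auto
  note gc = graded_comp[OF submonoid_pos]
  have "op_comp g B = op_comp (op_comp A' A) (op_comp g B)"
    unfolding A' by (simp add: op_comp_one_left gc gr)
  also have "\<dots> = op_comp A' op_one"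
    unfolding AB(5)[symmetric] by (simp add: op_comp_assoc gc gr)
  finally have gB: "op_comp g B = A'" by (simp add: op_comp_one_right gr)
  have "g = op_comp g (op_comp B B')" unfolding B' by (simp add: op_comp_one_right gr)
  also have "\<dots> = op_comp A' B'" unfolding gB[symmetric] by (simp add: op_comp_assoc gr)
  finally show thesis using that A' B' by blast
qed

section \<open>Comparison with convergence at a point of the torus\<close>

lemma analytic_op_of_exp_bounded:
  assumes S: "submonoid S" and g: "is_aut S g" and bound: "exp_bounded g s \<eta>"
  shows "analytic_op g"
  unfolding analytic_op_def analytic_series_def
proof (intro allI bexI)
  fix \<gamma>
  \<comment> \<open>Additivity of the degree makes the weight itself a point of the torus, the same
    for all \<gamma>.\<close>
  let ?t = "\<lambda>\<mu>. complex_of_real (exp (s * deg \<mu>))"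
  let ?f = "\<lambda>\<mu>. cmod (g \<gamma> (\<gamma> + \<mu>) * ?t \<mu>)"
  show "?t \<in> torus"
    by (auto simp: torus_def deg_add distrib_left exp_add)
  show "?f summable_on UNIV"
  proof (rule nonneg_bdd_above_summable_on)
    have "sum ?f F \<le> exp (\<eta> * ell \<gamma>)" if F: "finite F" for F
    proof -
      \<comment> \<open>Absolute values are taken because exponents outside \<open>pos\<close> may
        have negative degree.\<close>
      define N where "N = (\<Sum>\<mu>\<in>F. \<bar>deg \<mu>\<bar>)"
      have "deg \<mu> \<le> N" if "\<mu> \<in> F" for \<mu>
        using member_le_sum[OF that, of "\<lambda>\<mu>. \<bar>deg \<mu>\<bar>"] F by (simp add: N_def)
      then have "sum ?f F = sum ?f (F \<inter> trunc N)"
        using F graded_zero'[OF graded_pos[OF S is_autD(1)[OF g]], of _ \<gamma>]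
        by (intro sum.mono_neutral_right) (auto simp: trunc_def)
      also have "\<dots> \<le> sum ?f (trunc N)" by (intro sum_mono2) auto
      also have "\<dots> = trunc_norm g s N \<gamma>" by (simp add: trunc_norm_def norm_mult)
      also have "\<dots> \<le> exp (\<eta> * ell \<gamma>)" using bound by (simp add: exp_bounded_def)
      finally show ?thesis .
    qed
    then show "bdd_above (sum ?f ` {F. F \<subseteq> UNIV \<and> finite F})"
      by (intro bdd_aboveI[of _ "exp (\<eta> * ell \<gamma>)"]) auto
  qed simp
qed

text \<open>The logarithm of the modulus is additive on the lattice and hence bounded by a multiple
  of the l1-norm. Convergence at an arbitrary torus point thereby gives convergence at logarithmic
  radius -T, since \<open>ell\<close> is at most \<open>deg\<close> on \<open>pos\<close>.\<close>

lemma torus_lower_bound: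
  assumes "t \<in> torus"
  obtains T :: real where "0 \<le> T" "\<And>\<mu> :: 'n lattice. exp (- T * ell \<mu>) \<le> cmod (t \<mu>)"
proof -
  define L where "L = (\<lambda>\<mu>. ln (cmod (t \<mu>)))"
  have nz: "t \<mu> \<noteq> 0" for \<mu> using assms by (simp add: torus_def)
  have add: "L (\<alpha> + \<beta>) = L \<alpha> + L \<beta>" for \<alpha> \<beta>
    using assms nz by (simp add: torus_def L_def norm_mult ln_mult)
  define T where "T = (\<Sum>i\<in>UNIV. \<bar>L (axis i 1)\<bar>)"
  have "exp (- T * ell \<mu>) \<le> cmod (t \<mu>)" for \<mu>
  proof -
    have "- L \<mu> \<le> \<bar>\<Sum>i\<in>UNIV. real_of_int (\<mu> $ i) * L (axis i 1)\<bar>"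
      using additive_lattice_expand[of L \<mu>, OF add] by simp
    also have "\<dots> \<le> (\<Sum>i\<in>UNIV. \<bar>real_of_int (\<mu> $ i)\<bar> * \<bar>L (axis i 1)\<bar>)"
      by (rule order_trans[OF sum_abs]) (simp add: abs_mult)
    also have "\<dots> \<le> (\<Sum>i\<in>UNIV. ell \<mu> * \<bar>L (axis i 1)\<bar>)"
      by (intro sum_mono mult_right_mono ell_ge_comp) simp
    also have "\<dots> = T * ell \<mu>" by (simp add: T_def sum_distrib_left mult.commute)
    finally have "- T * ell \<mu> \<le> L \<mu>" by simp
    then have "exp (- T * ell \<mu>) \<le> exp (L \<mu>)" by simp
    then show ?thesis using nz by (simp add: L_def)
  qed
  moreover have "0 \<le> T" by (simp add: T_def sum_nonneg)
  ultimately show thesis using that by blast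
qed

lemma analytic_aut_of_analytic_op:
  assumes g: "is_aut S g" and analytic: "analytic_op g"
  shows "analytic_aut g"
proof -
  have "\<exists>T B. 0 \<le> T \<and> (\<forall>N. trunc_norm g (- T) N (axis i 1) \<le> B)" for i
  proof -
    obtain t where t: "t \<in> torus" "(\<lambda>\<mu>. cmod (g (axis i 1) (axis i 1 + \<mu>) * t \<mu>)) summable_on UNIV"
      using analytic unfolding analytic_op_def analytic_series_def by blast
    obtain T where T: "0 \<le> T" "\<And>\<mu>. exp (- T * ell \<mu>) \<le> cmod (t \<mu>)"
      using torus_lower_bound[OF t(1)] by blast
    have "trunc_norm g (- T) N (axis i 1) \<le> (\<Sum>\<^sub>\<infinity>\<mu>. cmod (g (axis i 1) (axis i 1 + \<mu>) * t \<mu>))" for N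
    proof -
      have "trunc_norm g (- T) N (axis i 1) \<le> (\<Sum>\<mu>\<in>trunc N. cmod (g (axis i 1) (axis i 1 + \<mu>) * t \<mu>))"
        unfolding trunc_norm_def norm_mult
      proof (intro sum_mono mult_left_mono)
        fix \<mu> assume "\<mu> \<in> trunc N"
        then have "T * ell \<mu> \<le> T * deg \<mu>"
          using T by (intro mult_left_mono ell_le_deg) (auto dest: truncD)
        then have "exp (- T * deg \<mu>) \<le> exp (- T * ell \<mu>)" by simp
        then show "exp (- T * deg \<mu>) \<le> cmod (t \<mu>)" using T(2) order_trans by blast
      qed simp
      also have "\<dots> \<le> (\<Sum>\<^sub>\<infinity>\<mu>. cmod (g (axis i 1) (axis i 1 + \<mu>) * t \<mu>))"
        using t(2) by (intro finite_sum_le_infsum) auto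
      finally show ?thesis .
    qed
    then show ?thesis using T(1) by blast
  qed
  then obtain T B where TB: "\<And>i. 0 \<le> T i" "\<And>i N. trunc_norm g (- T i) N (axis i 1) \<le> B i"
    by metis
  \<comment> \<open>The definition of analyticity allows a different torus point for each
    coordinate; this radius lies below all of theirs.\<close>
  define s where "s = - (\<Sum>i\<in>UNIV. T i)"
  have "trunc_norm (g - op_one) s N (axis i 1) \<le> B i" for i N
  proof -
    have "trunc_norm (g - op_one) s N (axis i 1) \<le> trunc_norm g s N (axis i 1)"
      using trunc_norm_minus_one[of g "axis i 1" s N, OF is_autD(2)[OF g]] by (cases "0 \<le> N") (auto simp del: fun_diff_def)
    also have "\<dots> \<le> trunc_norm g (- T i) N (axis i 1)"
      using member_le_sum[of i UNIV T] TB(1) by (intro trunc_norm_mono) (simp add: s_def)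
    also have "\<dots> \<le> B i" by (rule TB)
    finally show ?thesis .
  qed
  then have "close_to_one g s (\<Sum>i\<in>UNIV. B i)" unfolding close_to_one_def by (intro allI sum_mono)
  then show ?thesis by (auto simp: analytic_aut_def)
qed

lemma analytic_op_iff_analytic_aut:
  assumes "submonoid S" "is_aut S g"
  shows "analytic_op g \<longleftrightarrow> analytic_aut g"
  using assms analytic_aut_of_analytic_op analytic_op_of_exp_bounded exp_bounded_of_analytic_aut by metis

text \<open>Replaces the exponential description of the group by conditions stable under products
  and entrywise limits, which is what the iteration produces.\<close>

lemma G_cone_eq_is_aut:
  assumes "submonoid {\<mu>. lattice_emb \<mu> \<in> C}"
  shows "G_cone C = {g. is_aut {\<mu>. lattice_emb \<mu> \<in> C} g}"
proof -
  have "g_cone C = {v. supp_in {\<mu>. lattice_emb \<mu> \<in> C} v}"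
    by (auto simp: g_cone_def supp_in_def)
  then show ?thesis
    unfolding G_cone_def using is_aut_exp[OF assms] is_aut_imp_exp[OF assms]
    by (auto simp: image_iff) metis
qed

end

section \<open>Cones over sectors\<close>

text \<open>Three half-planes, bounded by the two edges and by the perpendicular to the bisector.
  When a = b the first two leave a whole line and the third selects the ray. The second claim
  supplies the functional from which the degree is built.\<close>

lemma sector_Icc_eq:
  assumes "a \<le> b" "b - a < pi"
  defines "m \<equiv> (a + b) / 2"
  shows "insert 0 (sector {a..b}) =
    {z. 0 \<le> Im (z * cis (- a)) \<and> Im (z * cis (- b)) \<le> 0 \<and> 0 \<le> Re (z * cis (- m))}"
    and "z \<in> sector {a..b} \<Longrightarrow> 0 < Re (z * cis (- m))"
proof -
  define h where "h = (b - a) / 2"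
  have h: "0 \<le> h" "h < pi / 2" "a = m - h" "b = m + h"
    using assms by (auto simp: h_def m_def field_simps)
  have rot: "of_real r * cis \<theta> * cis (- c) = of_real r * cis (\<theta> - c)" for r \<theta> c
    by (simp add: mult.assoc cis_mult)
  have fwd: "0 \<le> Im (z * cis (- a)) \<and> Im (z * cis (- b)) \<le> 0 \<and> 0 < Re (z * cis (- m))"
    if "z \<in> sector {a..b}" for z
  proof -
    obtain r \<theta> where z: "z = of_real r * cis \<theta>" "0 < r" "a \<le> \<theta>" "\<theta> \<le> b"
      using \<open>z \<in> sector {a..b}\<close> by (auto simp: sector_def)
    have "0 \<le> sin (\<theta> - a)" using z assms by (intro sin_ge_zero) auto
    moreover have "0 \<le> sin (b - \<theta>)" using z assms by (intro sin_ge_zero) auto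
    then have "sin (\<theta> - b) \<le> 0" using sin_minus[of "b - \<theta>"] by simp
    moreover have "0 < cos (\<theta> - m)" using z h by (intro cos_gt_zero_pi) auto
    ultimately show ?thesis
      unfolding z(1) rot using z(2) by (simp add: mult_le_0_iff)
  qed
  then show "z \<in> sector {a..b} \<Longrightarrow> 0 < Re (z * cis (- m))" by blast
  show "insert 0 (sector {a..b}) =
    {z. 0 \<le> Im (z * cis (- a)) \<and> Im (z * cis (- b)) \<le> 0 \<and> 0 \<le> Re (z * cis (- m))}"
    (is "_ = ?H")
  proof (intro equalityI subsetI)
    fix z assume "z \<in> insert 0 (sector {a..b})"
    then show "z \<in> ?H" using fwd by fastforce
  next
    fix z assume H: "z \<in> ?H"
    show "z \<in> insert 0 (sector {a..b})"
    proof (cases "z = 0")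
      case False
      define \<phi> where "\<phi> = Arg (z * cis (- m))"
      define r where "r = cmod z"
      have r: "0 < r" using False by (simp add: r_def)
      have \<phi>: "- pi < \<phi>" "\<phi> \<le> pi" using Arg_bounded by (auto simp: \<phi>_def)
      have "z * cis (- m) = of_real r * cis \<phi>"
        using rcis_cmod_Arg[of "z * cis (- m)"] by (simp add: rcis_def r_def \<phi>_def norm_mult)
      then have "z * cis (- m) * cis m = of_real r * cis \<phi> * cis m" by simp
      then have z: "z = of_real r * cis (m + \<phi>)" by (simp add: mult.assoc cis_mult add.commute)
      have zc: "z * cis (- c) = of_real r * cis (m + \<phi> - c)" for c
        unfolding z by (rule rot)
      have "0 \<le> sin (\<phi> + h)" "sin (\<phi> - h) \<le> 0" "0 \<le> cos \<phi>"
        using H r unfolding mem_Collect_eq zc h(3,4)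
        by (simp_all add: mult_le_0_iff zero_le_mult_iff algebra_simps)
      have cos_neg: "cos x < 0" if "pi / 2 < x" "x \<le> pi" for x
        using cos_gt_zero_pi[of "pi - x"] that by simp
      have \<phi>2: "- (pi / 2) \<le> \<phi>" "\<phi> \<le> pi / 2"
        using cos_neg[of \<phi>] cos_neg[of "- \<phi>"] \<phi> \<open>0 \<le> cos \<phi>\<close> by force+
      have "- h \<le> \<phi>"
        using sin_gt_zero[of "- (\<phi> + h)"] \<open>0 \<le> sin (\<phi> + h)\<close> sin_minus[of "\<phi> + h"] \<phi>2 h pi_gt_zero
        by (smt (verit) field_sum_of_halves)
      moreover have "\<phi> \<le> h"
        using sin_gt_zero[of "\<phi> - h"] \<open>sin (\<phi> - h) \<le> 0\<close> \<phi>2 h pi_gt_zero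
        by (smt (verit) field_sum_of_halves)
      ultimately have "m + \<phi> \<in> {a..b}" using h by auto
      then show ?thesis using z r by (auto simp: sector_def)
    qed simp
  qed
qed

text \<open>Closedness excludes the open interval of length pi, so the set of angles is compact and
  connected.\<close>

lemma closed_admissible_sector_Icc:
  assumes "closed_admissible_sector V"
  obtains a b where "a \<le> b" "b - a < pi" "V = sector {a..b}"
proof -
  obtain S where S: "admissible_angles S" "closed S" "V = sector S"
    using assms by (auto simp: closed_admissible_sector_def)
  have ne: "S \<noteq> {}" and con: "connected S" using S by (auto simp: admissible_angles_def)
  have "\<not> (\<exists>a. S = {a<..<a + pi})"
  proof
    assume "\<exists>a. S = {a<..<a + pi}"
    then obtain a where a: "S = {a<..<a + pi}" by blast
    have "closure S = {a..a + pi}" unfolding a by (intro closure_greaterThanLessThan) simp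
    then have "a \<in> S" using S(2) by (simp add: closure_closed)
    then show False by (simp add: a)
  qed
  then have b: "bounded S" "diameter S < pi" using S by (auto simp: admissible_angles_def)
  then have "compact S" using S(2) compact_eq_bounded_closed by blast
  then obtain a b where ab: "S = {a..b}" using con connected_compact_interval_1 by metis
  then have "a \<le> b" using ne by auto
  moreover have "dist b a \<le> diameter S"
    using ab \<open>a \<le> b\<close> by (intro diameter_bounded_bound[OF b(1)]) auto
  ultimately show thesis using that ab b S(3) by (auto simp: dist_real_def)
qed

lemma sector_convex_cone:
  assumes "closed_admissible_sector V"
  obtains u where "\<And>z. z \<in> V \<Longrightarrow> 0 < Re (z * u)"
    and "closed (insert 0 V)" "convex (insert 0 V)" "cone (insert 0 V)"
proof -
  obtain a b where ab: "a \<le> b" "b - a < pi" "V = sector {a..b}"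
    using closed_admissible_sector_Icc[OF assms] .
  let ?H = "{z. 0 \<le> Im (z * cis (- a)) \<and> Im (z * cis (- b)) \<le> 0 \<and> 0 \<le> Re (z * cis (- ((a + b) / 2)))}"
  have eq: "insert 0 V = ?H" unfolding ab by (rule sector_Icc_eq(1)[OF ab(1,2)])
  have "closed ?H"
    by (intro closed_Collect_conj closed_Collect_le continuous_intros)
  moreover have "convex ?H \<and> cone ?H"
    unfolding convex_cone by (auto simp: distrib_right intro!: add_nonneg_nonneg add_nonpos_nonpos
        simp del: times_complex.simps) (auto simp: mult_nonneg_nonpos)
  ultimately have "closed (insert 0 V)" "convex (insert 0 V)" "cone (insert 0 V)"
    unfolding eq by auto
  moreover have "0 < Re (z * cis (- ((a + b) / 2)))" if "z \<in> V" for z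
    using sector_Icc_eq(2)[OF ab(1,2)] that unfolding ab(3) .
  ultimately show thesis by (intro that)
qed

lemma linear_Z_real: "linear (Z_real Z)"
  by (rule linearI) (simp_all add: Z_real_def scaleR_left_distrib sum.distrib scaleR_sum_right)

lemma continuous_Z_real [continuous_intros]: "continuous_on A (Z_real Z)"
  by (simp add: linear_Z_real linear_continuous_on linear_conv_bounded_linear[symmetric])

lemma Z_real_emb:
  assumes "central_charge Z"
  shows "Z_real Z (lattice_emb \<gamma>) = Z \<gamma>"
  using additive_lattice_expand[of Z \<gamma>] assms
  by (simp add: central_charge_def Z_real_def lattice_emb_def)

lemma lattice_emb_add: "lattice_emb (\<gamma> + \<delta>) = lattice_emb \<gamma> + lattice_emb \<delta>"
  by (simp add: lattice_emb_def vec_eq_iff)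

lemma lattice_emb_0: "lattice_emb 0 = 0"
  by (simp add: lattice_emb_def vec_eq_iff)

lemma ell_le_norm_emb: "ell (\<gamma> :: 'n::finite lattice) \<le> real CARD('n) * norm (lattice_emb \<gamma>)"
proof -
  have "\<bar>real_of_int (\<gamma> $ i)\<bar> \<le> norm (lattice_emb \<gamma>)" for i
    using component_le_norm_cart[of "lattice_emb \<gamma>" i] by (simp add: lattice_emb_def)
  then show ?thesis unfolding ell_def by (intro sum_bounded_above) auto
qed

lemma sector_conesD:
  assumes "C \<in> sector_cones Z V"
  shows "closed C" "convex C" "cone C" "strict C" "0 \<in> C"
    "x \<in> C \<Longrightarrow> x \<noteq> 0 \<Longrightarrow> Z_real Z x \<in> V" "x \<in> C \<Longrightarrow> Z_real Z x \<in> insert 0 V"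
proof -
  have *: "closed C" "convex C" "cone C" "strict C" "Z_real Z ` (C - {0}) \<subseteq> V"
    "C \<inter> {x. Z_real Z x = 0} = {0}"
    using assms by (auto simp: sector_cones_def)
  then show "closed C" "convex C" "cone C" "strict C" "0 \<in> C" "x \<in> C \<Longrightarrow> x \<noteq> 0 \<Longrightarrow> Z_real Z x \<in> V"
    by auto
  show "x \<in> C \<Longrightarrow> Z_real Z x \<in> insert 0 V"
    using * linear_0[OF linear_Z_real, of Z] by (cases "x = 0") auto
qed

text \<open>The functional is positive on the compact set of unit vectors of the cone, so it has a
  positive lower bound c there, and homogeneity gives R = 1/c. This is where the degree becomes
  comparable with the norm.\<close>

lemma cone_norm_bound:
  fixes C :: "(real ^ 'n::finite) set"
  assumes C: "C \<in> sector_cones Z V" and u: "\<And>z. z \<in> V \<Longrightarrow> 0 < Re (z * u)"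
  obtains R where "0 \<le> R" "\<And>x. x \<in> C \<Longrightarrow> norm x \<le> R * Re (Z_real Z x * u)"
proof -
  define K where "K = C \<inter> sphere 0 1"
  define \<psi> where "\<psi> = (\<lambda>x. Re (Z_real Z x * u))"
  have \<psi>_scale: "\<psi> (c *\<^sub>R x) = c * \<psi> x" for c x
    by (simp add: \<psi>_def linear_cmul[OF linear_Z_real] right_diff_distrib mult.assoc)
  have \<psi>_pos: "0 < \<psi> x" if "x \<in> C" "x \<noteq> 0" for x
    using that sector_conesD(6)[OF C] u by (simp add: \<psi>_def)
  have K: "compact K" unfolding K_def using sector_conesD(1)[OF C] by (intro closed_Int_compact) auto
  have cont: "continuous_on K \<psi>" unfolding \<psi>_def by (intro continuous_intros)
  obtain c where c: "0 < c" "\<And>x. x \<in> K \<Longrightarrow> c \<le> \<psi> x"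
  proof (cases "K = {}")
    case True
    then show thesis using that[of 1] by simp
  next
    case False
    obtain x where x: "x \<in> K" "\<And>y. y \<in> K \<Longrightarrow> \<psi> x \<le> \<psi> y"
      using continuous_attains_inf[OF K False cont] by blast
    have "0 < \<psi> x" using x(1) by (intro \<psi>_pos) (auto simp: K_def)
    then show thesis using that x(2) by blast
  qed
  have "norm x \<le> 1 / c * \<psi> x" if "x \<in> C" for x
  proof (cases "x = 0")
    case True
    then show ?thesis using \<psi>_scale[of 0 0] by simp
  next
    case False
    have "x /\<^sub>R norm x \<in> K"
      using that False sector_conesD(3)[OF C] by (auto simp: K_def cone_def)
    then have "c \<le> \<psi> x / norm x" using c(2) \<psi>_scale by (fastforce simp: divide_inverse mult.commute)
    then show ?thesis using c(1) False by (simp add: field_simps)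
  qed
  then show thesis using that[of "1 / c"] c(1) by (simp add: \<psi>_def)
qed

text \<open>A ready-made upper bound for cones over the sector. Cutting it out by an inequality
  makes closedness evident, which would need an argument for a Minkowski sum of cones.\<close>

lemma bounded_cone_in_sector_cones:
  fixes Z :: "'n::finite lattice \<Rightarrow> complex"
  assumes V: "closed (insert 0 V)" "convex (insert 0 V)" "cone (insert 0 V)"
    and u: "\<And>z. z \<in> V \<Longrightarrow> 0 < Re (z * u)" and R: "0 \<le> R"
  shows "{x. Z_real Z x \<in> insert 0 V \<and> norm x \<le> R * Re (Z_real Z x * u)} \<in> sector_cones Z V"
    (is "?K \<in> _")
proof -
  define \<psi> where "\<psi> = (\<lambda>x. Re (Z_real Z x * u))"
  note lin = linear_Z_real[of Z]
  have \<psi>: "\<psi> (x + y) = \<psi> x + \<psi> y" "\<psi> (c *\<^sub>R x) = c * \<psi> x" for x y c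
    by (simp_all add: \<psi>_def linear_add[OF lin] linear_cmul[OF lin] algebra_simps)
  have K: "?K = {x. Z_real Z x \<in> insert 0 V \<and> norm x \<le> R * \<psi> x}" by (simp add: \<psi>_def)
  have "closed (Z_real Z -` insert 0 V \<inter> {x. norm x \<le> R * \<psi> x})"
    unfolding \<psi>_def
    by (intro closed_Int closed_vimage closed_Collect_le continuous_intros V(1))
  moreover have "Z_real Z -` insert 0 V \<inter> {x. norm x \<le> R * \<psi> x} = ?K" unfolding K by auto
  ultimately have "closed ?K" by simp
  moreover have "convex ?K \<and> cone ?K"
    unfolding K convex_cone
  proof (intro conjI ballI allI impI)
    note VV = conjI[OF V(2,3), unfolded convex_cone]
    fix x y assume xy: "x \<in> {x. Z_real Z x \<in> insert 0 V \<and> norm x \<le> R * \<psi> x}"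
      "y \<in> {x. Z_real Z x \<in> insert 0 V \<and> norm x \<le> R * \<psi> x}"
    have "norm (x + y) \<le> R * \<psi> x + R * \<psi> y"
      using xy by (intro norm_triangle_le add_mono) auto
    moreover have "Z_real Z x + Z_real Z y \<in> insert 0 V" using VV xy by blast
    ultimately show "x + y \<in> {x. Z_real Z x \<in> insert 0 V \<and> norm x \<le> R * \<psi> x}"
      by (simp add: \<psi> linear_add[OF lin] distrib_left)
  next
    note VV = conjI[OF V(2,3), unfolded convex_cone]
    fix x and c :: real assume x: "x \<in> {x. Z_real Z x \<in> insert 0 V \<and> norm x \<le> R * \<psi> x}" and c: "0 \<le> c"
    have "c *\<^sub>R Z_real Z x \<in> insert 0 V" using VV x c by blast
    moreover have "c * norm x \<le> c * (R * \<psi> x)" using x c by (intro mult_left_mono) auto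
    ultimately show "c *\<^sub>R x \<in> {x. Z_real Z x \<in> insert 0 V \<and> norm x \<le> R * \<psi> x}"
      using c by (simp add: \<psi> linear_cmul[OF lin] mult.left_commute)
  qed
  moreover have "strict ?K"
    unfolding strict_def
  proof (intro notI, elim exE conjE)
    fix p d assume d: "d \<noteq> 0" and line: "\<forall>t. p + t *\<^sub>R d \<in> ?K"
    have bound: "norm (p + t *\<^sub>R d) \<le> R * (\<psi> p + t * \<psi> d)" for t
      using line unfolding K by (simp add: \<psi>)
    \<comment> \<open>On a line \<psi> is affine, so adding the bounds at t and -t eliminates its
      slope and caps the length of t d at norm p + R \<psi>(p). This t exceeds the cap by 1.\<close>
    define t where "t = (norm p + R * \<psi> p + 1) / norm d"
    have t: "0 \<le> R * \<psi> p" using bound[of 0] order_trans[OF norm_ge_zero] by simp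
    have "norm (t *\<^sub>R d) = norm p + R * \<psi> p + 1"
      using d t by (simp add: t_def)
    moreover have "norm (t *\<^sub>R d) \<le> norm (p + t *\<^sub>R d) + norm p"
      using norm_triangle_ineq4[of "p + t *\<^sub>R d" p] by simp
    moreover have "norm (t *\<^sub>R d) \<le> norm (p + (- t) *\<^sub>R d) + norm p"
      using norm_triangle_ineq4[of "p + (- t) *\<^sub>R d" p] by simp
    ultimately show False
      using bound[of t] bound[of "- t"] by (simp add: algebra_simps)
  qed
  moreover have "Z_real Z x \<in> V" if "x \<in> ?K" "x \<noteq> 0" for x
  proof (rule ccontr)
    assume "Z_real Z x \<notin> V"
    then have "Z_real Z x = 0" using that by auto
    then show False using that by auto
  qed
  then have "Z_real Z ` (?K - {0}) \<subseteq> V" by blast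
  moreover have "?K \<inter> {x. Z_real Z x = 0} = {0}"
    using linear_0[OF lin] by auto
  ultimately show ?thesis unfolding sector_cones_def by blast
qed

lemma sector_cones_restrict:
  assumes C: "C \<in> sector_cones Z V" and W: "closed (insert 0 W)" "convex (insert 0 W)" "cone (insert 0 W)"
    and "0 \<notin> V"
  shows "{x \<in> C. Z_real Z x \<in> insert 0 W} \<in> sector_cones Z W" (is "?D \<in> _")
proof -
  note lin = linear_Z_real[of Z]
  have nz: "x = 0" if "x \<in> C" "Z_real Z x = 0" for x
    using sector_conesD(6)[OF C that(1)] that(2) \<open>0 \<notin> V\<close> by metis
  have D: "?D = C \<inter> Z_real Z -` insert 0 W" by auto
  have "closed ?D"
    unfolding D by (intro closed_Int closed_vimage continuous_intros W(1) sector_conesD(1)[OF C])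
  moreover have "convex ?D"
    unfolding D by (intro convex_Int convex_linear_vimage lin W(2) sector_conesD(2)[OF C])
  moreover have "cone ?D"
    using W(3) sector_conesD(3)[OF C] unfolding D cone_def vimage_def Int_iff mem_Collect_eq linear_cmul[OF lin]
    by blast
  moreover have "strict ?D" using sector_conesD(4)[OF C] by (auto simp: strict_def)
  moreover have "Z_real Z ` (?D - {0}) \<subseteq> W"
    using nz by auto
  moreover have "?D \<inter> {x. Z_real Z x = 0} = {0}"
    using nz sector_conesD(5)[OF C] linear_0[OF lin] by auto
  ultimately show ?thesis by (auto simp: sector_cones_def)
qed

lemma sector_cones_mono: "V \<subseteq> W \<Longrightarrow> sector_cones Z V \<subseteq> sector_cones Z W"
  unfolding sector_cones_def by blast

lemma (in grading) submonoid_cone: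
  assumes C: "C \<in> sector_cones Z V" and sub: "{\<mu>. lattice_emb \<mu> \<in> C} \<subseteq> pos"
  shows "submonoid {\<mu>. lattice_emb \<mu> \<in> C}"
  using sub sector_conesD(5)[OF C] conjI[OF sector_conesD(2)[OF C] sector_conesD(3)[OF C]]
  unfolding submonoid_def convex_cone by (simp add: lattice_emb_add lattice_emb_0)

text \<open>The factor n compares the l1-norm with the Euclidean one, and \<open>R\<close> compares
  the latter with the functional on the cone. Both together make the degree dominate
  \<open>ell\<close> on the lattice points of \<open>C\<close>.\<close>

lemma cone_grading:
  fixes Z :: "'n::finite lattice \<Rightarrow> complex"
  assumes Z: "central_charge Z"
  defines "deg \<equiv> \<lambda>R u \<mu>. real CARD('n) * R * Re (Z \<mu> * u)"
  shows "grading (deg R u)"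
    and "(\<And>x. x \<in> C \<Longrightarrow> norm x \<le> R * Re (Z_real Z x * u)) \<Longrightarrow>
      {\<mu>. lattice_emb \<mu> \<in> C} \<subseteq> grading.pos (deg R u)"
proof -
  show gr: "grading (deg R u)"
    using Z by unfold_locales (simp add: deg_def central_charge_def algebra_simps)
  assume le: "\<And>x. x \<in> C \<Longrightarrow> norm x \<le> R * Re (Z_real Z x * u)"
  show "{\<mu>. lattice_emb \<mu> \<in> C} \<subseteq> grading.pos (deg R u)"
  proof clarify
    fix \<mu> assume "lattice_emb \<mu> \<in> C"
    from le[OF this] have "real CARD('n) * norm (lattice_emb \<mu>) \<le> deg R u \<mu>"
      unfolding deg_def mult.assoc by (intro mult_left_mono) (auto simp: Z_real_emb[OF Z])
    with ell_le_norm_emb[of \<mu>] show "\<mu> \<in> grading.pos (deg R u)"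
      by (simp add: grading.pos_def[OF gr])
  qed
qed

theorem theorem3p2p1:
  fixes Z :: "int ^ 'n::finite \<Rightarrow> complex"
    and V V\<^sub>1 V\<^sub>2 l\<^sub>1\<^sub>2 :: "complex set"
  assumes "rational_rank2 Z"
    and "closed_admissible_sector V" and "rational_sector V"
    and "closed_admissible_sector V\<^sub>1" and "rational_sector V\<^sub>1"
    and "closed_admissible_sector V\<^sub>2" and "rational_sector V\<^sub>2"
    and "V = V\<^sub>1 \<union> V\<^sub>2"
    and "V\<^sub>1 \<inter> V\<^sub>2 = l\<^sub>1\<^sub>2"
    and "boundary_ray l\<^sub>1\<^sub>2 V\<^sub>1" and "boundary_ray l\<^sub>1\<^sub>2 V\<^sub>2"
  shows "G_an Z V = G_an Z V\<^sub>1 <#>\<^bsub>G_sector Z V\<^esub> G_an Z V\<^sub>2"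
proof -
  have Z: "central_charge Z" using assms(1) by (simp add: rational_rank2_def)
  obtain u where u: "\<And>z. z \<in> V \<Longrightarrow> 0 < Re (z * u)"
    and V: "closed (insert 0 V)" "convex (insert 0 V)" "cone (insert 0 V)"
    using sector_convex_cone[OF assms(2)] by blast
  have V1: "closed (insert 0 V\<^sub>1)" "convex (insert 0 V\<^sub>1)" "cone (insert 0 V\<^sub>1)"
    using sector_convex_cone[OF assms(4)] by blast+
  have V2: "closed (insert 0 V\<^sub>2)" "convex (insert 0 V\<^sub>2)" "cone (insert 0 V\<^sub>2)"
    using sector_convex_cone[OF assms(6)] by blast+
  have V0: "0 \<notin> V" using u by fastforce
  show ?thesis
  proof (intro equalityI subsetI)
    fix g assume "g \<in> G_an Z V"
    then obtain C where C: "C \<in> sector_cones Z V" "g \<in> G_cone C" "analytic_op g"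
      by (auto simp: G_an_def)
    obtain R where R: "\<And>x. x \<in> C \<Longrightarrow> norm x \<le> R * Re (Z_real Z x * u)"
      using cone_norm_bound[OF C(1) u] by blast
    \<comment> \<open>The degree depends on the cone through \<open>R\<close>, so each inclusion
      uses its own grading.\<close>
    interpret grading "\<lambda>\<mu>. real CARD('n) * R * Re (Z \<mu> * u)"
      by (rule cone_grading(1)[OF Z])
    have sub: "{\<mu>. lattice_emb \<mu> \<in> C} \<subseteq> pos" by (rule cone_grading(2)[OF Z R])
    \<comment> \<open>The parts of \<open>C\<close> above the two subsectors. They cover
      \<open>C\<close> since its image lies in \<open>V\<close> together with 0, and they share the
      part above the common ray.\<close>
    define C1 where "C1 = {x \<in> C. Z_real Z x \<in> insert 0 V\<^sub>1}"
    define C2 where "C2 = {x \<in> C. Z_real Z x \<in> insert 0 V\<^sub>2}"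
    have C1: "C1 \<in> sector_cones Z V\<^sub>1" and C2: "C2 \<in> sector_cones Z V\<^sub>2"
      unfolding C1_def C2_def
      by (rule sector_cones_restrict[OF C(1) V1 V0] sector_cones_restrict[OF C(1) V2 V0])+
    have S: "submonoid {\<mu>. lattice_emb \<mu> \<in> C}" by (rule submonoid_cone[OF C(1) sub])
    have S1: "submonoid {\<mu>. lattice_emb \<mu> \<in> C1}"
      using sub by (intro submonoid_cone[OF C1]) (auto simp: C1_def)
    have S2: "submonoid {\<mu>. lattice_emb \<mu> \<in> C2}"
      using sub by (intro submonoid_cone[OF C2]) (auto simp: C2_def)
    have g: "is_aut {\<mu>. lattice_emb \<mu> \<in> C} g" using C(2) G_cone_eq_is_aut[OF S] by simp
    have analytic: "analytic_aut g" using analytic_op_iff_analytic_aut[OF S g] C(3) by simp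
    obtain g1 g2 where g12: "is_aut {\<mu>. lattice_emb \<mu> \<in> C1} g1" "is_aut {\<mu>. lattice_emb \<mu> \<in> C2} g2"
      "analytic_aut g1" "analytic_aut g2" "g = op_comp g1 g2"
    proof (rule analytic_aut_factorization[OF S S1 S2 _ _ _ g analytic])
      show "{\<mu>. lattice_emb \<mu> \<in> C} \<subseteq> {\<mu>. lattice_emb \<mu> \<in> C1} \<union> {\<mu>. lattice_emb \<mu> \<in> C2}"
        using sector_conesD(7)[OF C(1)] assms(8) by (auto simp: C1_def C2_def)
    qed (auto simp: C1_def C2_def)
    have "g1 \<in> G_an Z V\<^sub>1"
      unfolding G_an_def using C1 g12 G_cone_eq_is_aut[OF S1] analytic_op_iff_analytic_aut[OF S1] by auto
    moreover have "g2 \<in> G_an Z V\<^sub>2"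
      unfolding G_an_def using C2 g12 G_cone_eq_is_aut[OF S2] analytic_op_iff_analytic_aut[OF S2] by auto
    ultimately show "g \<in> G_an Z V\<^sub>1 <#>\<^bsub>G_sector Z V\<^esub> G_an Z V\<^sub>2"
      using g12(5) by (auto simp: set_mult_def G_sector_def)
  next
    fix g assume "g \<in> G_an Z V\<^sub>1 <#>\<^bsub>G_sector Z V\<^esub> G_an Z V\<^sub>2"
    then obtain g1 g2 where g12: "g1 \<in> G_an Z V\<^sub>1" "g2 \<in> G_an Z V\<^sub>2" "g = op_comp g1 g2"
      by (auto simp: set_mult_def G_sector_def)
    obtain C1 where C1: "C1 \<in> sector_cones Z V\<^sub>1" "g1 \<in> G_cone C1" "analytic_op g1"
      using g12 by (auto simp: G_an_def)
    obtain C2 where C2: "C2 \<in> sector_cones Z V\<^sub>2" "g2 \<in> G_cone C2" "analytic_op g2"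
      using g12 by (auto simp: G_an_def)
    have C1V: "C1 \<in> sector_cones Z V" using C1(1) sector_cones_mono[of V\<^sub>1 V Z] assms(8) by blast
    have C2V: "C2 \<in> sector_cones Z V" using C2(1) sector_cones_mono[of V\<^sub>2 V Z] assms(8) by blast
    obtain R1 where R1: "0 \<le> R1" "\<And>x. x \<in> C1 \<Longrightarrow> norm x \<le> R1 * Re (Z_real Z x * u)"
      using cone_norm_bound[OF C1V u] by blast
    obtain R2 where R2: "0 \<le> R2" "\<And>x. x \<in> C2 \<Longrightarrow> norm x \<le> R2 * Re (Z_real Z x * u)"
      using cone_norm_bound[OF C2V u] by blast
    \<comment> \<open>The functional is nonnegative over the sector, so both norm bounds persist
      with the larger constant. Hence \<open>C\<close> contains both cones and one grading governs
      both factors.\<close>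
    define R where "R = R1 + R2"
    define C where "C = {x. Z_real Z x \<in> insert 0 V \<and> norm x \<le> R * Re (Z_real Z x * u)}"
    have C: "C \<in> sector_cones Z V"
      unfolding C_def R_def using R1 R2 by (intro bounded_cone_in_sector_cones V u) auto
    have nn: "0 \<le> Re (Z_real Z x * u)" if "Z_real Z x \<in> insert 0 V" for x
      using that u by fastforce
    have "C1 \<subseteq> C"
      using sector_conesD(7)[OF C1V] R1(2) nn R2(1) unfolding C_def R_def
      by (smt (verit) mem_Collect_eq mult_nonneg_nonneg distrib_right subsetI)
    have "C2 \<subseteq> C"
      using sector_conesD(7)[OF C2V] R2(2) nn R1(1) unfolding C_def R_def
      by (smt (verit) mem_Collect_eq mult_nonneg_nonneg distrib_right subsetI)
    interpret grading "\<lambda>\<mu>. real CARD('n) * R * Re (Z \<mu> * u)"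
      by (rule cone_grading(1)[OF Z])
    have sub: "{\<mu>. lattice_emb \<mu> \<in> C} \<subseteq> pos"
      by (rule cone_grading(2)[OF Z]) (simp add: C_def)
    have S: "submonoid {\<mu>. lattice_emb \<mu> \<in> C}" by (rule submonoid_cone[OF C sub])
    have S1: "submonoid {\<mu>. lattice_emb \<mu> \<in> C1}"
      using sub \<open>C1 \<subseteq> C\<close> by (intro submonoid_cone[OF C1(1)]) auto
    have S2: "submonoid {\<mu>. lattice_emb \<mu> \<in> C2}"
      using sub \<open>C2 \<subseteq> C\<close> by (intro submonoid_cone[OF C2(1)]) auto
    have g1: "is_aut {\<mu>. lattice_emb \<mu> \<in> C} g1"
      using C1(2) \<open>C1 \<subseteq> C\<close> unfolding G_cone_eq_is_aut[OF S1] mem_Collect_eq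
      by (elim is_aut_mono) auto
    have g2: "is_aut {\<mu>. lattice_emb \<mu> \<in> C} g2"
      using C2(2) \<open>C2 \<subseteq> C\<close> unfolding G_cone_eq_is_aut[OF S2] mem_Collect_eq
      by (elim is_aut_mono) auto
    have "analytic_aut g"
      unfolding g12(3) using analytic_op_iff_analytic_aut[OF S] g1 g2 C1(3) C2(3) by (intro analytic_aut_comp[OF S]) auto
    moreover have g: "is_aut {\<mu>. lattice_emb \<mu> \<in> C} g"
      unfolding g12(3) by (rule is_aut_comp[OF S g1 g2])
    ultimately show "g \<in> G_an Z V"
      unfolding G_an_def using C G_cone_eq_is_aut[OF S] analytic_op_iff_analytic_aut[OF S g] by auto
  qed
qed

end
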